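(* Let $\{T(t)\}_{t\ge 0}$ be a $C_0$-semigroup on a complex Banach space $(X,\|\cdot\|)$ with generator $A$. For $\{T(t)\}_{t\ge 0}$ to be uniformly exponentially stable it is necessary and, provided the semigroup is scalar type spectral or eventually norm-continuous (in particular, eventually compact, eventually differentiable, analytic, or uniformly continuous), sufficient that $$\{\lambda\in\mathbb{C} : \operatorname{Re}\lambda\ge 0\}\subseteq\rho(A)\quad\text{and}\quad \sup_{\operatorname{Re}\lambda\ge 0}\|R(\lambda,A)\|<\infty.$$
   Context: The norm of operators is the operator norm; $L(X)$ is the space of bounded linear operators on $X$. The resolvent set $\rho(A)$ is the set of $\lambda\in\mathbb{C}$ for which $R(\lambda,A):=(A-\lambda I)^{-1}$ exists in $L(X)$, and $\sigma(A)=\mathbb{C}\setminus\rho(A)$ is the spectrum. Uniformly exponentially stable: there exist $\omega<0$ and $M=M(\omega)\ge 1$ with $\|T(t)\|\le Me^{\omega t}$ for all $t\ge 0$. Eventually norm-continuous: for some $t_0>0$, the function $[t_0,\infty)\ni t\mapsto T(t)\in L(X)$ is continuous relative to the operator norm. The class of eventually norm-continuous $C_0$-semigroups encompasses the eventually compact, eventually differentiable, analytic, and uniformly continuous $C_0$-semigroups. Scalar type spectral operator: a densely defined closed linear operator $B$ in $X$ for which there is a strongly $\sigma$-additive spectral measure (resolution of the identity) $E_B(\cdot)$, assigning to each Borel subset of $\mathbb{C}$ a bounded projection operator on $X$ (with $E_B(\emptyset)=0$, $E_B(\mathbb{C})=I$, $E_B(\delta\cap\delta')=E_B(\delta)E_B(\delta')$),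 having $\sigma(B)$ as its support, and such that $B=\int_{\sigma(B)}\lambda\,dE_B(\lambda)$, i.e., $Bf=\lim_{n\to\infty}\int_{\{|\lambda|\le n\}}\lambda\,dE_B(\lambda)f$ with domain consisting of exactly those $f\in X$ for which this limit exists. Scalar type spectral $C_0$-semigroup: a $C_0$-semigroup of scalar type spectral operators; it is known that such a semigroup is generated by a scalar type spectral operator $A$, with $T(t)=e^{tA}=\int_{\sigma(A)}e^{t\lambda}\,dE_A(\lambda)$, $t\ge 0$. *)

theory Defs
  imports "HOL-Analysis.Analysis"
begin

section \<open>Complex Banach spaces and bounded linear operators\<close>

class complex_normed_vector = real_normed_vector +
  fixes scaleC :: "complex \<Rightarrow> 'a \<Rightarrow> 'a"  (infixr "*\<^sub>C" 75)
  assumes scaleC_add_right: "a *\<^sub>C (x + y) = a *\<^sub>C x + a *\<^sub>C y"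
    and scaleC_add_left: "(a + b) *\<^sub>C x = a *\<^sub>C x + b *\<^sub>C x"
    and scaleC_scaleC: "a *\<^sub>C b *\<^sub>C x = (a * b) *\<^sub>C x"
    and scaleC_of_real: "complex_of_real r *\<^sub>C x = r *\<^sub>R x"
    and norm_scaleC: "norm (a *\<^sub>C x) = cmod a * norm x"

class complex_banach = complex_normed_vector + banach

text \<open>
  The members of \<open>L(X)\<close> are the elements of \<open>'a \<Rightarrow>\<^sub>L 'a\<close> (bounded real-linear maps, normed
  by the operator norm) that commute with complex scalars.
\<close>

definition complex_linear :: "('a::complex_normed_vector \<Rightarrow>\<^sub>L 'a) \<Rightarrow> bool" where
  "complex_linear F \<longleftrightarrow> (\<forall>c x. blinfun_apply F (c *\<^sub>C x) = c *\<^sub>C blinfun_apply F x)"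

lift_definition scalar_op :: "complex \<Rightarrow> ('a::complex_normed_vector \<Rightarrow>\<^sub>L 'a)" is "\<lambda>c x. c *\<^sub>C x"
proof
  fix c :: complex and x y :: 'a and r :: real
  show "c *\<^sub>C (x + y) = c *\<^sub>C x + c *\<^sub>C y"
    by (rule scaleC_add_right)
  show "c *\<^sub>C (r *\<^sub>R x) = r *\<^sub>R (c *\<^sub>C x)"
    by (simp only: scaleC_of_real[symmetric] scaleC_scaleC mult.commute)
  show "\<exists>K. \<forall>x::'a. norm (c *\<^sub>C x) \<le> norm x * K"
    by (intro exI[of _ "cmod c"]) (simp add: norm_scaleC mult.commute)
qed

section \<open>Unbounded operators, resolvent and spectrum\<close>

text \<open>An operator in \<open>X\<close>, not necessarily everywhere defined, is represented by its graph.\<close>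

type_synonym 'a operator = "('a \<times> 'a) set"

definition linear_operator :: "'a::complex_normed_vector operator \<Rightarrow> bool" where
  "linear_operator B \<longleftrightarrow>
     single_valued B \<and> (0, 0) \<in> B \<and>
     (\<forall>x y x' y'. (x, y) \<in> B \<longrightarrow> (x', y') \<in> B \<longrightarrow> (x + x', y + y') \<in> B) \<and>
     (\<forall>c x y. (x, y) \<in> B \<longrightarrow> (c *\<^sub>C x, c *\<^sub>C y) \<in> B)"

definition bounded_operator :: "('a::complex_normed_vector \<Rightarrow>\<^sub>L 'a) \<Rightarrow> 'a operator" where
  "bounded_operator F = {(x, blinfun_apply F x) | x. True}"

text \<open>\<open>R\<close> is a two-sided inverse of \<open>B - \<lambda>I\<close>, expressed as equality of graphs.\<close>

definition is_resolvent ::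
    "'a::complex_normed_vector operator \<Rightarrow> complex \<Rightarrow> ('a \<Rightarrow>\<^sub>L 'a) \<Rightarrow> bool" where
  "is_resolvent B l R \<longleftrightarrow>
     complex_linear R \<and> bounded_operator R = {(y - l *\<^sub>C x, x) | x y. (x, y) \<in> B}"

definition resolvent_set :: "'a::complex_normed_vector operator \<Rightarrow> complex set" where
  "resolvent_set B = {l. \<exists>R. is_resolvent B l R}"

definition spectrum :: "'a::complex_normed_vector operator \<Rightarrow> complex set" where
  "spectrum B = - resolvent_set B"

definition resolvent ::
    "complex \<Rightarrow> 'a::complex_normed_vector operator \<Rightarrow> ('a \<Rightarrow>\<^sub>L 'a)" where
  "resolvent l B = (THE R. is_resolvent B l R)"

section \<open>Scalar type spectral operators\<close>

text \<open>
  Only the values of \<open>E\<close> on Borel sets matter.  Idempotence of each \<open>E \<delta>\<close> is the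
  instance \<open>\<delta>' = \<delta>\<close> of multiplicativity.
\<close>

definition spectral_measure :: "(complex set \<Rightarrow> ('a::complex_banach \<Rightarrow>\<^sub>L 'a)) \<Rightarrow> bool" where
  "spectral_measure E \<longleftrightarrow>
     (\<forall>\<delta>\<in>sets borel. complex_linear (E \<delta>)) \<and>
     E {} = 0 \<and> E UNIV = id_blinfun \<and>
     (\<forall>\<delta>\<in>sets borel. \<forall>\<delta>'\<in>sets borel. E (\<delta> \<inter> \<delta>') = E \<delta> o\<^sub>L E \<delta>') \<and>
     (\<forall>\<delta> :: nat \<Rightarrow> complex set. range \<delta> \<subseteq> sets borel \<longrightarrow> disjoint_family \<delta> \<longrightarrow>
        (\<forall>x. (\<lambda>n. blinfun_apply (E (\<delta> n)) x) sums blinfun_apply (E (\<Union>n. \<delta> n)) x))"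

text \<open>The complement of the largest open set on which \<open>E\<close> vanishes.\<close>

definition spectral_support :: "(complex set \<Rightarrow> ('a::complex_banach \<Rightarrow>\<^sub>L 'a)) \<Rightarrow> complex set" where
  "spectral_support E = {z. \<forall>U. open U \<longrightarrow> z \<in> U \<longrightarrow> E U \<noteq> 0}"

text \<open>
  The integral of a bounded Borel function: the limit, in operator norm, of the integrals of
  Borel simple functions converging to it uniformly.
\<close>

definition simple_spectral_integral ::
    "(complex set \<Rightarrow> ('a::complex_banach \<Rightarrow>\<^sub>L 'a)) \<Rightarrow> (complex \<Rightarrow> complex) \<Rightarrow> ('a \<Rightarrow>\<^sub>L 'a)" where
  "simple_spectral_integral E s = (\<Sum>c\<in>range s. scalar_op c o\<^sub>L E (s -` {c}))"

definition has_spectral_integral ::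
    "(complex set \<Rightarrow> ('a::complex_banach \<Rightarrow>\<^sub>L 'a)) \<Rightarrow> (complex \<Rightarrow> complex) \<Rightarrow> ('a \<Rightarrow>\<^sub>L 'a) \<Rightarrow> bool" where
  "has_spectral_integral E f S \<longleftrightarrow>
     (\<exists>s :: nat \<Rightarrow> complex \<Rightarrow> complex.
        (\<forall>n. simple_function borel (s n)) \<and>
        uniform_limit UNIV s f sequentially \<and>
        (\<lambda>n. simple_spectral_integral E (s n)) \<longlonglongrightarrow> S)"

definition spectral_integral_id :: "(complex set \<Rightarrow> ('a::complex_banach \<Rightarrow>\<^sub>L 'a)) \<Rightarrow> 'a operator" where
  "spectral_integral_id E =
     {(x, y). \<exists>S :: nat \<Rightarrow> ('a \<Rightarrow>\<^sub>L 'a).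
        (\<forall>n. has_spectral_integral E (\<lambda>z. if cmod z \<le> real n then z else 0) (S n)) \<and>
        (\<lambda>n. blinfun_apply (S n) x) \<longlonglongrightarrow> y}"

definition scalar_type_spectral :: "'a::complex_banach operator \<Rightarrow> bool" where
  "scalar_type_spectral B \<longleftrightarrow>
     linear_operator B \<and> closed B \<and> closure (Domain B) = UNIV \<and>
     (\<exists>E. spectral_measure E \<and> spectral_support E = spectrum B \<and> B = spectral_integral_id E)"

section \<open>Strongly continuous semigroups\<close>

text \<open>A semigroup is a function on \<open>real\<close>; its values at negative arguments are unconstrained.\<close>

definition C0_semigroup :: "(real \<Rightarrow> ('a::complex_banach \<Rightarrow>\<^sub>L 'a)) \<Rightarrow> bool" where
  "C0_semigroup T \<longleftrightarrow>
     (\<forall>t\<ge>0. complex_linear (T t)) \<and>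
     T 0 = id_blinfun \<and>
     (\<forall>s\<ge>0. \<forall>t\<ge>0. T (s + t) = T s o\<^sub>L T t) \<and>
     (\<forall>x. ((\<lambda>t. blinfun_apply (T t) x) \<longlongrightarrow> x) (at_right 0))"

definition generator :: "(real \<Rightarrow> ('a::complex_banach \<Rightarrow>\<^sub>L 'a)) \<Rightarrow> 'a operator" where
  "generator T = {(x, y). ((\<lambda>t. (blinfun_apply (T t) x - x) /\<^sub>R t) \<longlongrightarrow> y) (at_right 0)}"

definition uniformly_exponentially_stable :: "(real \<Rightarrow> ('a::complex_banach \<Rightarrow>\<^sub>L 'a)) \<Rightarrow> bool" where
  "uniformly_exponentially_stable T \<longleftrightarrow>
     (\<exists>\<omega><0. \<exists>M\<ge>1. \<forall>t\<ge>0. norm (T t) \<le> M * exp (\<omega> * t))"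

definition scalar_type_spectral_semigroup :: "(real \<Rightarrow> ('a::complex_banach \<Rightarrow>\<^sub>L 'a)) \<Rightarrow> bool" where
  "scalar_type_spectral_semigroup T \<longleftrightarrow>
     C0_semigroup T \<and> (\<forall>t\<ge>0. scalar_type_spectral (bounded_operator (T t)))"

definition eventually_norm_continuous :: "(real \<Rightarrow> ('a::complex_banach \<Rightarrow>\<^sub>L 'a)) \<Rightarrow> bool" where
  "eventually_norm_continuous T \<longleftrightarrow> (\<exists>t0>0. continuous_on {t0..} T)"

definition eventually_compact :: "(real \<Rightarrow> ('a::complex_banach \<Rightarrow>\<^sub>L 'a)) \<Rightarrow> bool" where
  "eventually_compact T \<longleftrightarrow> (\<exists>t0>0. compact (closure (blinfun_apply (T t0) ` cball 0 1)))"

definition eventually_differentiable :: "(real \<Rightarrow> ('a::complex_banach \<Rightarrow>\<^sub>L 'a)) \<Rightarrow> bool" where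
  "eventually_differentiable T \<longleftrightarrow>
     (\<exists>t0\<ge>0. \<forall>x. \<forall>t>t0. (\<lambda>s. blinfun_apply (T s) x) differentiable (at t))"

definition uniformly_continuous_semigroup :: "(real \<Rightarrow> ('a::complex_banach \<Rightarrow>\<^sub>L 'a)) \<Rightarrow> bool" where
  "uniformly_continuous_semigroup T \<longleftrightarrow> continuous_on {0..} T"

definition sector :: "real \<Rightarrow> complex set" where
  "sector \<delta> = {z. z \<noteq> 0 \<and> \<bar>Arg z\<bar> < \<delta>}"

text \<open>
  \<open>T\<close> extends to a sector, holomorphically for the operator norm (the Frechet derivative at
  each point is multiplication by an operator \<open>D\<close>) and strongly continuously at the vertex
  along every smaller sector.
\<close>

definition analytic_semigroup :: "(real \<Rightarrow> ('a::complex_banach \<Rightarrow>\<^sub>L 'a)) \<Rightarrow> bool" where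
  "analytic_semigroup T \<longleftrightarrow>
     (\<exists>\<delta>. \<exists>S :: complex \<Rightarrow> ('a \<Rightarrow>\<^sub>L 'a).
        0 < \<delta> \<and> \<delta> \<le> pi / 2 \<and>
        (\<forall>t\<ge>0. S (complex_of_real t) = T t) \<and>
        (\<forall>z\<in>sector \<delta>. complex_linear (S z)) \<and>
        (\<forall>z\<in>sector \<delta>. \<forall>w\<in>sector \<delta>. S (z + w) = S z o\<^sub>L S w) \<and>
        (\<forall>z\<in>sector \<delta>. \<exists>D. (S has_derivative (\<lambda>h. scalar_op h o\<^sub>L D)) (at z)) \<and>
        (\<forall>\<delta>'. 0 < \<delta>' \<longrightarrow> \<delta>' < \<delta> \<longrightarrow>
           (\<forall>x. ((\<lambda>z. blinfun_apply (S z) x) \<longlongrightarrow> x) (at 0 within sector \<delta>'))))"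

end

theory Submission
  imports Defs
begin

text \<open>
  Boundedness of the resolvent is used only through the estimate \<open>\<parallel>x\<parallel> \<le> C \<parallel>A x - l x\<parallel>\<close>. If it holds
  for \<open>Re l \<ge> 0\<close>, the triangle inequality extends it, with \<open>2 C\<close>, to a strip \<open>Re l \<ge> - \<epsilon>\<close>
  (\<open>bounded_resolvent_estimate\<close>). Such estimates are then turned into growth bounds by a discrete
  form of Cauchy's estimates for the resolvent (\<open>power_bound\<close>): if
  \<open>\<parallel>y\<parallel> \<le> C \<parallel>y - w D y\<parallel>\<close> for all \<open>y\<close> in a \<open>D\<close>-invariant subspace and all \<open>\<bar>w\<bar> \<le> r\<close>, then
  \<open>r\<^sup>n \<parallel>D\<^sup>n y\<parallel> \<le> C \<parallel>y\<parallel>\<close> there. Averages over roots of unity take the place of contour integrals.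

  \<^emph>\<open>Eventually norm-continuous semigroups.\<close> Let \<open>w = exp (- \<mu>)\<close> with \<open>\<bar>w\<bar> \<le> exp \<epsilon>\<close> and
  \<open>\<delta> = x - w T(1) x\<close>. The Fourier coefficients over \<open>[0, 1]\<close> of \<open>s \<mapsto> exp (- \<mu> s) T(s) x\<close> are
  mapped to \<open>- \<delta>\<close> by \<open>A - (\<mu> + 2 \<pi> i k)\<close>, hence all of them are bounded by \<open>C \<parallel>\<delta>\<parallel>\<close>
  (\<open>window_transform_bound\<close>). Applying \<open>T(t\<^sub>0)\<close> makes these functions equicontinuous, uniformly in the
  unit ball, so one of their values is recovered up to a small error from finitely many Fourier
  coefficients. This bounds \<open>\<parallel>x\<parallel>\<close> by a multiple of \<open>\<parallel>\<delta>\<parallel>\<close> (\<open>norm_continuous_a_priori\<close>), and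
  \<open>power_bound\<close> for \<open>D = T(1)\<close> gives \<open>\<parallel>T(n)\<parallel> \<le> K exp (- \<epsilon> n)\<close>.

  \<^emph>\<open>Scalar type spectral semigroups.\<close> The argument only involves the resolution of the identity
  \<open>E\<close> of \<open>T(1)\<close>. Fix \<open>exp (- \<epsilon>) < \<rho> < 1\<close> and let \<open>Y\<close> be the range of \<open>E {z. \<rho> \<le> \<bar>z\<bar>}\<close>. On \<open>Y\<close> the
  operator \<open>T(1)\<close> has an inverse whose \<open>n\<close>-th power is \<open>O (\<rho>\<^sup>-\<^sup>n)\<close>, so orbits in \<open>Y\<close> extend to negative
  times and satisfy the estimate \<open>\<parallel>x\<parallel> \<le> C \<parallel>A x - l x\<parallel>\<close> for \<open>Re l \<le> - \<epsilon>\<close> as well. The resolvent of the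
  part of \<open>A\<close> in \<open>Y\<close> would thus be bounded on the whole plane, and by Liouville's theorem \<open>Y = 0\<close>; here this
  is \<open>power_bound\<close> for \<open>D = R(0, A)\<close> with arbitrarily large \<open>r\<close> (\<open>scalar_type_stable\<close>). What is
  left of \<open>T(1)\<close> lives on \<open>\<bar>z\<bar> < \<rho>\<close>, whence \<open>\<parallel>T(n)\<parallel> \<le> K \<rho>\<^sup>n\<close>.

  \<^emph>\<open>Necessity.\<close> If \<open>\<parallel>T(b)\<parallel> \<le> 1/2\<close>, then for \<open>Re l \<ge> 0\<close> the operator \<open>exp (- l b) T(b) - I\<close> has an
  inverse of norm at most \<open>2\<close>, and it equals \<open>A - l\<close> applied to a Laplace integral over \<open>[0, b]\<close>.

  \<^emph>\<open>Sufficient conditions for eventual norm continuity.\<close> Compactness of \<open>T(t\<^sub>0)\<close> upgrades strong to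
  uniform continuity on the image of the unit ball; differentiability of all orbits upgrades, by the
  uniform boundedness principle, to a Lipschitz estimate in norm. Analytic and uniformly continuous
  semigroups are norm-continuous on \<open>[1, \<infinity>)\<close> outright.
\<close>

section \<open>Complex scalars and uniform boundedness\<close>

lemma bounded_bilinear_scaleC [bounded_bilinear]:
  "bounded_bilinear (scaleC :: complex \<Rightarrow> 'a::complex_normed_vector \<Rightarrow> 'a)"
proof
  fix a a' :: complex and b b' :: 'a and r :: real
  show "(a + a') *\<^sub>C b = a *\<^sub>C b + a' *\<^sub>C b" by (rule scaleC_add_left)
  show "a *\<^sub>C (b + b') = a *\<^sub>C b + a *\<^sub>C b'" by (rule scaleC_add_right)
  show "(r *\<^sub>R a) *\<^sub>C b = r *\<^sub>R a *\<^sub>C b"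
    by (simp only: scaleR_conv_of_real scaleC_of_real scaleC_scaleC[symmetric])
  show "a *\<^sub>C r *\<^sub>R b = r *\<^sub>R a *\<^sub>C b"
    by (simp only: scaleC_of_real[symmetric] scaleC_scaleC mult.commute)
  show "\<exists>K. \<forall>(a::complex) (b::'a). norm (a *\<^sub>C b) \<le> norm a * norm b * K"
    by (rule exI[of _ 1]) (simp add: norm_scaleC)
qed

interpretation scaleC: bounded_bilinear
  "scaleC :: complex \<Rightarrow> 'a::complex_normed_vector \<Rightarrow> 'a"
  by (rule bounded_bilinear_scaleC)

lemma scaleC_one [simp]: "1 *\<^sub>C (x::'a::complex_normed_vector) = x"
  using scaleC_of_real[of 1 x] by simp

lemma scalar_op_apply [simp]: "blinfun_apply (scalar_op c) x = c *\<^sub>C x"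
  by (simp add: scalar_op.rep_eq)

lemma complex_linearD: "complex_linear F \<Longrightarrow> blinfun_apply F (c *\<^sub>C x) = c *\<^sub>C blinfun_apply F x"
  by (simp add: complex_linear_def)

lemma continuous_on_scalar_op [continuous_intros]:
  assumes "continuous_on S f"
  shows "continuous_on S (\<lambda>x. scalar_op (f x) :: 'a::complex_normed_vector \<Rightarrow>\<^sub>L 'a)"
proof -
  have "bounded_linear (scalar_op :: complex \<Rightarrow> 'a \<Rightarrow>\<^sub>L 'a)"
  proof (rule bounded_linear_intro[where K=1])
    show "scalar_op (x + y) = (scalar_op x + scalar_op y :: 'a \<Rightarrow>\<^sub>L 'a)" for x y
      by (rule blinfun_eqI) (simp add: blinfun.add_left scaleC_add_left)
    show "scalar_op (r *\<^sub>R x) = (r *\<^sub>R scalar_op x :: 'a \<Rightarrow>\<^sub>L 'a)" for r x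
      by (rule blinfun_eqI) (simp add: blinfun.scaleR_left scaleC.scaleR_left)
    show "norm (scalar_op x :: 'a \<Rightarrow>\<^sub>L 'a) \<le> norm x * 1" for x
      by (rule norm_blinfun_bound) (simp_all add: norm_scaleC)
  qed
  then show ?thesis by (rule bounded_linear.continuous_on[OF _ assms])
qed

lemma norm_scalar_op_comp_le: "norm (scalar_op c o\<^sub>L F) \<le> cmod c * norm (F :: 'a::complex_normed_vector \<Rightarrow>\<^sub>L 'a)"
  by (rule norm_blinfun_bound)
    (auto simp: norm_scaleC mult.assoc intro!: mult_left_mono norm_blinfun)

text \<open>
  By Baire's theorem one of the closed sets on which all members are bounded by \<open>n\<close> contains a ball;
  linearity moves this ball to the origin.
\<close>

lemma uniform_boundedness_principle:
  fixes F :: "'i \<Rightarrow> ('a::banach \<Rightarrow>\<^sub>L 'b::real_normed_vector)"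
  assumes bdd: "\<And>x. \<exists>K. \<forall>i\<in>I. norm (F i x) \<le> K"
  shows "\<exists>K. \<forall>i\<in>I. norm (F i) \<le> K"
proof -
  define C where "C n = {x. \<forall>i\<in>I. norm (F i x) \<le> real n}" for n
  have closed: "closed (C n)" for n
  proof -
    have "C n = (\<Inter>i\<in>I. {x. norm (F i x) \<le> real n})" unfolding C_def by auto
    then show ?thesis by (auto intro!: closed_INT closed_Collect_le continuous_intros)
  qed
  have cover: "(\<Union>(range C)) = UNIV"
  proof -
    have "\<exists>n. x \<in> C n" for x
    proof -
      obtain K where K: "\<forall>i\<in>I. norm (F i x) \<le> K" using bdd by blast
      obtain n where "K \<le> real n" using real_arch_simple by blast
      then have "x \<in> C n" using K unfolding C_def by force
      then show ?thesis ..
    qed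
    then show ?thesis by blast
  qed
  have "\<exists>n. interior (C n) \<noteq> {}"
  proof (rule ccontr)
    assume *: "\<not> ?thesis"
    have "(euclidean::'a topology) interior_of \<Union>(range C) = {}"
      by (rule Baire_category_alt) (use closed * completely_metrizable_space_euclidean in auto)
    then show False using cover by simp
  qed
  then obtain n x e where e: "e > 0" "cball x e \<subseteq> C n"
    unfolding ex_in_conv[symmetric] mem_interior_cball by blast
  have "norm (F i) \<le> 2 * real n / e" if i: "i \<in> I" for i
  proof (rule norm_blinfun_bound)
    fix y :: 'a
    show "norm (F i y) \<le> 2 * real n / e * norm y"
    proof (cases "y = 0")
      case False
      define z where "z = (e / norm y) *\<^sub>R y"
      have "x + z \<in> cball x e" "x \<in> cball x e" using False e by (auto simp: z_def dist_norm)
      then have "norm (F i (x + z)) \<le> n" "norm (F i x) \<le> n"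
        using subsetD[OF e(2)] i unfolding C_def by blast+
      then have "norm (F i z) \<le> 2 * n"
        using norm_triangle_ineq4[of "F i (x + z)" "F i x"] by (simp add: blinfun.add_right)
      then have "e / norm y * norm (F i y) \<le> 2 * n"
        using e by (simp add: z_def blinfun.scaleR_right)
      then show ?thesis using e False by (simp add: field_simps)
    qed simp
  qed (use e in auto)
  then show ?thesis by blast
qed

lemma linear_operatorD:
  assumes "linear_operator B"
  shows "(x, y) \<in> B \<Longrightarrow> (x, y') \<in> B \<Longrightarrow> y = y'"
    and "(0, 0) \<in> B"
    and "(x, y) \<in> B \<Longrightarrow> (x', y') \<in> B \<Longrightarrow> (x + x', y + y') \<in> B"
    and "(x, y) \<in> B \<Longrightarrow> (c *\<^sub>C x, c *\<^sub>C y) \<in> B"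
  using assms unfolding linear_operator_def single_valued_def by blast+

lemma is_resolvent_unique:
  assumes "is_resolvent A l R" "is_resolvent A l R'" shows "R = R'"
proof (rule blinfun_eqI)
  fix x
  have "bounded_operator R = bounded_operator R'" using assms by (simp add: is_resolvent_def)
  moreover have "(x, R x) \<in> bounded_operator R" by (auto simp: bounded_operator_def)
  ultimately show "R x = R' x" by (auto simp: bounded_operator_def)
qed

lemma resolvent_eq: "is_resolvent A l R \<Longrightarrow> resolvent l A = R"
  unfolding resolvent_def by (blast intro: is_resolvent_unique)

lemma is_resolvent_iff:
  "is_resolvent A l R \<longleftrightarrow> complex_linear R \<and>
     (\<forall>z. \<exists>y. (R z, y) \<in> A \<and> z = y - l *\<^sub>C R z) \<and> (\<forall>x y. (x, y) \<in> A \<longrightarrow> R (y - l *\<^sub>C x) = x)"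
  (is "_ \<longleftrightarrow> _ \<and> ?onto \<and> ?inv")
proof -
  have "bounded_operator R = {(y - l *\<^sub>C x, x) | x y. (x, y) \<in> A} \<longleftrightarrow> ?onto \<and> ?inv"
  proof
    assume eq: "bounded_operator R = {(y - l *\<^sub>C x, x) | x y. (x, y) \<in> A}"
    have "(z, R z) \<in> {(y - l *\<^sub>C x, x) | x y. (x, y) \<in> A}" for z
      unfolding eq[symmetric] by (auto simp: bounded_operator_def)
    moreover have "(y - l *\<^sub>C x, x) \<in> bounded_operator R" if "(x, y) \<in> A" for x y
      unfolding eq using that by auto
    moreover have "R w = x" if "(w, x) \<in> bounded_operator R" for w x
      using that by (auto simp: bounded_operator_def)
    ultimately show "?onto \<and> ?inv" by blast
  next
    assume "?onto \<and> ?inv"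
    then have onto: ?onto and inv: ?inv by auto
    show "bounded_operator R = {(y - l *\<^sub>C x, x) | x y. (x, y) \<in> A}"
    proof (intro equalityI subsetI)
      fix p assume "p \<in> bounded_operator R"
      then obtain z where "p = (z, R z)" by (auto simp: bounded_operator_def)
      moreover obtain y where "(R z, y) \<in> A" "z = y - l *\<^sub>C R z" using onto by metis
      ultimately show "p \<in> {(y - l *\<^sub>C x, x) | x y. (x, y) \<in> A}" by blast
    qed (use inv in \<open>auto simp: bounded_operator_def\<close>)
  qed
  then show ?thesis unfolding is_resolvent_def by blast
qed

lemma is_resolventD:
  assumes "is_resolvent A l R"
  shows "complex_linear R"
    and "(R z, z + l *\<^sub>C R z) \<in> A"
    and "(x, y) \<in> A \<Longrightarrow> R (y - l *\<^sub>C x) = x"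
proof -
  note * = assms[unfolded is_resolvent_iff]
  show "complex_linear R" "(x, y) \<in> A \<Longrightarrow> R (y - l *\<^sub>C x) = x" using * by auto
  obtain y where "(R z, y) \<in> A" "z = y - l *\<^sub>C R z" using * by metis
  then show "(R z, z + l *\<^sub>C R z) \<in> A" by (metis diff_add_cancel)
qed

text \<open>
  The estimate makes \<open>A - l\<close> injective, so that surjectivity defines an inverse, and it is at the
  same time the norm bound for this inverse.
\<close>

lemma resolvent_set_criterion:
  fixes A :: "'a::complex_normed_vector operator"
  assumes lin: "linear_operator A"
    and onto: "\<And>z. \<exists>x y. (x, y) \<in> A \<and> y - l *\<^sub>C x = z"
    and est: "\<And>x y. (x, y) \<in> A \<Longrightarrow> norm x \<le> C * norm (y - l *\<^sub>C x)" and C: "C \<ge> 0"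
  shows "l \<in> resolvent_set A" and "norm (resolvent l A) \<le> C"
proof -
  note L = linear_operatorD[OF lin]
  have "\<forall>z. \<exists>x. (x, z + l *\<^sub>C x) \<in> A" 
    using onto by (metis diff_add_cancel)
  then obtain r where r: "\<And>z. (r z, z + l *\<^sub>C r z) \<in> A" by metis
  have minus: "(- x, - y) \<in> A" if "(x, y) \<in> A" for x y
    using L(4)[OF that, of "-1"] by (simp add: scaleC.minus_left)
  have uniq: "x = r z" if "(x, z + l *\<^sub>C x) \<in> A" for x z
  proof -
    have "(x + (- r z), (z + l *\<^sub>C x) + (- (z + l *\<^sub>C r z))) \<in> A"
      using L(3)[OF that minus[OF r]] .
    from est[OF this] have "norm (x - r z) \<le> 0" by (simp add: scaleC.diff_right)
    then show ?thesis by simp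
  qed
  have add: "r (z + w) = r z + r w" for z w
    using uniq[of "r z + r w" "z + w"] L(3)[OF r[of z] r[of w]]
    by (simp add: scaleC_add_right algebra_simps)
  have scale: "r (c *\<^sub>C z) = c *\<^sub>C r z" for c z
    using uniq[of "c *\<^sub>C r z" "c *\<^sub>C z"] L(4)[OF r[of z], of c]
    by (simp add: scaleC_add_right scaleC_scaleC mult.commute)
  have bound: "norm (r z) \<le> C * norm z" for z
    using est[OF r[of z]] by simp
  have bl: "bounded_linear r"
    by (rule bounded_linear_intro[where K=C])
      (use add scale[of "of_real _"] bound in \<open>auto simp: scaleC_of_real mult.commute\<close>)
  have app: "blinfun_apply (Blinfun r) = r" using bl by (simp add: bounded_linear_Blinfun_apply)
  have "is_resolvent A l (Blinfun r)"
    unfolding is_resolvent_iff complex_linear_def app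
  proof (intro conjI allI impI)
    show "\<exists>y. (r z, y) \<in> A \<and> z = y - l *\<^sub>C r z" for z using r[of z] by force
    show "r (y - l *\<^sub>C x) = x" if "(x, y) \<in> A" for x y using uniq[of x "y - l *\<^sub>C x"] that by simp
  qed (rule scale)
  then show "l \<in> resolvent_set A" "norm (resolvent l A) \<le> C"
    using resolvent_eq[of A l "Blinfun r"] norm_blinfun_bound[OF C, of "Blinfun r"] bound
    by (auto simp: resolvent_set_def app)
qed

section \<open>Strongly continuous semigroups and their generators\<close>

lemma filterlim_dist_at_right:
  fixes t :: real shows "filterlim (\<lambda>s. \<bar>s - t\<bar>) (at_right 0) (at t within S)"
  unfolding filterlim_at
proof
  have "((\<lambda>s. \<bar>s - t\<bar>) \<longlongrightarrow> \<bar>t - t\<bar>) (at t within S)" by (intro tendsto_intros)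
  then show "((\<lambda>s. \<bar>s - t\<bar>) \<longlongrightarrow> 0) (at t within S)" by simp
  show "\<forall>\<^sub>F s in at t within S. \<bar>s - t\<bar> \<in> {0<..} \<and> \<bar>s - t\<bar> \<noteq> 0"
    by (auto simp: eventually_at_filter)
qed

locale c0_semigroup =
  fixes T :: "real \<Rightarrow> ('a::complex_banach \<Rightarrow>\<^sub>L 'a)"
  assumes C0: "C0_semigroup T"
begin

lemma T_linear: "t \<ge> 0 \<Longrightarrow> complex_linear (T t)"
  and T_zero [simp]: "T 0 = id_blinfun"
  and T_at_zero: "((\<lambda>t. T t x) \<longlongrightarrow> x) (at_right 0)"
  using C0 unfolding C0_semigroup_def by blast+

lemma T_add: "s \<ge> 0 \<Longrightarrow> t \<ge> 0 \<Longrightarrow> T (s + t) x = T s (T t x)"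
  using C0 unfolding C0_semigroup_def by simp

lemma T_scaleC: "t \<ge> 0 \<Longrightarrow> T t (c *\<^sub>C x) = c *\<^sub>C T t x"
  by (rule complex_linearD[OF T_linear])

lemma T_power: "t \<ge> 0 \<Longrightarrow> T (real n * t) x = (blinfun_apply (T t) ^^ n) x"
proof (induction n)
  case (Suc n)
  then show ?case using T_add[of t "real n * t" x] by (simp add: algebra_simps)
qed simp

lemma T_commute: "s \<ge> 0 \<Longrightarrow> t \<ge> 0 \<Longrightarrow> T s (T t x) = T t (T s x)"
  by (simp add: add.commute flip: T_add)

text \<open>
  Were \<open>T\<close> unbounded near \<open>0\<close>, there would be operators \<open>T (t n)\<close> with \<open>t n \<rightarrow> 0\<close> and unbounded norms,
  although they converge strongly to the identity. The semigroup law carries a bound near \<open>0\<close> to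
  every bounded interval.
\<close>

lemma locally_bounded: "\<exists>M\<ge>1. \<forall>t. 0 \<le> t \<longrightarrow> t \<le> b \<longrightarrow> norm (T t) \<le> M"
proof -
  have "\<exists>n::nat. \<forall>t. 0 \<le> t \<and> t \<le> 1 / Suc n \<longrightarrow> norm (T t) \<le> n"
  proof (rule ccontr)
    assume "\<not> ?thesis"
    then have "\<forall>n::nat. \<exists>t. 0 \<le> t \<and> t \<le> 1 / Suc n \<and> norm (T t) > n" by (force simp: not_le)
    then obtain t where t: "\<And>n::nat. 0 \<le> t n" "\<And>n. t n \<le> 1 / Suc n" "\<And>n. norm (T (t n)) > n"
      by metis
    have "t \<longlonglongrightarrow> 0"
      by (rule tendsto_sandwich[OF _ _ tendsto_const LIMSEQ_inverse_real_of_nat])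
        (use t in \<open>auto simp: inverse_eq_divide\<close>)
    have "\<exists>K. \<forall>n\<in>UNIV. norm (T (t n) x) \<le> K" for x
    proof -
      have "continuous (at 0 within {0..}) (\<lambda>t. T t x)"
        using T_at_zero[of x] by (simp add: continuous_within at_within_Ici_at_right)
      then have "(\<lambda>n. T (t n) x) \<longlonglongrightarrow> T 0 x"
        using \<open>t \<longlonglongrightarrow> 0\<close> t(1) unfolding continuous_within_sequentially comp_def by auto
      then have "Bseq (\<lambda>n. T (t n) x)" by (intro convergent_imp_Bseq) (auto simp: convergent_def)
      then show ?thesis by (auto simp: Bseq_def)
    qed
    from uniform_boundedness_principle[of UNIV "\<lambda>n. T (t n)", OF this]
    obtain K where K: "\<And>n. norm (T (t n)) \<le> K" by auto
    obtain n :: nat where "K \<le> n" using real_arch_simple by blast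
    with K[of n] t(3)[of n] show False by simp
  qed
  then obtain n :: nat where n: "\<And>t. 0 \<le> t \<Longrightarrow> t \<le> 1 / Suc n \<Longrightarrow> norm (T t) \<le> n" by blast
  define \<delta> K where "\<delta> = 1 / real (Suc n)" and "K = max 1 (real n)"
  have \<delta>: "\<delta> > 0" and K: "K \<ge> 1" and loc: "\<And>t. 0 \<le> t \<Longrightarrow> t \<le> \<delta> \<Longrightarrow> norm (T t) \<le> K"
    using n by (force simp: \<delta>_def K_def)+
  have pow: "norm (T t) \<le> K ^ Suc k" if "0 \<le> t" "t \<le> real k * \<delta>" for t k
    using that
  proof (induction k arbitrary: t)
    case 0
    then show ?case using loc[of t] \<delta> by simp
  next
    case (Suc k)
    show ?case
    proof (cases "t \<le> \<delta>")
      case True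
      then have "norm (T t) \<le> K" using loc Suc by simp
      also have "\<dots> \<le> K ^ Suc (Suc k)" using K power_increasing[of 1 "Suc (Suc k)" K] by simp
      finally show ?thesis .
    next
      case False
      have "T (\<delta> + (t - \<delta>)) = T \<delta> o\<^sub>L T (t - \<delta>)"
        by (rule blinfun_eqI) (use False \<delta> T_add[of \<delta> "t - \<delta>"] in simp)
      then have "norm (T t) \<le> norm (T \<delta>) * norm (T (t - \<delta>))"
        using norm_blinfun_compose[of "T \<delta>" "T (t - \<delta>)"] by simp
      also have "\<dots> \<le> K * K ^ Suc k"
        by (intro mult_mono loc Suc.IH) (use Suc.prems False \<delta> K in \<open>auto simp: algebra_simps\<close>)
      finally show ?thesis by simp
    qed
  qed
  obtain k :: nat where k: "b / \<delta> \<le> k" using real_arch_simple by blast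
  show ?thesis
  proof (intro exI conjI allI impI)
    show "1 \<le> K ^ Suc k" by (rule one_le_power[OF K])
    show "norm (T t) \<le> K ^ Suc k" if "0 \<le> t" "t \<le> b" for t
      by (rule pow) (use that k \<delta> in \<open>auto simp: field_simps\<close>)
  qed
qed

text \<open>
  Difference quotients from the left and from the right have a common form: a one-sided quotient at
  \<open>0\<close>, moved by the locally bounded factor \<open>T (min s t)\<close>. Continuity and differentiability of orbits
  at \<open>0\<close> from the right therefore give the two-sided statements.
\<close>

lemma T_difference:
  assumes "0 \<le> s" "0 \<le> t" "s \<noteq> t"
  shows "(T s x - T t x) /\<^sub>R (s - t) = T (min s t) ((T \<bar>s - t\<bar> x - x) /\<^sub>R \<bar>s - t\<bar>)"
proof (cases "t < s")
  case True
  then show ?thesis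
    using T_add[of t "s - t" x] assms by (simp add: blinfun.scaleR_right blinfun.diff_right)
next
  case False
  then have "s < t" using assms by simp
  moreover have "(T s x - T t x) /\<^sub>R (s - t) = (T t x - T s x) /\<^sub>R (t - s)"
    using scaleR_minus_left[of "inverse (t - s)" "T s x - T t x"]
    by (metis inverse_minus_eq minus_diff_eq scaleR_minus_left scaleR_minus_right)
  ultimately show ?thesis
    using T_add[of s "t - s" x] assms by (simp add: blinfun.scaleR_right blinfun.diff_right)
qed

lemma strongly_continuous: "continuous_on {0..} (\<lambda>t. T t x)"
  unfolding continuous_on
proof
  fix t :: real assume t: "t \<in> {0..}"
  obtain M where M: "M \<ge> 1" "\<And>s. 0 \<le> s \<Longrightarrow> s \<le> t + 1 \<Longrightarrow> norm (T s) \<le> M" using locally_bounded[of "t + 1"] by metis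
  have "((\<lambda>s. T \<bar>s - t\<bar> x) \<longlongrightarrow> x) (at t within {0..})"
    by (rule filterlim_compose[OF T_at_zero filterlim_dist_at_right])
  then have "((\<lambda>s. M * norm (T \<bar>s - t\<bar> x - x)) \<longlongrightarrow> M * norm (x - x)) (at t within {0..})"
    by (intro tendsto_intros)
  then have lim: "((\<lambda>s. M * norm (T \<bar>s - t\<bar> x - x)) \<longlongrightarrow> 0) (at t within {0..})" by simp
  have "\<forall>\<^sub>F s in at t within {0..}. norm (T s x - T t x) \<le> M * norm (T \<bar>s - t\<bar> x - x)"
    unfolding eventually_at
  proof (intro exI[of _ 1] conjI ballI impI)
    fix s :: real assume s: "s \<in> {0..}" "s \<noteq> t \<and> dist s t < 1"
    have "norm (T s x - T t x) / \<bar>s - t\<bar> = norm (T (min s t) (T \<bar>s - t\<bar> x - x)) / \<bar>s - t\<bar>"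
      using arg_cong[OF T_difference[of s t x], of norm] s t
      by (simp add: blinfun.scaleR_right divide_inverse mult.commute)
    then have "norm (T s x - T t x) = norm (T (min s t) (T \<bar>s - t\<bar> x - x))" using s by simp
    also have "\<dots> \<le> norm (T (min s t)) * norm (T \<bar>s - t\<bar> x - x)" by (rule norm_blinfun)
    also have "\<dots> \<le> M * norm (T \<bar>s - t\<bar> x - x)"
      by (intro mult_right_mono M) (use s t in auto)
    finally show "norm (T s x - T t x) \<le> M * norm (T \<bar>s - t\<bar> x - x)" .
  qed simp
  from Lim_null_comparison[OF this lim]
  have "((\<lambda>s. T s x - T t x) \<longlongrightarrow> 0) (at t within {0..})" .
  then show "((\<lambda>s. T s x) \<longlongrightarrow> T t x) (at t within {0..})" by (simp add: LIM_zero_iff)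
qed

lemma jointly_continuous: "continuous_on ({0..} \<times> UNIV) (\<lambda>p. T (fst p) (snd p))"
  unfolding continuous_on
proof
  fix p :: "real \<times> 'a" assume p: "p \<in> {0..} \<times> UNIV"
  let ?F = "at p within {0..} \<times> UNIV"
  obtain M where M: "M \<ge> 1" "\<And>s. 0 \<le> s \<Longrightarrow> s \<le> fst p + 1 \<Longrightarrow> norm (T s) \<le> M"
    using locally_bounded[of "fst p + 1"] by metis
  have "continuous_on ({0..} \<times> UNIV) (\<lambda>q::real \<times> 'a. T (fst q) (snd p))"
    by (rule continuous_on_compose2[OF strongly_continuous continuous_on_fst[OF continuous_on_id]]) auto
  then have 1: "((\<lambda>q. T (fst q) (snd p)) \<longlongrightarrow> T (fst p) (snd p)) ?F"
    using p unfolding continuous_on by auto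
  have "((\<lambda>q. M * norm (snd q - snd p)) \<longlongrightarrow> M * norm (snd p - snd p)) ?F"
    by (intro tendsto_intros)
  then have lim: "((\<lambda>q. M * norm (snd q - snd p)) \<longlongrightarrow> 0) ?F" by simp
  have "\<forall>\<^sub>F q in ?F. norm (T (fst q) (snd q - snd p)) \<le> M * norm (snd q - snd p)"
    unfolding eventually_at
  proof (intro exI[of _ 1] conjI ballI impI)
    fix q :: "real \<times> 'a" assume q: "q \<in> {0..} \<times> UNIV" "q \<noteq> p \<and> dist q p < 1"
    have "dist (fst q) (fst p) < 1" using q dist_fst_le[of q p] by simp
    then have "norm (T (fst q)) \<le> M" using q by (intro M) (auto simp: dist_real_def)
    then show "norm (T (fst q) (snd q - snd p)) \<le> M * norm (snd q - snd p)"
      by (rule order_trans[OF norm_blinfun mult_right_mono]) simp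
  qed simp
  from Lim_null_comparison[OF this lim]
  have "((\<lambda>q. T (fst q) (snd q - snd p)) \<longlongrightarrow> 0) ?F" .
  from tendsto_add[OF 1 this]
  show "((\<lambda>q. T (fst q) (snd q)) \<longlongrightarrow> T (fst p) (snd p)) ?F"
    by (simp add: blinfun.diff_right)
qed

lemma generatorD: "(x, y) \<in> generator T \<Longrightarrow> ((\<lambda>t. (T t x - x) /\<^sub>R t) \<longlongrightarrow> y) (at_right 0)"
  by (simp add: generator_def)

lemma generator_linear: "linear_operator (generator T)"
  unfolding linear_operator_def
proof (intro conjI allI impI)
  show "single_valued (generator T)"
    unfolding single_valued_def using generatorD tendsto_unique[OF trivial_limit_at_right_real] by blast
  show "(0, 0) \<in> generator T" by (simp add: generator_def)
  show "(x + x', y + y') \<in> generator T"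
    if "(x, y) \<in> generator T" "(x', y') \<in> generator T" for x y x' y'
    using tendsto_add[OF generatorD[OF that(1)] generatorD[OF that(2)]]
    by (simp add: generator_def blinfun.add_right algebra_simps)
  show "(c *\<^sub>C x, c *\<^sub>C y) \<in> generator T" if "(x, y) \<in> generator T" for c x y
  proof -
    have "((\<lambda>t. c *\<^sub>C ((T t x - x) /\<^sub>R t)) \<longlongrightarrow> c *\<^sub>C y) (at_right 0)"
      by (intro tendsto_intros generatorD that)
    moreover have "\<forall>\<^sub>F t in at_right 0. c *\<^sub>C ((T t x - x) /\<^sub>R t) = (T t (c *\<^sub>C x) - c *\<^sub>C x) /\<^sub>R t"
      using eventually_at_right_less[of 0]
      by eventually_elim (simp add: T_scaleC scaleC.scaleR_right scaleC.diff_right)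
    ultimately show ?thesis unfolding generator_def by (auto elim: Lim_transform_eventually)
  qed
qed

lemma T_has_vector_derivative:
  assumes u: "(x, y) \<in> generator T" and t: "t \<ge> 0"
  shows "((\<lambda>s. T s x) has_vector_derivative T t y) (at t within {0..})"
proof -
  let ?F = "at t within {0..}"
  obtain M where M: "M \<ge> 1" "\<And>s. 0 \<le> s \<Longrightarrow> s \<le> t + 1 \<Longrightarrow> norm (T s) \<le> M" using locally_bounded[of "t + 1"] by metis
  define q where "q s = (T \<bar>s - t\<bar> x - x) /\<^sub>R \<bar>s - t\<bar>" for s
  have q: "(q \<longlongrightarrow> y) ?F"
    unfolding q_def by (rule filterlim_compose[OF generatorD[OF u] filterlim_dist_at_right])
  have "continuous_on {0..} (\<lambda>s. T (min s t) y)"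
    by (rule continuous_on_compose2[OF strongly_continuous]) (use t in \<open>auto intro!: continuous_intros\<close>)
  then have "((\<lambda>s. T (min s t) y) \<longlongrightarrow> T (min t t) y) ?F"
    using t unfolding continuous_on by (drule_tac bspec[where x=t]) simp_all
  with q have "((\<lambda>s. M * norm (q s - y) + norm (T (min s t) y - T t y))
      \<longlongrightarrow> M * norm (y - y) + norm (T (min t t) y - T t y)) ?F"
    by (intro tendsto_add tendsto_mult tendsto_const tendsto_norm tendsto_diff)
  then have lim: "((\<lambda>s. M * norm (q s - y) + norm (T (min s t) y - T t y)) \<longlongrightarrow> 0) ?F" by simp
  have "\<forall>\<^sub>F s in ?F. norm (norm ((T s x - T t x) - (s - t) *\<^sub>R T t y) / norm (s - t))
      \<le> M * norm (q s - y) + norm (T (min s t) y - T t y)"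
    unfolding eventually_at
  proof (intro exI[of _ 1] conjI ballI impI)
    fix s :: real assume s: "s \<in> {0..}" "s \<noteq> t \<and> dist s t < 1"
    have "norm (norm ((T s x - T t x) - (s - t) *\<^sub>R T t y) / norm (s - t))
        = norm (((T s x - T t x) - (s - t) *\<^sub>R T t y) /\<^sub>R (s - t))"
      by (simp add: divide_inverse mult.commute)
    also have "((T s x - T t x) - (s - t) *\<^sub>R T t y) /\<^sub>R (s - t) = (T s x - T t x) /\<^sub>R (s - t) - T t y"
      using s by (simp add: scaleR_diff_right)
    also have "\<dots> = T (min s t) (q s - y) + (T (min s t) y - T t y)"
      using s t by (subst T_difference) (auto simp: q_def blinfun.diff_right)
    also have "norm \<dots> \<le> norm (T (min s t)) * norm (q s - y) + norm (T (min s t) y - T t y)"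
      by (rule order_trans[OF norm_triangle_ineq add_right_mono[OF norm_blinfun]])
    also have "\<dots> \<le> M * norm (q s - y) + norm (T (min s t) y - T t y)"
      by (intro add_right_mono mult_right_mono M) (use s t in auto)
    finally show "norm (norm ((T s x - T t x) - (s - t) *\<^sub>R T t y) / norm (s - t))
      \<le> M * norm (q s - y) + norm (T (min s t) y - T t y)" .
  qed simp
  from Lim_null_comparison[OF this lim]
  have "((\<lambda>s. norm ((T s x - T t x) - (s - t) *\<^sub>R T t y) / norm (s - t)) \<longlongrightarrow> 0) ?F" .
  then show ?thesis
    unfolding has_vector_derivative_def has_derivative_iff_norm
    by (simp add: bounded_linear_scaleR_left)
qed

text \<open>
  For the mean value inequality: \<open>s \<mapsto> exp (l (b - s)) T(s) x\<close> runs from \<open>exp (l b) x\<close> to \<open>T(b) x\<close>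
  and has derivative \<open>exp (l (b - s)) T(s) (y - l x)\<close>. A contraction property of \<open>T(b)\<close> or of an inverse of it
  turns this into a bound of \<open>\<parallel>x\<parallel>\<close> by \<open>\<parallel>y - l x\<parallel>\<close>.
\<close>

lemma exp_growth_estimate:
  assumes u: "(x, y) \<in> generator T" and b: "b \<ge> 0"
    and M: "\<And>t. 0 \<le> t \<Longrightarrow> t \<le> b \<Longrightarrow> norm (T t) \<le> M"
    and K: "\<And>s. 0 \<le> s \<Longrightarrow> s \<le> b \<Longrightarrow> exp (Re l * (b - s)) \<le> K"
  shows "norm (T b x - exp (l * of_real b) *\<^sub>C x) \<le> b * K * M * norm (y - l *\<^sub>C x)"
proof -
  define f where "f s = exp (l * of_real (b - s)) *\<^sub>C T s x" for s
  define f' where "f' s = exp (l * of_real (b - s)) *\<^sub>C T s (y - l *\<^sub>C x)" for s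
  have deriv: "(f has_vector_derivative f' s) (at s within {0..b})" if s: "s \<in> {0..b}" for s
  proof -
    have 1: "((\<lambda>s. T s x) has_vector_derivative T s y) (at s within {0..b})"
      by (rule has_vector_derivative_within_subset[OF T_has_vector_derivative[OF u]]) (use s in auto)
    have 2: "((\<lambda>s. exp (l * of_real (b - s))) has_vector_derivative - l * exp (l * of_real (b - s))) (at s within {0..b})"
    proof -
      have "((\<lambda>z. exp (l * (of_real b - z))) has_field_derivative - l * exp (l * (of_real b - of_real s))) (at (of_real s))"
        by (auto intro!: derivative_eq_intros)
      from has_vector_derivative_real_field[OF this] show ?thesis by simp
    qed
    from bounded_bilinear.has_vector_derivative[OF bounded_bilinear_scaleC 2 1] s
    show ?thesis unfolding f_def f'_def
      by (simp add: blinfun.diff_right T_scaleC scaleC.diff_right scaleC_scaleC scaleC.minus_left mult.commute)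
  qed
  have "norm (f b - f 0) \<le> K * M * norm (y - l *\<^sub>C x) * norm (b - 0)"
  proof (rule differentiable_bound[of "{0..b}"])
    show "(f has_derivative (\<lambda>h. h *\<^sub>R f' s)) (at s within {0..b})" if "s \<in> {0..b}" for s
      using deriv[OF that] by (simp add: has_vector_derivative_def)
    show "onorm (\<lambda>h. h *\<^sub>R f' s) \<le> K * M * norm (y - l *\<^sub>C x)" if s: "s \<in> {0..b}" for s
    proof (rule onorm_bound)
      have "norm (T s (y - l *\<^sub>C x)) \<le> M * norm (y - l *\<^sub>C x)"
        by (rule order_trans[OF norm_blinfun mult_right_mono[OF M]]) (use s in auto)
      moreover have "0 \<le> K" using K[of b] b by simp
      ultimately have "norm (f' s) \<le> K * (M * norm (y - l *\<^sub>C x))"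
        unfolding f'_def norm_scaleC by (intro mult_mono) (use s K[of s] in auto)
      then show "norm (h *\<^sub>R f' s) \<le> K * M * norm (y - l *\<^sub>C x) * norm h" for h
        by (simp add: mult.assoc mult.commute mult_left_mono)
      have "0 \<le> M" using M[of 0] b norm_ge_zero order_trans by blast
      with \<open>0 \<le> K\<close> show "0 \<le> K * M * norm (y - l *\<^sub>C x)" by simp
    qed
  qed (use b in auto)
  then show ?thesis using b by (simp add: f_def ac_simps)
qed

lemma integrable_T: "0 \<le> a \<Longrightarrow> (\<lambda>s. T s x) integrable_on {a..b}"
  by (intro integrable_continuous_real continuous_on_subset[OF strongly_continuous]) auto

text \<open>
  With \<open>V(h) = \<integral>\<^sub>0\<^sup>h T(s) x ds\<close> the semigroup law gives \<open>T(h) V(t) - V(t) = T(t) V(h) - V(h)\<close>, and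
  \<open>V(h) / h\<close> tends to \<open>x\<close>.
\<close>

lemma integral_in_generator:
  assumes t: "t \<ge> 0"
  shows "(integral {0..t} (\<lambda>s. T s x), T t x - x) \<in> generator T"
proof -
  define V where "V h = integral {0..h} (\<lambda>s. T s x)" for h
  have TV: "T a (V b) = V (a + b) - V a" if "0 \<le> a" "0 \<le> b" for a b
  proof -
    have "T a (V b) = integral {0..b} (\<lambda>s. T a (T s x))"
      unfolding V_def using integral_linear[OF integrable_T[of 0 x b] blinfun.bounded_linear_right[of "T a"]]
      by (simp add: comp_def)
    also have "\<dots> = integral {0..b} (\<lambda>s. T (s + a) x)"
      by (rule integral_cong) (use that in \<open>auto simp: add.commute simp flip: T_add\<close>)
    also have "\<dots> = integral {a..a + b} (\<lambda>s. T s x)"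
      using integral_shift_Icc_real[of 0 b "\<lambda>s. T s x" a] by (simp add: comp_def add.commute)
    also have "\<dots> = V (a + b) - V a"
      unfolding V_def using Henstock_Kurzweil_Integration.integral_combine[of 0 a "a + b" "\<lambda>s. T s x"] integrable_T[of 0 x "a + b"] that
      by (simp add: algebra_simps)
    finally show ?thesis .
  qed
  have V0: "((\<lambda>h. V h /\<^sub>R h) \<longlongrightarrow> x) (at_right 0)"
  proof -
    have "(V has_vector_derivative T 0 x) (at 0 within {0..1})"
      unfolding V_def by (rule integral_has_vector_derivative) (auto intro: continuous_on_subset[OF strongly_continuous])
    then have "((\<lambda>h. norm (V h - h *\<^sub>R x) / norm h) \<longlongrightarrow> 0) (at 0 within {0..1})"
      unfolding has_vector_derivative_def has_derivative_iff_norm by (simp add: V_def)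
    then have 0: "((\<lambda>h. norm (V h - h *\<^sub>R x) / norm h) \<longlongrightarrow> 0) (at_right 0)"
      by (simp add: at_within_Icc_at_right)
    have "((\<lambda>h. V h /\<^sub>R h - x) \<longlongrightarrow> 0) (at_right 0)"
    proof (rule Lim_null_comparison[OF _ 0])
      show "\<forall>\<^sub>F h in at_right 0. norm (V h /\<^sub>R h - x) \<le> norm (V h - h *\<^sub>R x) / norm h"
        using eventually_at_right_less[of 0]
      proof eventually_elim
        case (elim h)
        then have "V h /\<^sub>R h - x = (V h - h *\<^sub>R x) /\<^sub>R h" by (simp add: scaleR_diff_right)
        then show ?case by (simp add: divide_inverse mult.commute)
      qed
    qed
    then show ?thesis by (simp add: LIM_zero_iff)
  qed
  have "((\<lambda>h. T t (V h /\<^sub>R h) - V h /\<^sub>R h) \<longlongrightarrow> T t x - x) (at_right 0)"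
    by (intro tendsto_intros V0)
  moreover have "\<forall>\<^sub>F h in at_right 0. T t (V h /\<^sub>R h) - V h /\<^sub>R h = (T h (V t) - V t) /\<^sub>R h"
    using eventually_at_right_less[of 0]
  proof eventually_elim
    case (elim h)
    then have "T t (V h) - V h = T h (V t) - V t" using TV[of t h] TV[of h t] t by (simp add: add.commute)
    then show ?case by (simp add: blinfun.scaleR_right flip: scaleR_diff_right)
  qed
  ultimately show ?thesis
    unfolding generator_def V_def[symmetric] by (auto elim: Lim_transform_eventually)
qed

lemma rescaled_C0: "C0_semigroup (\<lambda>t. scalar_op (exp (- l * of_real t)) o\<^sub>L T t)"
  unfolding C0_semigroup_def
proof (intro conjI allI impI)
  show "complex_linear (scalar_op (exp (- l * of_real t)) o\<^sub>L T t)" if "0 \<le> t" for t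
    using that by (simp add: complex_linear_def T_scaleC scaleC_scaleC mult.commute)
  show "scalar_op (exp (- l * of_real 0)) o\<^sub>L T 0 = id_blinfun"
    by (rule blinfun_eqI) simp
  show "scalar_op (exp (- l * of_real (s + t))) o\<^sub>L T (s + t)
      = (scalar_op (exp (- l * of_real s)) o\<^sub>L T s) o\<^sub>L (scalar_op (exp (- l * of_real t)) o\<^sub>L T t)"
    if "0 \<le> s" "0 \<le> t" for s t
    by (rule blinfun_eqI)
      (use that in \<open>simp add: T_add T_scaleC scaleC_scaleC distrib_left exp_add exp_diff exp_minus field_simps\<close>)
  fix x
  have "((\<lambda>t. exp (- l * of_real t)) \<longlongrightarrow> exp (- l * of_real 0)) (at_right 0)"
    by (intro tendsto_intros)
  then have "((\<lambda>t. exp (- l * of_real t) *\<^sub>C T t x) \<longlongrightarrow> exp (- l * of_real 0) *\<^sub>C x) (at_right 0)"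
    by (intro tendsto_intros T_at_zero)
  then show "((\<lambda>t. (scalar_op (exp (- l * of_real t)) o\<^sub>L T t) x) \<longlongrightarrow> x) (at_right 0)" by simp
qed

lemma rescaled_generator:
  assumes "(x, y) \<in> generator (\<lambda>t. scalar_op (exp (- l * of_real t)) o\<^sub>L T t)"
  shows "(x, y + l *\<^sub>C x) \<in> generator T"
proof -
  let ?e = "\<lambda>t. exp (l * of_real t)"
  have "((\<lambda>t. (exp (- l * of_real t) *\<^sub>C T t x - x) /\<^sub>R t) \<longlongrightarrow> y) (at_right 0)"
    using assms by (simp add: generator_def)
  moreover have "(?e \<longlongrightarrow> ?e 0) (at_right 0)" by (intro tendsto_intros)
  moreover have "((\<lambda>t. (?e t - 1) / of_real t) \<longlongrightarrow> l) (at_right 0)"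
  proof -
    have "((\<lambda>z. exp (l * z)) has_field_derivative l) (at (of_real 0))"
      by (auto intro!: derivative_eq_intros)
    from has_vector_derivative_real_field[OF this, of "{0<..}"]
    have "(?e has_vector_derivative l) (at_right 0)" .
    then have "((\<lambda>t. norm (?e t - 1 - t *\<^sub>R l) / norm t) \<longlongrightarrow> 0) (at_right 0)"
      unfolding has_vector_derivative_def has_derivative_iff_norm by simp
    then have "((\<lambda>t. (?e t - 1) / of_real t - l) \<longlongrightarrow> 0) (at_right 0)"
    proof (rule Lim_null_comparison[rotated])
      show "\<forall>\<^sub>F t in at_right 0. norm ((?e t - 1) / of_real t - l) \<le> norm (?e t - 1 - t *\<^sub>R l) / norm t"
        using eventually_at_right_less[of 0]
      proof eventually_elim
        case (elim t)
        then have "(?e t - 1) / of_real t - l = (?e t - 1 - t *\<^sub>R l) / of_real t"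
          by (simp add: field_simps scaleR_conv_of_real)
        then show ?case by (simp add: norm_divide)
      qed
    qed
    then show ?thesis by (simp add: LIM_zero_iff)
  qed
  ultimately have "((\<lambda>t. ?e t *\<^sub>C ((exp (- l * of_real t) *\<^sub>C T t x - x) /\<^sub>R t) + ((?e t - 1) / of_real t) *\<^sub>C x)
      \<longlongrightarrow> ?e 0 *\<^sub>C y + l *\<^sub>C x) (at_right 0)"
    by (intro tendsto_intros)
  moreover have "\<forall>\<^sub>F t in at_right 0. ?e t *\<^sub>C ((exp (- l * of_real t) *\<^sub>C T t x - x) /\<^sub>R t) + ((?e t - 1) / of_real t) *\<^sub>C x
      = (T t x - x) /\<^sub>R t"
    using eventually_at_right_less[of 0]
  proof eventually_elim
    case (elim t)
    have "((?e t - 1) / of_real t) = inverse t *\<^sub>R (?e t - 1)" by (simp add: scaleR_conv_of_real divide_inverse mult.commute)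
    then have "((?e t - 1) / of_real t) *\<^sub>C x = (?e t *\<^sub>C x - x) /\<^sub>R t"
      by (simp only: scaleC.scaleR_left scaleC.diff_left scaleC_one)
    moreover have "?e t *\<^sub>C ((exp (- l * of_real t) *\<^sub>C T t x - x) /\<^sub>R t) = (T t x - ?e t *\<^sub>C x) /\<^sub>R t"
      by (simp add: scaleC.scaleR_right scaleC.diff_right scaleC_scaleC exp_minus)
    ultimately show ?case by (simp only: scaleR_diff_right) (simp add: algebra_simps)
  qed
  ultimately show ?thesis unfolding generator_def by (auto elim: Lim_transform_eventually)
qed

text \<open>
  This is \<open>integral_in_generator\<close> for the rescaled semigroup \<open>exp (- l t) T(t)\<close>, whose
  generator is \<open>A - l\<close>.
\<close>

lemma laplace_in_generator:
  fixes l :: complex and x :: 'a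
  assumes t: "t \<ge> 0"
  defines "w \<equiv> integral {0..t} (\<lambda>s. exp (- l * of_real s) *\<^sub>C T s x)"
  shows "(w, (exp (- l * of_real t) *\<^sub>C T t x - x) + l *\<^sub>C w) \<in> generator T"
proof -
  interpret S: c0_semigroup "\<lambda>t. scalar_op (exp (- l * of_real t)) o\<^sub>L T t"
    by unfold_locales (rule rescaled_C0)
  show ?thesis
    using rescaled_generator[OF S.integral_in_generator[OF t, of x]] by (simp add: w_def)
qed

end

section \<open>Exponential stability and the resolvent\<close>

context c0_semigroup begin

lemma stable_imp_bounded_resolvent:
  assumes "uniformly_exponentially_stable T"
  shows "{l. Re l \<ge> 0} \<subseteq> resolvent_set (generator T)"
    and "bdd_above {norm (resolvent l (generator T)) | l. Re l \<ge> 0}"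
proof -
  obtain \<omega> M where \<omega>: "\<omega> < 0" and M: "M \<ge> 1" and T: "\<And>t. t \<ge> 0 \<Longrightarrow> norm (T t) \<le> M * exp (\<omega> * t)"
    using assms unfolding uniformly_exponentially_stable_def by blast
  have TM: "norm (T t) \<le> M" if "t \<ge> 0" for t
  proof -
    have "M * exp (\<omega> * t) \<le> M * 1" using M \<omega> that by (intro mult_left_mono) (auto simp: mult_nonpos_nonneg)
    then show ?thesis using T[OF that] by simp
  qed
  define b where "b = ln (2 * M) / (- \<omega>)"
  have b: "b \<ge> 0" using M \<omega> by (simp add: b_def divide_nonneg_neg)
  have Tb: "norm (T b) \<le> 1 / 2"
  proof -
    have "\<omega> * b = - ln (2 * M)" using \<omega> by (simp add: b_def)
    then have "M * exp (\<omega> * b) = 1 / 2" using M by (simp add: exp_minus)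
    then show ?thesis using T[OF b] by simp
  qed
  \<comment> \<open>\<open>b\<close> is chosen so that \<open>T b\<close> is a contraction with factor \<open>1/2\<close>: existence of a preimage under
    \<open>A - l\<close> becomes a fixed point problem, and the growth estimate on \<open>[0, b]\<close> can absorb \<open>T b x\<close>.\<close>
  have main: "l \<in> resolvent_set (generator T) \<and> norm (resolvent l (generator T)) \<le> 2 * b * M" if l: "Re l \<ge> 0" for l
  proof -
    let ?e = "exp (- l * of_real b)"
    have e: "cmod ?e \<le> 1" using l b by simp
    have contr: "norm (?e *\<^sub>C T b v) \<le> 1 / 2 * norm v" for v
    proof -
      have "norm (?e *\<^sub>C T b v) \<le> 1 * (1 / 2 * norm v)"
        unfolding norm_scaleC
        by (intro mult_mono e order_trans[OF norm_blinfun mult_right_mono[OF Tb]]) auto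
      then show ?thesis by simp
    qed
    have onto: "\<exists>x y. (x, y) \<in> generator T \<and> y - l *\<^sub>C x = z" for z
    proof -
      have "\<exists>!v. ?e *\<^sub>C T b v - z = v"
      proof (rule banach_fix_type[of "1/2"])
        show "\<forall>u v. dist (?e *\<^sub>C T b u - z) (?e *\<^sub>C T b v - z) \<le> 1 / 2 * dist u v"
          using contr[of "_ - _"] by (simp add: dist_norm blinfun.diff_right scaleC.diff_right)
      qed auto
      then obtain v where v: "?e *\<^sub>C T b v - z = v" by blast
      define w where "w = integral {0..b} (\<lambda>s. exp (- l * of_real s) *\<^sub>C T s v)"
      have "(w, (?e *\<^sub>C T b v - v) + l *\<^sub>C w) \<in> generator T"
        unfolding w_def by (rule laplace_in_generator[OF b])
      moreover have "?e *\<^sub>C T b v - v = z" using v by (simp add: algebra_simps)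
      ultimately have "(w, z + l *\<^sub>C w) \<in> generator T" by simp
      then show ?thesis by (intro exI[of _ w] exI[of _ "z + l *\<^sub>C w"]) simp
    qed
    have est: "norm x \<le> 2 * b * M * norm (y - l *\<^sub>C x)" if u: "(x, y) \<in> generator T" for x y
    proof -
      let ?E = "exp (Re l * b)"
      have E: "?E \<ge> 1" using l b by simp
      have "norm (T b x - exp (l * of_real b) *\<^sub>C x) \<le> b * ?E * M * norm (y - l *\<^sub>C x)"
        by (rule exp_growth_estimate[OF u b]) (use TM l in \<open>auto intro!: mult_left_mono\<close>)
      moreover have "norm (exp (l * of_real b) *\<^sub>C x) = ?E * norm x" by (simp add: norm_scaleC)
      moreover have "norm (exp (l * of_real b) *\<^sub>C x) \<le> norm (T b x) + norm (T b x - exp (l * of_real b) *\<^sub>C x)"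
        by (metis norm_minus_commute norm_triangle_sub)
      moreover have "norm (T b x) \<le> 1 / 2 * norm x" by (rule order_trans[OF norm_blinfun mult_right_mono[OF Tb]]) simp
      moreover have "1 / 2 * norm x \<le> ?E * (1 / 2 * norm x)" using mult_right_mono[OF E, of "1 / 2 * norm x"] by simp
      ultimately have "?E * norm x \<le> ?E * (1 / 2 * norm x) + b * ?E * M * norm (y - l *\<^sub>C x)" by linarith
      also have "\<dots> = ?E * (1 / 2 * norm x + b * M * norm (y - l *\<^sub>C x))" by (simp add: algebra_simps)
      finally have "norm x \<le> 1 / 2 * norm x + b * M * norm (y - l *\<^sub>C x)"
        by (simp only: mult_le_cancel_left_pos[OF exp_gt_zero])
      then show ?thesis by simp
    qed
    show ?thesis
      using resolvent_set_criterion[OF generator_linear onto est] b M by simp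
  qed
  then show "{l. Re l \<ge> 0} \<subseteq> resolvent_set (generator T)" by blast
  show "bdd_above {norm (resolvent l (generator T)) | l. Re l \<ge> 0}"
    using main by (auto intro!: bdd_aboveI)
qed

text \<open>
  For \<open>Re l < 0\<close> the estimate at \<open>i Im l\<close> differs from the one at \<open>l\<close> by at most
  \<open>K \<bar>Re l\<bar> \<parallel>x\<parallel>\<close>, which can be absorbed when \<open>\<bar>Re l\<bar> \<le> 1 / (2 K)\<close>.
\<close>

lemma bounded_resolvent_estimate:
  assumes sub: "{l. Re l \<ge> 0} \<subseteq> resolvent_set (generator T)"
    and bdd: "bdd_above {norm (resolvent l (generator T)) | l. Re l \<ge> 0}"
  shows "\<exists>\<epsilon>>0. \<exists>C>0. \<forall>l x y. Re l \<ge> - \<epsilon> \<longrightarrow> (x, y) \<in> generator T \<longrightarrow> norm x \<le> C * norm (y - l *\<^sub>C x)"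
proof -
  obtain K0 where K0: "\<And>l. Re l \<ge> 0 \<Longrightarrow> norm (resolvent l (generator T)) \<le> K0"
    using bdd unfolding bdd_above_def by blast
  define K where "K = max 1 K0"
  have K: "K \<ge> 1" by (simp add: K_def)
  have right: "norm x \<le> K * norm (y - l *\<^sub>C x)" if l: "Re l \<ge> 0" and u: "(x, y) \<in> generator T" for l x y
  proof -
    obtain R where R: "is_resolvent (generator T) l R" using sub l by (auto simp: resolvent_set_def)
    have "norm R \<le> K" using K0[OF l] resolvent_eq[OF R] by (simp add: K_def)
    moreover have "R (y - l *\<^sub>C x) = x" by (rule is_resolventD(3)[OF R u])
    ultimately show ?thesis
      using order_trans[OF norm_blinfun[of R "y - l *\<^sub>C x"] mult_right_mono[of "norm R" K]] by simp
  qed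
  have "norm x \<le> 2 * K * norm (y - l *\<^sub>C x)"
    if l: "Re l \<ge> - (1 / (2 * K))" and u: "(x, y) \<in> generator T" for l x y
  proof (cases "Re l \<ge> 0")
    case True
    have "norm x \<le> K * norm (y - l *\<^sub>C x)" by (rule right[OF True u])
    also have "\<dots> \<le> 2 * K * norm (y - l *\<^sub>C x)" by (rule mult_right_mono) (use K in auto)
    finally show ?thesis .
  next
    case False
    define l' where "l' = l - of_real (Re l)"
    have "norm x \<le> K * norm (y - l' *\<^sub>C x)" by (rule right[OF _ u]) (simp add: l'_def)
    also have "y - l' *\<^sub>C x = (y - l *\<^sub>C x) + Re l *\<^sub>R x"
      by (simp add: l'_def scaleC.diff_left scaleC_of_real)
    also have "norm \<dots> \<le> norm (y - l *\<^sub>C x) + 1 / (2 * K) * norm x"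
    proof -
      have "\<bar>Re l\<bar> * norm x \<le> 1 / (2 * K) * norm x" by (rule mult_right_mono) (use l False in auto)
      then show ?thesis using norm_triangle_ineq[of "y - l *\<^sub>C x" "Re l *\<^sub>R x"] by simp
    qed
    finally have "norm x \<le> K * (norm (y - l *\<^sub>C x) + 1 / (2 * K) * norm x)" using K by simp
    then show ?thesis using K by (simp add: algebra_simps)
  qed
  then show ?thesis using K by (intro exI[of _ "1 / (2 * K)"] exI[of _ "2 * K"] conjI allI impI) auto
qed

lemma stable_if_discrete_decay:
  assumes q: "0 < q" "q < 1" and decay: "\<And>n::nat. norm (T n) \<le> K * q ^ n"
  shows "uniformly_exponentially_stable T"
proof -
  obtain M where M: "M \<ge> 1" and bound: "\<forall>t. 0 \<le> t \<longrightarrow> t \<le> 1 \<longrightarrow> norm (T t) \<le> M"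
    using locally_bounded[of 1] by blast
  have K: "K \<ge> 0" using order_trans[OF norm_ge_zero decay[of 0]] by simp
  have "norm (T t) \<le> max 1 (K * M / q) * exp (ln q * t)" if t: "t \<ge> 0" for t
  proof -
    define n where "n = nat \<lfloor>t\<rfloor>"
    have n: "real n \<le> t" "t \<le> real n + 1" using t by (auto simp: n_def)
    have "T (real n + (t - real n)) = T (real n) o\<^sub>L T (t - real n)"
      by (rule blinfun_eqI) (use n T_add[of "real n" "t - real n"] in simp)
    then have "norm (T t) \<le> norm (T (real n)) * norm (T (t - real n))"
      using norm_blinfun_compose[of "T (real n)" "T (t - real n)"] by simp
    also have "\<dots> \<le> (K * q ^ n) * M"
      by (intro mult_mono decay bound[rule_format]) (use n K q in auto)
    also have "q ^ n \<le> exp (ln q * t) / q"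
    proof -
      have "q ^ n = exp (ln q * real n)" using q by (simp add: exp_of_nat_mult mult.commute)
      also have "\<dots> \<le> exp (ln q * (t - 1))" using q n by (simp add: mult_left_mono_neg)
      also have "\<dots> = exp (ln q * t) / q" using q by (simp add: algebra_simps exp_diff)
      finally show ?thesis .
    qed
    finally have "norm (T t) \<le> K * (exp (ln q * t) / q) * M" using K M by (simp add: mult_left_mono mult_right_mono)
    also have "\<dots> = K * M / q * exp (ln q * t)" by simp
    also have "\<dots> \<le> max 1 (K * M / q) * exp (ln q * t)" by (rule mult_right_mono) auto
    finally show ?thesis .
  qed
  then show ?thesis unfolding uniformly_exponentially_stable_def
    by (intro exI[of _ "ln q"] exI[of _ "max 1 (K * M / q)"] conjI allI impI) (use q in auto)
qed

end

section \<open>Power bounds from a priori estimates\<close>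

lemma roots_of_unity_orthogonal:
  assumes "k < N" "n < N"
  shows "(\<Sum>j<N. cnj (cis (2 * pi * real j / real N)) ^ n * cis (2 * pi * real j / real N) ^ k)
         = (if k = n then of_nat N else 0)"
proof -
  define q where "q = cis (2 * pi * (real k - real n) / real N)"
  have N: "real N > 0" using assms by simp
  have "cnj (cis (2 * pi * real j / real N)) ^ n * cis (2 * pi * real j / real N) ^ k = q ^ j" for j
  proof -
    have "real n * (- (2 * pi * real j / real N)) + real k * (2 * pi * real j / real N)
        = real j * (2 * pi * (real k - real n) / real N)"
      by (simp add: algebra_simps diff_divide_distrib)
    then show ?thesis unfolding q_def by (simp only: cis_cnj Complex.DeMoivre cis_mult)
  qed
  then have sum: "(\<Sum>j<N. cnj (cis (2 * pi * real j / real N)) ^ n * cis (2 * pi * real j / real N) ^ k)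
      = (\<Sum>j<N. q ^ j)" by simp
  show ?thesis
  proof (cases "k = n")
    case True
    then show ?thesis unfolding sum by (simp add: q_def)
  next
    case False
    have "q \<noteq> 1"
    proof
      assume "q = 1"
      then have "cos (2 * pi * (real k - real n) / real N) = 1" by (simp add: q_def complex_eq_iff)
      then obtain i :: int where "2 * pi * (real k - real n) / real N = of_int i * 2 * pi"
        using cos_one_2pi_int by auto
      then have "(2 * pi) * (real k - real n) = (2 * pi) * (of_int i * real N)"
        using N by (simp add: field_simps)
      then have "real k - real n = of_int i * real N" by (subst (asm) mult_cancel_left) simp
      then have eq: "int k - int n = i * int N"
        by (metis of_int_diff of_int_eq_iff of_int_mult of_int_of_nat_eq)
      moreover have "\<bar>int k - int n\<bar> < int N" "int k - int n \<noteq> 0" using assms False by auto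
      ultimately have "\<bar>i\<bar> * int N < int N" "i \<noteq> 0" by (auto simp: abs_mult)
      then show False using N by (simp add: mult_less_cancel_right1)
    qed
    moreover have "q ^ N = 1"
    proof -
      have "q ^ N = cis (2 * pi * (real k - real n))" unfolding q_def using N by (simp add: Complex.DeMoivre)
      also have "2 * pi * (real k - real n) = 2 * pi * of_int (int k - int n)" by simp
      finally show ?thesis by (simp only: cis_multiple_2pi Ints_of_int)
    qed
    ultimately show ?thesis unfolding sum using False by (simp add: geometric_sum)
  qed
qed

text \<open>
  Cauchy's estimate for the coefficient of \<open>z\<^sup>n\<close> of a vector-valued polynomial of degree less than \<open>N\<close>: the
  coefficient is an average of the values at the \<open>N\<close>-th roots of unity. Indexing the monomials by an arbitrary set
  allows products of polynomials to be used without collecting terms.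
\<close>

lemma coefficient_bound:
  fixes a :: "'i \<Rightarrow> 'a::complex_normed_vector"
  assumes fin: "finite I" and deg: "\<And>i. i \<in> I \<Longrightarrow> d i < N" and n: "n < N"
    and bound: "\<And>z. cmod z = 1 \<Longrightarrow> norm (\<Sum>i\<in>I. z ^ d i *\<^sub>C a i) \<le> b"
  shows "norm (\<Sum>i | i \<in> I \<and> d i = n. a i) \<le> b"
proof -
  define e where "e j = cis (2 * pi * real j / real N)" for j
  have "(\<Sum>j<N. cnj (e j) ^ n *\<^sub>C (\<Sum>i\<in>I. e j ^ d i *\<^sub>C a i))
      = (\<Sum>i\<in>I. (\<Sum>j<N. cnj (e j) ^ n * e j ^ d i) *\<^sub>C a i)"
    by (simp add: scaleC.sum_right scaleC.sum_left scaleC_scaleC) (rule sum.swap)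
  also have "\<dots> = (\<Sum>i\<in>I. (if d i = n then of_nat N else 0) *\<^sub>C a i)"
    unfolding e_def by (intro sum.cong refl) (simp only: roots_of_unity_orthogonal[OF deg n])
  also have "\<dots> = (\<Sum>i | i \<in> I \<and> d i = n. of_nat N *\<^sub>C a i)"
    by (rule sum.mono_neutral_cong_right) (use fin in \<open>auto simp: scaleC.zero_left\<close>)
  also have "\<dots> = real N *\<^sub>R (\<Sum>i | i \<in> I \<and> d i = n. a i)"
    by (simp add: scaleC.sum_right flip: scaleC_of_real)
  finally have "real N * norm (\<Sum>i | i \<in> I \<and> d i = n. a i)
      = norm (\<Sum>j<N. cnj (e j) ^ n *\<^sub>C (\<Sum>i\<in>I. e j ^ d i *\<^sub>C a i))" by simp
  also have "\<dots> \<le> (\<Sum>j<N. b)"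
    by (rule sum_norm_le) (simp add: norm_scaleC norm_power e_def bound)
  also have "\<dots> = real N * b" by simp
  finally show ?thesis using n by simp
qed

definition complex_subspace :: "'a::complex_normed_vector set \<Rightarrow> bool" where
  "complex_subspace Y \<longleftrightarrow> 0 \<in> Y \<and> (\<forall>x\<in>Y. \<forall>y\<in>Y. x + y \<in> Y) \<and> (\<forall>c. \<forall>x\<in>Y. c *\<^sub>C x \<in> Y)"

lemma complex_subspace_sum:
  assumes "complex_subspace Y" "\<And>i. i \<in> I \<Longrightarrow> f i \<in> Y" shows "sum f I \<in> Y"
  using assms(2) by (induction I rule: infinite_finite_induct)
    (use assms(1) in \<open>auto simp: complex_subspace_def\<close>)

lemma complex_subspace_diff:
  assumes "complex_subspace Y" "x \<in> Y" "y \<in> Y" shows "x - y \<in> Y"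
proof -
  have "x + (-1) *\<^sub>C y \<in> Y" using assms by (simp add: complex_subspace_def)
  then show ?thesis by (simp add: scaleC.minus_left)
qed

text \<open>
  The estimate says that \<open>I - w D\<close> is bounded below on \<open>Y\<close>, uniformly for \<open>\<bar>w\<bar> \<le> r\<close>. This rules out
  growth of \<open>D\<^sup>n y\<close> faster than \<open>r\<^sup>-\<^sup>n\<close>: such growth is absent near \<open>w = 0\<close>, and it cannot set in at any
  radius up to \<open>r\<close>, because a power bound at one radius improves itself to one at a larger radius.
\<close>

locale a_priori_estimate =
  fixes D :: "'a::complex_normed_vector \<Rightarrow>\<^sub>L 'a" and Y :: "'a set" and r C :: real
  assumes lin: "complex_linear D" and Y: "complex_subspace Y"
    and inv: "\<And>y. y \<in> Y \<Longrightarrow> D y \<in> Y"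
    and est: "\<And>w y. cmod w \<le> r \<Longrightarrow> y \<in> Y \<Longrightarrow> norm y \<le> C * norm (y - w *\<^sub>C D y)"
    and C: "C \<ge> 1"
begin

abbreviation "Dpow n \<equiv> blinfun_apply D ^^ n"

lemma Dpow_in: "y \<in> Y \<Longrightarrow> Dpow n y \<in> Y"
  by (induction n) (simp_all add: inv)

lemma Dpow_norm: "norm (Dpow n y) \<le> norm D ^ n * norm y"
proof (induction n)
  case (Suc n)
  have "norm (D (Dpow n y)) \<le> norm D * norm (Dpow n y)" by (rule norm_blinfun)
  also have "\<dots> \<le> norm D * (norm D ^ n * norm y)" by (intro mult_left_mono Suc) simp
  finally show ?case by (simp add: mult.assoc)
qed simp

definition orbit :: "complex \<Rightarrow> 'a \<Rightarrow> nat \<Rightarrow> 'a" where "orbit w y k = w ^ k *\<^sub>C Dpow k y"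

lemma orbit_in: "y \<in> Y \<Longrightarrow> orbit w y k \<in> Y"
  using Y Dpow_in by (simp add: orbit_def complex_subspace_def)

lemma D_orbit: "w *\<^sub>C D (orbit w y k) = orbit w y (Suc k)"
  by (simp add: orbit_def complex_linearD[OF lin] scaleC_scaleC)

lemma D_sum_orbit: "w *\<^sub>C D (\<Sum>k<m. orbit w y (j + k)) = (\<Sum>k<m. orbit w y (Suc j + k))"
  by (simp add: blinfun.sum_right scaleC.sum_right D_orbit)

lemma orbit_sum_shift: "(\<Sum>k<m. orbit w y (j + k)) - (\<Sum>k<m. orbit w y (Suc j + k)) = orbit w y j - orbit w y (j + m)"
  by (induction m) (simp_all add: algebra_simps)

lemma norm_orbit: "norm (orbit w y k) = cmod w ^ k * norm (Dpow k y)"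
  by (simp add: orbit_def norm_scaleC norm_power)

definition power_bounded :: "real \<Rightarrow> bool" where
  "power_bounded t \<longleftrightarrow> (\<exists>K. \<forall>n. \<forall>y\<in>Y. t ^ n * norm (Dpow n y) \<le> K * norm y)"

text \<open>
  The bound at \<open>t\<close> may have any constant; at every smaller radius \<open>s \<le> r\<close> it improves to \<open>C\<close>. Indeed
  \<open>h = \<Sum>k<N. (w D)\<^sup>k y\<close> satisfies \<open>(I - w D) h = y - (w D)\<^sup>N y\<close>, where the last term vanishes as \<open>N \<rightarrow> \<infinity>\<close> for
  \<open>\<bar>w\<bar> = s < t\<close>, and \<open>s\<^sup>n D\<^sup>n y\<close> is a coefficient of \<open>h\<close>.
\<close>

lemma bound_below_radius:
  assumes s: "0 \<le> s" "s < t" "s \<le> r" and pb: "power_bounded t" and y: "y \<in> Y"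
  shows "s ^ n * norm (Dpow n y) \<le> C * norm y"
proof -
  obtain K where K: "\<And>n. t ^ n * norm (Dpow n y) \<le> K * norm y"
    using pb y unfolding power_bounded_def by blast
  have t: "t > 0" using s by simp
  have main: "s ^ n * norm (Dpow n y) \<le> C * (norm y + (s / t) ^ N * (K * norm y))" if "n < N" for N
  proof -
    have "norm (\<Sum>k<N. z ^ k *\<^sub>C (of_real s ^ k *\<^sub>C Dpow k y)) \<le> C * (norm y + (s / t) ^ N * (K * norm y))"
      if z: "cmod z = 1" for z
    proof -
      define w where "w = z * of_real s"
      have w: "cmod w = s" using z s by (simp add: w_def norm_mult)
      define h where "h = (\<Sum>k<N. orbit w y (0 + k))"
      have "h \<in> Y" unfolding h_def by (intro complex_subspace_sum[OF Y] orbit_in y)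
      then have "norm h \<le> C * norm (h - w *\<^sub>C D h)" using est w s by simp
      also have "h - w *\<^sub>C D h = orbit w y 0 - orbit w y (0 + N)" 
        unfolding h_def D_sum_orbit by (rule orbit_sum_shift)
      also have "norm (orbit w y 0 - orbit w y (0 + N)) \<le> norm (orbit w y 0) + norm (orbit w y N)"
        by (simp add: norm_triangle_ineq4)
      also have "norm (orbit w y N) = (s / t) ^ N * (t ^ N * norm (Dpow N y))"
        using t by (simp add: norm_orbit w power_divide)
      also have "\<dots> \<le> (s / t) ^ N * (K * norm y)"
        by (rule mult_left_mono[OF K]) (use s t in simp)
      also have "norm (orbit w y 0) = norm y" by (simp add: norm_orbit)
      finally have "norm h \<le> C * (norm y + (s / t) ^ N * (K * norm y))" using C by simp
      moreover have "h = (\<Sum>k<N. z ^ k *\<^sub>C (of_real s ^ k *\<^sub>C Dpow k y))"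
        unfolding h_def orbit_def w_def by (simp add: scaleC_scaleC power_mult_distrib)
      ultimately show ?thesis by simp
    qed
    from coefficient_bound[of "{..<N}" "\<lambda>k. k", OF _ _ that this]
    have "norm (\<Sum>i | i \<in> {..<N} \<and> i = n. of_real s ^ i *\<^sub>C Dpow i y) \<le> C * (norm y + (s / t) ^ N * (K * norm y))"
      by simp
    moreover have "{i. i \<in> {..<N} \<and> i = n} = {n}" using that by auto
    ultimately show ?thesis using s by (simp add: norm_scaleC norm_power)
  qed
  have "(\<lambda>N. C * (norm y + (s / t) ^ N * (K * norm y))) \<longlonglongrightarrow> C * (norm y + 0 * (K * norm y))"
    by (intro tendsto_intros LIMSEQ_power_zero) (use s t in simp)
  then have "(\<lambda>N. C * (norm y + (s / t) ^ N * (K * norm y))) \<longlonglongrightarrow> C * norm y" by simp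
  then show ?thesis
    by (rule tendsto_lowerbound[OF _ eventually_mono[OF eventually_gt_at_top[of n] main]]) simp_all
qed

lemma bound_at_radius:
  assumes t: "0 < t" "t \<le> r" and pb: "power_bounded t" and y: "y \<in> Y"
  shows "t ^ n * norm (Dpow n y) \<le> C * norm y"
proof -
  have "((\<lambda>s. s ^ n * norm (Dpow n y)) \<longlongrightarrow> t ^ n * norm (Dpow n y)) (at_left t)"
    by (intro tendsto_intros)
  moreover have "eventually (\<lambda>s. s ^ n * norm (Dpow n y) \<le> C * norm y) (at_left t)"
    using eventually_at_left_real[OF t(1)]
    by eventually_elim (rule bound_below_radius[OF _ _ _ pb y], use t in auto)
  ultimately show ?thesis by (rule tendsto_upperbound) simp
qed

text \<open>
  Applying the estimate twice yields decay, which is the room needed to enlarge the radius. For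
  \<open>h = (\<Sum>k\<le>m. (w D)\<^sup>k)\<^sup>2 y\<close> one has \<open>(I - w D)\<^sup>2 h = (I - (w D)\<^sup>m\<^sup>+\<^sup>1)\<^sup>2 y\<close>, which stays bounded, while the
  coefficient \<open>t\<^sup>m D\<^sup>m y\<close> occurs \<open>m + 1\<close> times in \<open>h\<close>.
\<close>

lemma decay_at_radius:
  assumes t: "0 < t" "t \<le> r" and pb: "power_bounded t" and y: "y \<in> Y"
  shows "real (Suc m) * (t ^ m * norm (Dpow m y)) \<le> 4 * C ^ 3 * norm y"
proof -
  let ?m = "Suc m"
  let ?I = "{..<?m} \<times> {..<?m}"
  have "norm (\<Sum>(j,k)\<in>?I. z ^ (j + k) *\<^sub>C (of_real t ^ (j + k) *\<^sub>C Dpow (j + k) y)) \<le> 4 * C ^ 3 * norm y"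
    if z: "cmod z = 1" for z
  proof -
    define w where "w = z * of_real t"
    have w: "cmod w = t" using z t by (simp add: w_def norm_mult)
    define q where "q j = (\<Sum>k<?m. orbit w y (j + k))" for j
    define h where "h = (\<Sum>j<?m. q j)"
    have q_in: "q j \<in> Y" for j unfolding q_def by (intro complex_subspace_sum[OF Y] orbit_in y)
    then have h_in: "h \<in> Y" unfolding h_def by (intro complex_subspace_sum[OF Y])
    have Dq: "w *\<^sub>C D (q j) = q (Suc j)" for j unfolding q_def by (rule D_sum_orbit)
    have q_diff: "q j - q (Suc j) = orbit w y j - orbit w y (j + ?m)" for j
      unfolding q_def by (rule orbit_sum_shift)
    have "h - w *\<^sub>C D h = (\<Sum>j<?m. q j) - (\<Sum>j<?m. q (Suc j))"
      unfolding h_def blinfun.sum_right scaleC.sum_right Dq ..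
    also have "\<dots> = q 0 - q ?m"
      using sum_lessThan_telescope'[of q ?m] by (simp only: sum_subtractf)
    finally have h_diff: "h - w *\<^sub>C D h = q 0 - q ?m" .
    have "(q 0 - q ?m) - w *\<^sub>C D (q 0 - q ?m) = (q 0 - q (Suc 0)) - (q ?m - q (Suc ?m))"
      by (simp add: blinfun.diff_right scaleC.diff_right Dq)
    also have "\<dots> = (orbit w y 0 - orbit w y ?m) - (orbit w y ?m - orbit w y (?m + ?m))"
      unfolding q_diff by simp
    finally have q_diff_diff: "(q 0 - q ?m) - w *\<^sub>C D (q 0 - q ?m)
        = (orbit w y 0 - orbit w y ?m) - (orbit w y ?m - orbit w y (?m + ?m))" .
    have orbit_bound: "norm (orbit w y k) \<le> C * norm y" for k
      unfolding norm_orbit w by (rule bound_at_radius[OF t pb y])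
    have "norm h \<le> C * norm (q 0 - q ?m)" using est[OF _ h_in, of w] w t h_diff by simp
    also have "norm (q 0 - q ?m) \<le> C * norm ((orbit w y 0 - orbit w y ?m) - (orbit w y ?m - orbit w y (?m + ?m)))"
      using est[OF _ complex_subspace_diff[OF Y q_in q_in], of w 0 ?m] w t unfolding q_diff_diff by simp
    also have "norm ((orbit w y 0 - orbit w y ?m) - (orbit w y ?m - orbit w y (?m + ?m))) \<le> 4 * (C * norm y)"
      using orbit_bound[of 0] orbit_bound[of ?m] orbit_bound[of "?m + ?m"] norm_triangle_ineq4[of "orbit w y 0" "orbit w y ?m"]
        norm_triangle_ineq4[of "orbit w y ?m" "orbit w y (?m + ?m)"]
        norm_triangle_ineq4[of "orbit w y 0 - orbit w y ?m" "orbit w y ?m - orbit w y (?m + ?m)"] by linarith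
    finally have "norm h \<le> C * (C * (4 * (C * norm y)))" using C by simp
    then have "norm h \<le> 4 * C ^ 3 * norm y" by (simp add: power3_eq_cube ac_simps)
    moreover have "h = (\<Sum>(j,k)\<in>?I. z ^ (j + k) *\<^sub>C (of_real t ^ (j + k) *\<^sub>C Dpow (j + k) y))"
      unfolding h_def q_def orbit_def w_def sum.cartesian_product
      by (simp add: scaleC_scaleC power_mult_distrib)
    ultimately show ?thesis by simp
  qed
  then have "norm (\<Sum>p | p \<in> ?I \<and> fst p + snd p = m.
      of_real t ^ (fst p + snd p) *\<^sub>C Dpow (fst p + snd p) y) \<le> 4 * C ^ 3 * norm y"
    by (intro coefficient_bound[of ?I "\<lambda>p. fst p + snd p" "2 * ?m"]) (auto simp: case_prod_unfold)
  moreover have "(\<Sum>p | p \<in> ?I \<and> fst p + snd p = m.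
      of_real t ^ (fst p + snd p) *\<^sub>C Dpow (fst p + snd p) y)
    = (\<Sum>p | p \<in> ?I \<and> fst p + snd p = m. of_real t ^ m *\<^sub>C Dpow m y)"
    by (rule sum.cong) auto
  moreover have "{p. p \<in> ?I \<and> fst p + snd p = m} = (\<lambda>j. (j, m - j)) ` {..<?m}"
    by (auto simp: image_iff)
  moreover have "card ((\<lambda>j. (j, m - j)) ` {..<?m}) = ?m"
    by (subst card_image) (auto simp: inj_on_def)
  ultimately have "norm (real ?m *\<^sub>R (of_real t ^ m *\<^sub>C Dpow m y)) \<le> 4 * C ^ 3 * norm y"
    by (simp only: sum_constant_scaleR)
  then show ?thesis using t by (simp add: norm_scaleC norm_power)
qed

lemma power_bounded_if_contraction:
  assumes M: "M > 0" and u: "u \<ge> 0" and contr: "\<And>y. y \<in> Y \<Longrightarrow> u ^ M * norm (Dpow M y) \<le> norm y"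
  shows "power_bounded u"
proof -
  define K where "K = (\<Sum>i<M. (u * norm D) ^ i)"
  have "u ^ n * norm (Dpow n y) \<le> K * norm y" if "y \<in> Y" for n y
    using that
  proof (induction n arbitrary: y rule: less_induct)
    case (less n)
    show ?case
    proof (cases "n < M")
      case True
      have "u ^ n * norm (Dpow n y) \<le> u ^ n * (norm D ^ n * norm y)"
        by (intro mult_left_mono Dpow_norm) (use u in simp)
      also have "\<dots> = (u * norm D) ^ n * norm y" by (simp add: power_mult_distrib)
      also have "\<dots> \<le> K * norm y" unfolding K_def
        by (intro mult_right_mono member_le_sum) (use True u in auto)
      finally show ?thesis .
    next
      case False
      then obtain i where n: "n = i + M" by (metis add.commute le_Suc_ex not_less)
      have "u ^ n * norm (Dpow n y) = u ^ M * (u ^ i * norm (Dpow i (Dpow M y)))"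
        by (simp add: n funpow_add power_add)
      also have "\<dots> \<le> u ^ M * (K * norm (Dpow M y))"
        using less.IH[of i "Dpow M y"] Dpow_in[OF less.prems] M n u by (intro mult_left_mono) auto
      also have "\<dots> = K * (u ^ M * norm (Dpow M y))" by simp
      also have "\<dots> \<le> K * norm y"
        by (intro mult_left_mono contr less.prems) (use u in \<open>auto simp: K_def intro!: sum_nonneg\<close>)
      finally show ?thesis .
    qed
  qed
  then show ?thesis unfolding power_bounded_def by blast
qed

lemma power_bounded_mono:
  assumes "0 \<le> s" "s \<le> t" "power_bounded t" shows "power_bounded s"
proof -
  obtain K where K: "\<And>n y. y \<in> Y \<Longrightarrow> t ^ n * norm (Dpow n y) \<le> K * norm y"
    using assms(3) unfolding power_bounded_def by blast
  have "s ^ n * norm (Dpow n y) \<le> K * norm y" if "y \<in> Y" for n y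
    by (rule order_trans[OF mult_right_mono[OF power_mono] K]) (use assms that in auto)
  then show ?thesis unfolding power_bounded_def by blast
qed

text \<open>
  The decay rate depends on \<open>C\<close> only. Hence there is one factor \<open>\<kappa> > 1\<close> by which every radius
  \<open>t \<le> r\<close> with bounded powers can be enlarged, and \<open>r\<close> is reached from a small radius in finitely many steps.
\<close>

lemma power_bound:
  assumes r: "r > 0" and y: "y \<in> Y"
  shows "r ^ n * norm (Dpow n y) \<le> C * norm y"
proof -
  \<comment> \<open>\<open>M\<close> is so large that \<open>decay_at_radius\<close> gives \<open>t\<^sup>M \<parallel>D\<^sup>M y\<parallel> \<le> \<parallel>y\<parallel> / 2\<close>.\<close>
  obtain M0 :: nat where M0: "4 * C ^ 3 \<le> real M0 / 2"
    using real_arch_simple[of "8 * C ^ 3"] by (auto simp: field_simps)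
  define M where "M = Suc M0"
  define \<kappa> where "\<kappa> = root M 2"
  have M: "M > 0" by (simp add: M_def)
  have \<kappa>: "\<kappa> > 1" "\<kappa> ^ M = 2" using M by (auto simp: \<kappa>_def)
  have step: "power_bounded (t * \<kappa>)" if t: "0 < t" "t \<le> r" "power_bounded t" for t
  proof (rule power_bounded_if_contraction[OF M])
    fix y assume y: "y \<in> Y"
    have "real (Suc M) * (t ^ M * norm (Dpow M y)) \<le> 4 * C ^ 3 * norm y"
      by (rule decay_at_radius[OF t y])
    also have "\<dots> \<le> real (Suc M) / 2 * norm y"
      by (rule mult_right_mono) (use M0 in \<open>auto simp: M_def\<close>)
    finally have "real (Suc M) * (2 * (t ^ M * norm (Dpow M y))) \<le> real (Suc M) * norm y" by simp
    then have "2 * (t ^ M * norm (Dpow M y)) \<le> norm y"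
      by (simp only: mult_le_cancel_left_pos of_nat_0_less_iff zero_less_Suc)
    then show "(t * \<kappa>) ^ M * norm (Dpow M y) \<le> norm y" by (simp add: power_mult_distrib \<kappa> ac_simps)
  qed (use t \<kappa> in auto)
  \<comment> \<open>At radius \<open>t0\<close> already \<open>t0 D\<close> is a contraction.\<close>
  define t0 where "t0 = min r (1 / (norm D + 1))"
  have t0: "t0 > 0" "t0 \<le> r" using r by (auto simp: t0_def add_nonneg_pos)
  have pb0: "power_bounded t0"
  proof (rule power_bounded_if_contraction[of 1])
    fix y :: 'a
    have "t0 * norm (D y) \<le> t0 * (norm D * norm y)" by (intro mult_left_mono norm_blinfun) (use t0 in auto)
    also have "\<dots> \<le> 1 / (norm D + 1) * (norm D * norm y)"
      by (rule mult_right_mono) (auto simp: t0_def)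
    also have "\<dots> \<le> norm y"
    proof -
      have "norm D / (norm D + 1) \<le> 1" by (simp add: divide_le_eq_1 add_nonneg_pos)
      from mult_right_mono[OF this, of "norm y"] show ?thesis by simp
    qed
    finally show "t0 ^ 1 * norm (Dpow 1 y) \<le> norm y" by simp
  qed (use t0 in auto)
  have pb: "power_bounded (min r (t0 * \<kappa> ^ i))" for i
  proof (induction i)
    case 0
    then show ?case using pb0 t0 by (simp add: min_def)
  next
    case (Suc i)
    let ?t = "min r (t0 * \<kappa> ^ i)"
    have "power_bounded (?t * \<kappa>)" by (rule step) (use Suc r t0 \<kappa> in auto)
    moreover have "min r (t0 * \<kappa> ^ Suc i) \<le> ?t * \<kappa>"
    proof (cases "r \<le> t0 * \<kappa> ^ i")
      case True
      have "min r (t0 * \<kappa> ^ Suc i) \<le> r" by simp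
      also have "r \<le> r * \<kappa>" using r \<kappa> by simp
      finally show ?thesis using True by (simp add: min_def)
    next
      case False
      then have "?t = t0 * \<kappa> ^ i" by simp
      then show ?thesis by (simp add: mult.commute mult.left_commute)
    qed
    ultimately show ?case using power_bounded_mono r t0 \<kappa>
      by (smt (verit) mult_nonneg_nonneg zero_le_power)
  qed
  obtain i where "r / t0 < \<kappa> ^ i" using real_arch_pow[OF \<kappa>(1)] by blast
  then have "min r (t0 * \<kappa> ^ i) = r" using t0 by (simp add: field_simps min_def)
  then have "power_bounded r" using pb[of i] by simp
  then show ?thesis using bound_at_radius[OF r order_refl _ y] by blast
qed

end

section \<open>Eventually norm-continuous semigroups\<close>

context c0_semigroup begin

text \<open>
  The weight \<open>sin\<^sup>2\<^sup>N (\<pi> s)\<close> is a trigonometric polynomial of period \<open>1\<close> whose mass concentrates at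
  \<open>s = 1/2\<close> as \<open>N\<close> grows.
\<close>

definition window_transform :: "nat \<Rightarrow> complex \<Rightarrow> 'a \<Rightarrow> 'a" where
  "window_transform N \<mu> x = integral {0..1} (\<lambda>s. (sin (pi * s))\<^sup>2 ^ N *\<^sub>R exp (- \<mu> * of_real s) *\<^sub>C T s x)"

lemma window_integrable:
  "(\<lambda>s. (sin (pi * s))\<^sup>2 ^ N *\<^sub>R exp (- \<mu> * of_real s) *\<^sub>C T s x) integrable_on {0..1}"
  by (intro integrable_continuous_real continuous_intros continuous_on_subset[OF strongly_continuous]) auto

lemma window_transform_Suc:
  "window_transform (Suc N) \<mu> x = (1/2) *\<^sub>R window_transform N \<mu> x
     - (1/4) *\<^sub>R window_transform N (\<mu> - 2 * of_real pi * \<i>) x - (1/4) *\<^sub>R window_transform N (\<mu> + 2 * of_real pi * \<i>) x"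
proof -
  let ?f = "\<lambda>\<mu> s. (sin (pi * s))\<^sup>2 ^ N *\<^sub>R exp (- \<mu> * of_real s) *\<^sub>C T s x"
  have key: "complex_of_real ((sin (pi * s))\<^sup>2) * exp (- \<mu> * of_real s)
      = (1/2) * exp (- \<mu> * of_real s) - (1/4) * exp (- (\<mu> - 2 * of_real pi * \<i>) * of_real s)
        - (1/4) * exp (- (\<mu> + 2 * of_real pi * \<i>) * of_real s)" for s
  proof -
    have 1: "exp (- (\<mu> - 2 * of_real pi * \<i>) * of_real s) = exp (- \<mu> * of_real s) * cis (2 * (pi * s))"
      by (simp add: cis_conv_exp flip: exp_add) (simp add: algebra_simps)
    have 2: "exp (- (\<mu> + 2 * of_real pi * \<i>) * of_real s) = exp (- \<mu> * of_real s) * cis (- (2 * (pi * s)))"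
      by (simp add: cis_conv_exp flip: exp_add) (simp add: algebra_simps)
    have 3: "complex_of_real ((sin (pi * s))\<^sup>2) = 1/2 - (1/4) * cis (2 * (pi * s)) - (1/4) * cis (- (2 * (pi * s)))"
      by (simp add: complex_eq_iff cos_double_sin diff_divide_distrib)
    show ?thesis unfolding 1 2 3 by (simp add: algebra_simps)
  qed
  have "(sin (pi * s))\<^sup>2 ^ Suc N *\<^sub>R exp (- \<mu> * of_real s) *\<^sub>C T s x
      = (1/2) *\<^sub>R ?f \<mu> s - (1/4) *\<^sub>R ?f (\<mu> - 2 * of_real pi * \<i>) s - (1/4) *\<^sub>R ?f (\<mu> + 2 * of_real pi * \<i>) s" for s
  proof -
    have "(sin (pi * s))\<^sup>2 *\<^sub>R exp (- \<mu> * of_real s) *\<^sub>C T s x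
        = (complex_of_real ((sin (pi * s))\<^sup>2) * exp (- \<mu> * of_real s)) *\<^sub>C T s x"
      by (simp only: scaleC_of_real[symmetric] scaleC_scaleC)
    also have "\<dots> = (1/2) *\<^sub>R exp (- \<mu> * of_real s) *\<^sub>C T s x
        - (1/4) *\<^sub>R exp (- (\<mu> - 2 * of_real pi * \<i>) * of_real s) *\<^sub>C T s x
        - (1/4) *\<^sub>R exp (- (\<mu> + 2 * of_real pi * \<i>) * of_real s) *\<^sub>C T s x"
      unfolding key scaleC.diff_left
      by (simp only: scaleC_of_real[symmetric] scaleC_scaleC) simp
    finally have eq: "(sin (pi * s))\<^sup>2 *\<^sub>R exp (- \<mu> * of_real s) *\<^sub>C T s x = \<dots>" .
    have "(sin (pi * s))\<^sup>2 ^ Suc N *\<^sub>R exp (- \<mu> * of_real s) *\<^sub>C T s x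
        = (sin (pi * s))\<^sup>2 ^ N *\<^sub>R ((sin (pi * s))\<^sup>2 *\<^sub>R exp (- \<mu> * of_real s) *\<^sub>C T s x)"
      by (simp add: mult.commute)
    also have "\<dots> = (1/2) *\<^sub>R ?f \<mu> s - (1/4) *\<^sub>R ?f (\<mu> - 2 * of_real pi * \<i>) s - (1/4) *\<^sub>R ?f (\<mu> + 2 * of_real pi * \<i>) s"
      unfolding eq scaleR_diff_right scaleR_scaleR by (simp only: mult.commute)
    finally show ?thesis .
  qed
  then have "window_transform (Suc N) \<mu> x = integral {0..1} (\<lambda>s. (1/2) *\<^sub>R ?f \<mu> s
      - (1/4) *\<^sub>R ?f (\<mu> - 2 * of_real pi * \<i>) s - (1/4) *\<^sub>R ?f (\<mu> + 2 * of_real pi * \<i>) s)"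
    by (simp only: window_transform_def)
  also have "\<dots> = (1/2) *\<^sub>R window_transform N \<mu> x
     - (1/4) *\<^sub>R window_transform N (\<mu> - 2 * of_real pi * \<i>) x - (1/4) *\<^sub>R window_transform N (\<mu> + 2 * of_real pi * \<i>) x"
    unfolding window_transform_def
    by (intro integral_unique has_integral_diff has_integral_cmul integrable_integral window_integrable)
  finally show ?thesis .
qed

text \<open>
  Without weight this is the resolvent estimate for a Laplace integral over \<open>[0, 1]\<close>. Multiplying the weight by
  \<open>sin\<^sup>2 (\<pi> s)\<close> averages over \<open>\<mu>\<close> and \<open>\<mu> \<plusminus> 2 \<pi> i\<close>, with coefficients whose absolute values sum to \<open>1\<close>; the real
  part of \<open>\<mu>\<close> and the number \<open>exp (- \<mu>)\<close> are unchanged. So the constant does not depend on \<open>N\<close>.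
\<close>

lemma window_transform_bound:
  assumes est: "\<And>l x y. Re l \<ge> - \<epsilon> \<Longrightarrow> (x, y) \<in> generator T \<Longrightarrow> norm x \<le> C * norm (y - l *\<^sub>C x)"
    and \<mu>: "Re \<mu> \<ge> - \<epsilon>"
  shows "norm (window_transform N \<mu> x) \<le> C * norm (x - exp (- \<mu>) *\<^sub>C T 1 x)"
  using \<mu>
proof (induction N arbitrary: \<mu>)
  case 0
  have "(window_transform 0 \<mu> x, (exp (- \<mu>) *\<^sub>C T 1 x - x) + \<mu> *\<^sub>C window_transform 0 \<mu> x) \<in> generator T"
    using laplace_in_generator[of 1 \<mu> x] by (simp add: window_transform_def)
  from est[OF 0 this] show ?case by (simp add: norm_minus_commute)
next
  case (Suc N)
  let ?B = "C * norm (x - exp (- \<mu>) *\<^sub>C T 1 x)"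
  have e: "exp (- (\<mu> - 2 * of_real pi * \<i>)) = exp (- \<mu>)" "exp (- (\<mu> + 2 * of_real pi * \<i>)) = exp (- \<mu>)"
    by (simp_all add: exp_diff exp_add exp_minus exp_two_pi_i inverse_eq_divide)
  have triangle: "norm (a - b - c) \<le> norm a + norm b + norm c" for a b c :: 'a
    using norm_triangle_ineq4[of "a - b" c] norm_triangle_ineq4[of a b] by linarith
  have "norm (window_transform (Suc N) \<mu> x) \<le> (1/2) * norm (window_transform N \<mu> x)
      + (1/4) * norm (window_transform N (\<mu> - 2 * of_real pi * \<i>) x) + (1/4) * norm (window_transform N (\<mu> + 2 * of_real pi * \<i>) x)"
    unfolding window_transform_Suc
    using triangle[of "(1/2) *\<^sub>R window_transform N \<mu> x"
        "(1/4) *\<^sub>R window_transform N (\<mu> - 2 * of_real pi * \<i>) x"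
        "(1/4) *\<^sub>R window_transform N (\<mu> + 2 * of_real pi * \<i>) x"] by simp
  also have "\<dots> \<le> (1/2) * ?B + (1/4) * ?B + (1/4) * ?B"
    by (intro add_mono mult_left_mono)
      (use Suc.IH[of \<mu>] Suc.IH[of "\<mu> - 2 * of_real pi * \<i>", unfolded e]
          Suc.IH[of "\<mu> + 2 * of_real pi * \<i>", unfolded e] Suc.prems in auto)
  finally show ?case by simp
qed

text \<open>
  Away from \<open>1/2\<close> the weight is at most \<open>cos\<^sup>2\<^sup>N (\<pi> \<eta>)\<close>, while its integral is at least \<open>\<eta> cos\<^sup>2\<^sup>N (\<pi> \<eta> / 2)\<close>.
\<close>

lemma window_concentration:
  assumes \<eta>: "0 < \<eta>" "\<eta> < 1/2" and d: "\<delta> > 0"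
  shows "\<exists>N. integral {0..1} (\<lambda>s. (sin (pi * s))\<^sup>2 ^ N) > 0 \<and>
    (\<forall>s\<in>{0..1}. \<eta> \<le> \<bar>s - 1/2\<bar> \<longrightarrow> (sin (pi * s))\<^sup>2 ^ N \<le> \<delta> * integral {0..1} (\<lambda>s. (sin (pi * s))\<^sup>2 ^ N))"
proof -
  have sin_cos: "(sin (pi * s))\<^sup>2 = (cos (pi * \<bar>s - 1/2\<bar>))\<^sup>2" for s
  proof -
    have "cos (pi * \<bar>s - 1/2\<bar>) = cos (pi / 2 - pi * s)"
      by (cases "s \<ge> 1/2") (simp_all add: algebra_simps flip: cos_minus[of "pi / 2 - pi * s"])
    then show ?thesis by (simp add: cos_diff)
  qed
  define a b where "a = (cos (pi * \<eta>))\<^sup>2" and "b = (cos (pi * (\<eta> / 2)))\<^sup>2"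
  have c1: "0 < cos (pi * \<eta>)" using \<eta> by (intro cos_gt_zero) (auto simp: field_simps)
  have c2: "cos (pi * \<eta>) < cos (pi * (\<eta> / 2))" using \<eta> by (intro cos_monotone_0_pi) auto
  have ab: "0 < a" "a < b" using c1 c2 by (auto simp: a_def b_def intro: power_strict_mono)
  obtain N where N: "(a / b) ^ N < \<delta> * \<eta>"
    using real_arch_pow_inv[of "\<delta> * \<eta>" "a / b"] ab d \<eta> by auto
  define I where "I = integral {0..1} (\<lambda>s. (sin (pi * s))\<^sup>2 ^ N)"
  have int: "(\<lambda>s. (sin (pi * s))\<^sup>2 ^ N) integrable_on {x..y}" for x y :: real
    by (intro integrable_continuous_real continuous_intros)
  have I: "\<eta> * b ^ N \<le> I"
  proof -
    have "\<eta> * b ^ N = integral {1/2 - \<eta>/2..1/2 + \<eta>/2} (\<lambda>_. b ^ N)" using \<eta> by simp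
    also have "\<dots> \<le> integral {1/2 - \<eta>/2..1/2 + \<eta>/2} (\<lambda>s. (sin (pi * s))\<^sup>2 ^ N)"
    proof (rule integral_le)
      fix s assume "s \<in> {1/2 - \<eta>/2..1/2 + \<eta>/2}"
      then have "1/2 - \<eta>/2 \<le> s" "s \<le> 1/2 + \<eta>/2" by simp_all
      then have "\<bar>s - 1/2\<bar> \<le> \<eta> / 2" by linarith
      then have "cos (pi * (\<eta> / 2)) \<le> cos (pi * \<bar>s - 1/2\<bar>)"
        using \<eta> by (intro cos_monotone_0_pi_le) auto
      then have "b \<le> (sin (pi * s))\<^sup>2"
        unfolding sin_cos b_def using c1 c2 by (intro power_mono) auto
      then show "b ^ N \<le> (sin (pi * s))\<^sup>2 ^ N" using ab by (intro power_mono) auto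
    qed (use int in auto)
    also have "\<dots> \<le> I" unfolding I_def
      by (rule integral_subset_le) (use \<eta> int in auto)
    finally show ?thesis .
  qed
  have tail: "(sin (pi * s))\<^sup>2 ^ N \<le> \<delta> * I" if s: "s \<in> {0..1}" "\<eta> \<le> \<bar>s - 1/2\<bar>" for s
  proof -
    have "cos (pi * \<bar>s - 1/2\<bar>) \<le> cos (pi * \<eta>)"
      using \<eta> s by (intro cos_monotone_0_pi_le) auto
    moreover have "0 \<le> cos (pi * \<bar>s - 1/2\<bar>)" using s by (intro cos_ge_zero) (auto simp: abs_if field_simps)
    ultimately have "(sin (pi * s))\<^sup>2 \<le> a" unfolding sin_cos a_def by (intro power_mono)
    then have "(sin (pi * s))\<^sup>2 ^ N \<le> a ^ N" by (intro power_mono) auto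
    also have "\<dots> = (a / b) ^ N * b ^ N" using ab by (simp add: power_divide)
    also have "\<dots> \<le> \<delta> * \<eta> * b ^ N" by (rule mult_right_mono) (use N ab in auto)
    also have "\<dots> \<le> \<delta> * I" using I d by (simp add: mult.assoc)
    finally show ?thesis .
  qed
  have "\<eta> * b ^ N > 0" using \<eta> ab by simp
  then have "I > 0" using I by linarith
  then show ?thesis using tail unfolding I_def by blast
qed

text \<open>
  If \<open>x\<close> is almost an eigenvector of \<open>T(1)\<close>, it is almost an eigenvector of \<open>T(j)\<close>, by telescoping.
\<close>

lemma orbit_defect:
  assumes M: "\<And>t. 0 \<le> t \<Longrightarrow> t \<le> real k \<Longrightarrow> norm (T t) \<le> M" and w: "cmod w \<le> r" and r: "r \<ge> 1" and jk: "j \<le> k"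
  shows "norm (x - w ^ j *\<^sub>C T (real j) x) \<le> real j * (r ^ k * M * norm (x - w *\<^sub>C T 1 x))"
  using jk
proof (induction j)
  case (Suc j)
  let ?\<delta> = "x - w *\<^sub>C T 1 x"
  have step: "w ^ j *\<^sub>C T (real j) ?\<delta> = w ^ j *\<^sub>C T (real j) x - w ^ Suc j *\<^sub>C T (real (Suc j)) x"
    using T_add[of "real j" 1 x]
    by (simp add: blinfun.diff_right scaleC.diff_right T_scaleC scaleC_scaleC add.commute mult.commute)
  have small: "norm (w ^ j *\<^sub>C T (real j) ?\<delta>) \<le> r ^ k * M * norm ?\<delta>"
  proof -
    have "cmod w ^ j \<le> r ^ j" by (rule power_mono[OF w]) simp
    also have "\<dots> \<le> r ^ k" using r Suc.prems by (intro power_increasing) auto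
    finally have 1: "cmod w ^ j \<le> r ^ k" .
    have 2: "norm (T (real j) ?\<delta>) \<le> M * norm ?\<delta>"
      by (rule order_trans[OF norm_blinfun mult_right_mono[OF M]]) (use Suc.prems in auto)
    show ?thesis unfolding norm_scaleC norm_power
      using mult_mono[OF 1 2] r by simp
  qed
  have triangle: "norm (x - w ^ Suc j *\<^sub>C T (real (Suc j)) x)
      \<le> norm (x - w ^ j *\<^sub>C T (real j) x) + norm (w ^ j *\<^sub>C T (real j) x - w ^ Suc j *\<^sub>C T (real (Suc j)) x)"
    using norm_triangle_ineq[of "x - w ^ j *\<^sub>C T (real j) x"
        "w ^ j *\<^sub>C T (real j) x - w ^ Suc j *\<^sub>C T (real (Suc j)) x"] by simp
  have "real (Suc j) * c = real j * c + c" for c by (simp add: distrib_right)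
  with triangle[folded step] small Suc.IH Suc.prems show ?case by simp
qed simp

text \<open>
  Norm continuity enters through uniform continuity of \<open>(\<mu>, s) \<mapsto> exp (- \<mu> s) T(s + t\<^sub>0)\<close> on a compact
  set: it allows one to evaluate \<open>exp (- \<mu> s) T(s + t\<^sub>0) x\<close> at \<open>s = 1/2\<close>, up to a small multiple of \<open>\<parallel>x\<parallel>\<close>,
  by a window transform. If \<open>\<delta> = x - w T(1) x\<close> is small, then so is the window transform, and \<open>x\<close> is close to
  \<open>w\<^sup>k T(k) x\<close>, an image of that value.
\<close>

lemma norm_continuous_a_priori:
  assumes t0: "t0 > 0" "continuous_on {t0..} T" and \<epsilon>: "\<epsilon> > 0"
    and est: "\<And>l x y. Re l \<ge> - \<epsilon> \<Longrightarrow> (x, y) \<in> generator T \<Longrightarrow> norm x \<le> C * norm (y - l *\<^sub>C x)"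
  shows "\<exists>K\<ge>1. \<forall>w x. cmod w \<le> exp \<epsilon> \<longrightarrow> norm x \<le> K * norm (x - w *\<^sub>C T 1 x)"
proof -
  define B where "B = 2 * (norm (T 1) + 1)"
  have B: "B > 0" by (simp add: B_def add_nonneg_pos)
  \<comment> \<open>For small \<open>w\<close> the term \<open>w T(1) x\<close> is absorbed; this confines \<open>\<mu> = - Ln w\<close> to a compact set.\<close>
  have small: "norm x \<le> 2 * norm (x - w *\<^sub>C T 1 x)" if w: "cmod w \<le> 1 / B" for w x
  proof -
    have "norm (w *\<^sub>C T 1 x) \<le> 1 / B * (norm (T 1) * norm x)"
      unfolding norm_scaleC by (intro mult_mono w norm_blinfun) (use B in auto)
    also have "\<dots> \<le> 1 / 2 * norm x"
    proof -
      have "1 / B * norm (T 1) \<le> 1 / 2" using B by (simp add: field_simps) (simp add: B_def)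
      from mult_right_mono[OF this, of "norm x"] show ?thesis by simp
    qed
    finally show ?thesis using norm_triangle_sub[of x "w *\<^sub>C T 1 x"] by simp
  qed
  define S where "S = cbox (Complex (- \<epsilon>) (- pi)) (Complex (ln B) pi)"
  define G where "G p = scalar_op (exp (- fst p * of_real (snd p))) o\<^sub>L T (snd p + t0)" for p :: "complex \<times> real"
  have compact: "compact (S \<times> {0..1::real})" unfolding S_def by (intro compact_Times) auto
  have "continuous_on (S \<times> {0..1}) (\<lambda>p. T (snd p + t0))"
    by (rule continuous_on_compose2[OF t0(2)]) (auto intro!: continuous_intros)
  then have contG: "continuous_on (S \<times> {0..1}) G"
    unfolding G_def by (intro continuous_intros)
  obtain L where L: "L > 0" "\<And>p. p \<in> S \<times> {0..1} \<Longrightarrow> norm (G p) \<le> L"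
    using compact_imp_bounded[OF compact_continuous_image[OF contG compact]]
    unfolding bounded_pos by auto
  \<comment> \<open>\<open>T(k) x\<close> has to be an image of \<open>T(t0 + 1/2) x\<close>.\<close>
  define k where "k = nat \<lceil>t0 + 1/2\<rceil>"
  have k: "real k \<ge> t0 + 1/2" using t0 by (simp add: k_def)
  obtain M where M: "M \<ge> 1" and bound: "\<forall>t. 0 \<le> t \<longrightarrow> t \<le> real k \<longrightarrow> norm (T t) \<le> M"
    using locally_bounded[of "real k"] by blast
  define L3 where "L3 = exp \<epsilon> ^ k * M"
  have L3: "L3 \<ge> 1" unfolding L3_def using M \<epsilon> mult_mono[of 1 "exp \<epsilon> ^ k" 1 M] by simp
  \<comment> \<open>The error \<open>2 \<theta> \<parallel>x\<parallel>\<close> of the evaluation at \<open>1/2\<close> is later multiplied by \<open>L3\<close> and then is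
    \<open>\<parallel>x\<parallel> / 2\<close>, which can be absorbed.\<close>
  define \<theta> where "\<theta> = 1 / (4 * L3)"
  have \<theta>: "\<theta> > 0" using L3 by (simp add: \<theta>_def)
  obtain \<eta>0 where \<eta>0: "\<eta>0 > 0" and unif: "\<And>p q. p \<in> S \<times> {0..1} \<Longrightarrow> q \<in> S \<times> {0..1} \<Longrightarrow> dist q p < \<eta>0 \<Longrightarrow> dist (G q) (G p) < \<theta>"
    using compact_uniformly_continuous[OF contG compact] \<theta> unfolding uniformly_continuous_on_def by metis
  define \<eta> where "\<eta> = min \<eta>0 (1/4)"
  have \<eta>: "0 < \<eta>" "\<eta> < 1/2" using \<eta>0 by (auto simp: \<eta>_def)
  obtain N where \<alpha>_pos: "integral {0..1} (\<lambda>s. (sin (pi * s))\<^sup>2 ^ N) > 0"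
    and tail: "\<And>s. s \<in> {0..1} \<Longrightarrow> \<eta> \<le> \<bar>s - 1/2\<bar> \<Longrightarrow>
      (sin (pi * s))\<^sup>2 ^ N \<le> \<theta> / (2 * L) * integral {0..1} (\<lambda>s. (sin (pi * s))\<^sup>2 ^ N)"
    using window_concentration[OF \<eta>, of "\<theta> / (2 * L)"] \<theta> L by auto
  define \<alpha> where "\<alpha> = integral {0..1} (\<lambda>s. (sin (pi * s))\<^sup>2 ^ N)"
  define C2 where "C2 = norm (T t0) * C / \<alpha>"
  have large: "norm x \<le> 2 * L3 * (C2 + real k) * norm (x - w *\<^sub>C T 1 x)"
    if w: "cmod w \<le> exp \<epsilon>" "cmod w > 1 / B" for w x
  proof -
    let ?\<delta> = "x - w *\<^sub>C T 1 x"
    define \<mu> where "\<mu> = - Ln w"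
    have w0: "w \<noteq> 0" using w B by auto
    have e\<mu>: "exp (- \<mu>) = w" using w0 by (simp add: \<mu>_def)
    have Re\<mu>: "Re \<mu> = - ln (cmod w)" using w0 by (simp add: \<mu>_def)
    have "ln (cmod w) \<le> ln (exp \<epsilon>)" using w w0 by (subst ln_le_cancel_iff) auto
    then have re1: "Re \<mu> \<ge> - \<epsilon>" unfolding Re\<mu> by simp
    have "1 / B \<le> cmod w" using w by simp
    then have "ln (1 / B) \<le> ln (cmod w)" using B w0 by (subst ln_le_cancel_iff) auto
    then have re2: "Re \<mu> \<le> ln B" unfolding Re\<mu> using B by (simp add: ln_div)
    have "\<bar>Im \<mu>\<bar> \<le> pi" using mpi_less_Im_Ln[OF w0] Im_Ln_le_pi[OF w0] by (auto simp: \<mu>_def)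
    then have \<mu>S: "\<mu> \<in> S" using re1 re2 by (auto simp: S_def in_cbox_complex_iff)
    define \<phi> where "\<phi> = G (\<mu>, 1/2) x"
    have diff: "(sin (pi * s))\<^sup>2 ^ N * norm (\<phi> - G (\<mu>, s) x) \<le> (\<theta> * (sin (pi * s))\<^sup>2 ^ N + \<theta> * \<alpha>) * norm x"
      if s: "s \<in> {0..1}" for s
    proof (cases "\<bar>s - 1/2\<bar> < \<eta>")
      case True
      then have "dist (\<mu>, 1/2) (\<mu>, s) < \<eta>0" by (auto simp: dist_Pair_Pair dist_real_def \<eta>_def)
      then have "dist (G (\<mu>, 1/2)) (G (\<mu>, s)) < \<theta>" by (intro unif) (use \<mu>S s in auto)
      then have "norm ((G (\<mu>, 1/2) - G (\<mu>, s)) x) \<le> \<theta> * norm x"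
        by (intro order_trans[OF norm_blinfun mult_right_mono]) (auto simp: dist_norm)
      then have "(sin (pi * s))\<^sup>2 ^ N * norm (\<phi> - G (\<mu>, s) x) \<le> (sin (pi * s))\<^sup>2 ^ N * (\<theta> * norm x)"
        by (intro mult_left_mono) (auto simp: \<phi>_def blinfun.diff_left)
      also have "\<dots> \<le> (\<theta> * (sin (pi * s))\<^sup>2 ^ N + \<theta> * \<alpha>) * norm x"
        using \<theta> \<alpha>_pos by (simp add: \<alpha>_def algebra_simps)
      finally show ?thesis .
    next
      case False
      have "norm (\<phi> - G (\<mu>, s) x) \<le> norm (G (\<mu>, 1/2) x) + norm (G (\<mu>, s) x)"
        unfolding \<phi>_def by (rule norm_triangle_ineq4)
      also have "\<dots> \<le> L * norm x + L * norm x"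
        by (intro add_mono order_trans[OF norm_blinfun mult_right_mono[OF L(2)]]) (use \<mu>S s in auto)
      finally have "(sin (pi * s))\<^sup>2 ^ N * norm (\<phi> - G (\<mu>, s) x) \<le> (\<theta> / (2 * L) * \<alpha>) * (2 * L * norm x)"
        using tail[OF s] False \<theta> L \<alpha>_pos by (intro mult_mono) (auto simp: \<alpha>_def)
      also have "\<dots> = \<theta> * \<alpha> * norm x" using L by simp
      also have "\<dots> \<le> (\<theta> * (sin (pi * s))\<^sup>2 ^ N + \<theta> * \<alpha>) * norm x"
        using \<theta> by (intro mult_right_mono) auto
      finally show ?thesis .
    qed
    have G_eq: "G (\<mu>, s) x = T t0 (exp (- \<mu> * of_real s) *\<^sub>C T s x)" if "s \<ge> 0" for s
      using that t0 T_add[of t0 s x] by (simp add: G_def T_scaleC add.commute)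
    have intG: "(\<lambda>s. (sin (pi * s))\<^sup>2 ^ N *\<^sub>R G (\<mu>, s) x) integrable_on {0..1}"
      and intG_eq: "integral {0..1} (\<lambda>s. (sin (pi * s))\<^sup>2 ^ N *\<^sub>R G (\<mu>, s) x) = T t0 (window_transform N \<mu> x)"
    proof -
      have "((\<lambda>s. T t0 ((sin (pi * s))\<^sup>2 ^ N *\<^sub>R exp (- \<mu> * of_real s) *\<^sub>C T s x)) has_integral
          T t0 (window_transform N \<mu> x)) {0..1}"
        unfolding window_transform_def
        using has_integral_linear[OF integrable_integral[OF window_integrable] blinfun.bounded_linear_right[of "T t0"]]
        by (simp add: comp_def)
      then have "((\<lambda>s. (sin (pi * s))\<^sup>2 ^ N *\<^sub>R G (\<mu>, s) x) has_integral T t0 (window_transform N \<mu> x)) {0..1}"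
        by (rule has_integral_eq[rotated]) (simp add: G_eq blinfun.scaleR_right)
      then show "(\<lambda>s. (sin (pi * s))\<^sup>2 ^ N *\<^sub>R G (\<mu>, s) x) integrable_on {0..1}"
        "integral {0..1} (\<lambda>s. (sin (pi * s))\<^sup>2 ^ N *\<^sub>R G (\<mu>, s) x) = T t0 (window_transform N \<mu> x)"
        by (auto simp: has_integral_iff)
    qed
    have int\<alpha>: "((\<lambda>s. (sin (pi * s))\<^sup>2 ^ N) has_integral \<alpha>) {0..1}"
      unfolding \<alpha>_def by (intro integrable_integral integrable_continuous_real continuous_intros)
    have int\<phi>: "((\<lambda>s. (sin (pi * s))\<^sup>2 ^ N *\<^sub>R \<phi>) has_integral \<alpha> *\<^sub>R \<phi>) {0..1}"
      by (rule has_integral_scaleR_left[OF int\<alpha>])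
    have "norm (integral {0..1} (\<lambda>s. (sin (pi * s))\<^sup>2 ^ N *\<^sub>R \<phi> - (sin (pi * s))\<^sup>2 ^ N *\<^sub>R G (\<mu>, s) x))
        \<le> integral {0..1} (\<lambda>s. (\<theta> * (sin (pi * s))\<^sup>2 ^ N + \<theta> * \<alpha>) * norm x)"
    proof (rule integral_norm_bound_integral)
      show "(\<lambda>s. (sin (pi * s))\<^sup>2 ^ N *\<^sub>R \<phi> - (sin (pi * s))\<^sup>2 ^ N *\<^sub>R G (\<mu>, s) x) integrable_on {0..1}"
        by (intro integrable_diff intG has_integral_integrable[OF int\<phi>])
      show "(\<lambda>s. (\<theta> * (sin (pi * s))\<^sup>2 ^ N + \<theta> * \<alpha>) * norm x) integrable_on {0..1}"
        by (intro integrable_continuous_real continuous_intros)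
      show "norm ((sin (pi * s))\<^sup>2 ^ N *\<^sub>R \<phi> - (sin (pi * s))\<^sup>2 ^ N *\<^sub>R G (\<mu>, s) x)
          \<le> (\<theta> * (sin (pi * s))\<^sup>2 ^ N + \<theta> * \<alpha>) * norm x" if "s \<in> {0..1}" for s
        using diff[OF that] by (simp flip: scaleR_diff_right)
    qed
    moreover have "integral {0..1} (\<lambda>s. (sin (pi * s))\<^sup>2 ^ N *\<^sub>R \<phi> - (sin (pi * s))\<^sup>2 ^ N *\<^sub>R G (\<mu>, s) x)
        = \<alpha> *\<^sub>R \<phi> - T t0 (window_transform N \<mu> x)"
      using has_integral_integrable[OF int\<phi>] integral_unique[OF int\<phi>] intG intG_eq by (simp add: integral_diff)
    moreover have "integral {0..1} (\<lambda>s. (\<theta> * (sin (pi * s))\<^sup>2 ^ N + \<theta> * \<alpha>) * norm x) = (\<theta> * \<alpha> + \<theta> * \<alpha>) * norm x"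
    proof (rule integral_unique)
      have "((\<lambda>s::real. \<theta> * \<alpha>) has_integral \<theta> * \<alpha>) {0..1}"
        using has_integral_const_real[of "\<theta> * \<alpha>" 0 1] by simp
      from has_integral_add[OF has_integral_mult_right[OF int\<alpha>] this]
      show "((\<lambda>s. (\<theta> * (sin (pi * s))\<^sup>2 ^ N + \<theta> * \<alpha>) * norm x) has_integral (\<theta> * \<alpha> + \<theta> * \<alpha>) * norm x) {0..1}"
        by (rule has_integral_mult_left)
    qed
    ultimately have "norm (\<alpha> *\<^sub>R \<phi> - T t0 (window_transform N \<mu> x)) \<le> (\<theta> * \<alpha> + \<theta> * \<alpha>) * norm x"
      by (simp only:)
    also have "\<dots> = 2 * \<theta> * \<alpha> * norm x" by (simp add: algebra_simps)
    finally have "norm (\<alpha> *\<^sub>R \<phi>) \<le> 2 * \<theta> * \<alpha> * norm x + norm (T t0 (window_transform N \<mu> x))"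
      using norm_triangle_sub[of "\<alpha> *\<^sub>R \<phi>" "T t0 (window_transform N \<mu> x)"] by linarith
    also have "norm (T t0 (window_transform N \<mu> x)) \<le> norm (T t0) * (C * norm ?\<delta>)"
      using window_transform_bound[OF est re1, of N x]
      by (intro order_trans[OF norm_blinfun mult_left_mono]) (auto simp: e\<mu>)
    also have "\<dots> = \<alpha> * (C2 * norm ?\<delta>)" using \<alpha>_pos by (simp add: C2_def \<alpha>_def)
    finally have "\<alpha> * norm \<phi> \<le> \<alpha> * (2 * \<theta> * norm x + C2 * norm ?\<delta>)"
      using \<alpha>_pos by (simp add: \<alpha>_def algebra_simps)
    then have \<phi>_bound: "norm \<phi> \<le> 2 * \<theta> * norm x + C2 * norm ?\<delta>"
      using \<alpha>_pos by (simp add: \<alpha>_def)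
    have "norm (w ^ k *\<^sub>C T (real k) x) \<le> L3 * norm \<phi>"
    proof -
      have "T (real k) x = T (real k - t0 - 1/2) (T (1/2 + t0) x)"
        using T_add[of "real k - t0 - 1/2" "1/2 + t0" x] k t0 by simp
      moreover have "w ^ k = exp (- \<mu> * of_real (real k - 1/2)) * exp (- \<mu> * of_real (1/2))"
      proof -
        have "w ^ k = exp (- \<mu> * of_real (real k))" by (simp add: e\<mu>[symmetric] exp_of_nat_mult[symmetric] mult.commute)
        also have "\<dots> = exp (- \<mu> * of_real (real k - 1/2) + - \<mu> * of_real (1/2))" by (simp add: algebra_simps)
        finally show ?thesis by (simp only: exp_add)
      qed
      ultimately have eq: "w ^ k *\<^sub>C T (real k) x = exp (- \<mu> * of_real (real k - 1/2)) *\<^sub>C T (real k - t0 - 1/2) \<phi>"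
        using k t0 by (simp add: \<phi>_def G_def T_scaleC scaleC_scaleC)
      have "cmod (exp (- \<mu> * of_real (real k - 1/2))) \<le> exp (\<epsilon> * real k)"
      proof -
        have "- Re \<mu> * (real k - 1/2) \<le> \<epsilon> * (real k - 1/2)" using re1 k t0 by (intro mult_right_mono) auto
        also have "\<dots> \<le> \<epsilon> * real k" using \<epsilon> by (intro mult_left_mono) auto
        finally show ?thesis by simp
      qed
      also have "exp (\<epsilon> * real k) = exp \<epsilon> ^ k" by (simp add: exp_of_nat_mult[symmetric] mult.commute)
      finally have 1: "cmod (exp (- \<mu> * of_real (real k - 1/2))) \<le> exp \<epsilon> ^ k" .
      have 2: "norm (T (real k - t0 - 1/2) \<phi>) \<le> M * norm \<phi>"
        by (rule order_trans[OF norm_blinfun mult_right_mono[OF bound[rule_format]]]) (use k t0 in auto)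
      show ?thesis unfolding eq norm_scaleC using mult_mono[OF 1 2] by (simp add: L3_def)
    qed
    also have "\<dots> \<le> L3 * (2 * \<theta> * norm x + C2 * norm ?\<delta>)" using \<phi>_bound L3 by simp
    also have "\<dots> = 1/2 * norm x + L3 * C2 * norm ?\<delta>" using L3 by (simp add: \<theta>_def field_simps)
    finally have a: "norm (w ^ k *\<^sub>C T (real k) x) \<le> 1/2 * norm x + L3 * C2 * norm ?\<delta>" .
    have "norm (x - w ^ k *\<^sub>C T (real k) x) \<le> real k * (L3 * norm ?\<delta>)"
      unfolding L3_def by (rule orbit_defect) (use bound w \<epsilon> in auto)
    with a have "norm x \<le> 1/2 * norm x + L3 * C2 * norm ?\<delta> + real k * (L3 * norm ?\<delta>)"
      using norm_triangle_sub[of x "w ^ k *\<^sub>C T (real k) x"] by linarith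
    then show ?thesis by (simp add: algebra_simps)
  qed
  define K where "K = max 2 (2 * L3 * (C2 + real k))"
  have "norm x \<le> K * norm (x - w *\<^sub>C T 1 x)" if "cmod w \<le> exp \<epsilon>" for w x
  proof (cases "cmod w \<le> 1 / B")
    case True
    show ?thesis by (rule order_trans[OF small[OF True] mult_right_mono]) (auto simp: K_def)
  next
    case False
    show ?thesis by (rule order_trans[OF large[OF that] mult_right_mono]) (use False in \<open>auto simp: K_def\<close>)
  qed
  then show ?thesis by (intro exI[of _ K]) (auto simp: K_def)
qed

lemma eventually_norm_continuous_stable:
  assumes "eventually_norm_continuous T"
    and "{l. Re l \<ge> 0} \<subseteq> resolvent_set (generator T)"
    and "bdd_above {norm (resolvent l (generator T)) | l. Re l \<ge> 0}"
  shows "uniformly_exponentially_stable T"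
proof -
  obtain t0 where t0: "t0 > 0" "continuous_on {t0..} T"
    using assms(1) unfolding eventually_norm_continuous_def by blast
  obtain \<epsilon> C where \<epsilon>: "\<epsilon> > 0"
    and est: "\<And>l x y. Re l \<ge> - \<epsilon> \<Longrightarrow> (x, y) \<in> generator T \<Longrightarrow> norm x \<le> C * norm (y - l *\<^sub>C x)"
    using bounded_resolvent_estimate[OF assms(2,3)] by blast
  obtain K where K: "K \<ge> 1" and apriori: "\<And>w x. cmod w \<le> exp \<epsilon> \<Longrightarrow> norm x \<le> K * norm (x - w *\<^sub>C T 1 x)"
    using norm_continuous_a_priori[OF t0 \<epsilon> est] by blast
  interpret a_priori_estimate "T 1" UNIV "exp \<epsilon>" K
    by unfold_locales (use T_linear apriori K in \<open>auto simp: complex_subspace_def\<close>)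
  have "norm (T (real n)) \<le> K * exp (- \<epsilon>) ^ n" for n
  proof (rule norm_blinfun_bound)
    fix x
    have "exp \<epsilon> ^ n * norm (T (real n) x) \<le> K * norm x"
      using power_bound[of x n] T_power[of 1 n x] by simp
    then show "norm (T (real n) x) \<le> K * exp (- \<epsilon>) ^ n * norm x"
      by (simp add: exp_minus power_inverse field_simps)
  qed (use K in simp)
  then show ?thesis using \<epsilon> by (intro stable_if_discrete_decay[of "exp (- \<epsilon>)" K]) auto
qed

end

section \<open>Integration with respect to a spectral measure\<close>

text \<open>
  A convex function on a cube attains its maximum at a vertex.
\<close>

lemma norm_convex_combination_le:
  fixes v :: "'i \<Rightarrow> 'b::real_normed_vector"
  assumes "finite I" "\<And>J. J \<subseteq> I \<Longrightarrow> norm (w + sum v J) \<le> K" "\<And>i. i \<in> I \<Longrightarrow> 0 \<le> b i \<and> b i \<le> 1"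
  shows "norm (w + (\<Sum>i\<in>I. b i *\<^sub>R v i)) \<le> K"
  using assms
proof (induction I arbitrary: w rule: finite_induct)
  case empty
  from empty.prems(1)[of "{}"] show ?case by simp
next
  case (insert a I)
  let ?s = "\<Sum>i\<in>I. b i *\<^sub>R v i"
  have 1: "norm (w + ?s) \<le> K"
    by (rule insert.IH) (use insert.prems in auto)
  have 2: "norm ((w + v a) + ?s) \<le> K"
  proof (rule insert.IH)
    fix J assume J: "J \<subseteq> I"
    then have "sum v (insert a J) = v a + sum v J"
      using insert.hyps finite_subset by (intro sum.insert) auto
    then show "norm ((w + v a) + sum v J) \<le> K"
      using insert.prems(1)[of "insert a J"] J by (auto simp: add.assoc)
  qed (use insert.prems in auto)
  have "w + (\<Sum>i\<in>insert a I. b i *\<^sub>R v i) = (1 - b a) *\<^sub>R (w + ?s) + b a *\<^sub>R ((w + v a) + ?s)"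
    using insert.hyps by (simp add: algebra_simps)
  also have "norm \<dots> \<le> (1 - b a) * norm (w + ?s) + b a * norm ((w + v a) + ?s)"
    using insert.prems(2)[of a] norm_triangle_ineq[of "(1 - b a) *\<^sub>R (w + ?s)" "b a *\<^sub>R ((w + v a) + ?s)"] by simp
  also have "\<dots> \<le> (1 - b a) * K + b a * K"
    using insert.prems(2)[of a] by (intro add_mono mult_left_mono 1 2) auto
  finally show ?case by (simp add: algebra_simps)
qed

text \<open>
  Coefficients in \<open>[- R, R]\<close> are affine images of coefficients in \<open>[0, 1]\<close>. The application is to
  spectral projections, whose partial sums are again projections with a common bound.
\<close>

lemma norm_real_combination_le:
  fixes v :: "'i \<Rightarrow> 'b::real_normed_vector"
  assumes fin: "finite I" and K: "\<And>J. J \<subseteq> I \<Longrightarrow> norm (sum v J) \<le> K"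
    and a: "\<And>i. i \<in> I \<Longrightarrow> \<bar>a i\<bar> \<le> R" and R: "R > 0"
  shows "norm (\<Sum>i\<in>I. a i *\<^sub>R v i) \<le> 3 * K * R"
proof -
  define b where "b i = (a i / R + 1) / 2" for i
  have b: "0 \<le> b i \<and> b i \<le> 1" if "i \<in> I" for i
    using a[OF that] R by (auto simp: b_def abs_le_iff field_simps)
  have "a i *\<^sub>R v i = (2 * R) *\<^sub>R b i *\<^sub>R v i - R *\<^sub>R v i" for i
    using R by (simp add: b_def field_simps flip: scaleR_diff_left)
  then have "(\<Sum>i\<in>I. a i *\<^sub>R v i) = (2 * R) *\<^sub>R (\<Sum>i\<in>I. b i *\<^sub>R v i) - R *\<^sub>R sum v I"
    by (simp add: sum_subtractf scaleR_sum_right)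
  also have "norm \<dots> \<le> 2 * R * norm (\<Sum>i\<in>I. b i *\<^sub>R v i) + R * norm (sum v I)"
    using norm_triangle_ineq4[of "(2 * R) *\<^sub>R (\<Sum>i\<in>I. b i *\<^sub>R v i)" "R *\<^sub>R sum v I"] R by simp
  also have "\<dots> \<le> 2 * R * K + R * K"
    using norm_convex_combination_le[OF fin, of 0 v K b] K b R by (intro add_mono mult_left_mono) auto
  finally show ?thesis by (simp add: algebra_simps)
qed

locale spectral =
  fixes E :: "complex set \<Rightarrow> ('a::complex_banach \<Rightarrow>\<^sub>L 'a)"
  assumes E: "spectral_measure E"
begin

lemma E_linear: "\<delta> \<in> sets borel \<Longrightarrow> complex_linear (E \<delta>)"
  and E_empty [simp]: "E {} = 0"
  and E_UNIV [simp]: "E UNIV = id_blinfun"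
  and E_Int: "\<delta> \<in> sets borel \<Longrightarrow> \<delta>' \<in> sets borel \<Longrightarrow> E (\<delta> \<inter> \<delta>') = E \<delta> o\<^sub>L E \<delta>'"
  and E_sums: "range D \<subseteq> sets borel \<Longrightarrow> disjoint_family D \<Longrightarrow> (\<lambda>n. E (D n) x) sums E (\<Union>n. D n) x"
  using E unfolding spectral_measure_def by blast+

lemma E_idem: "\<delta> \<in> sets borel \<Longrightarrow> E \<delta> (E \<delta> x) = E \<delta> x"
  using E_Int[of \<delta> \<delta>] by (metis Int_absorb blinfun_apply_blinfun_compose)

lemma E_Un:
  assumes "\<delta> \<in> sets borel" "\<delta>' \<in> sets borel" "\<delta> \<inter> \<delta>' = {}"
  shows "E (\<delta> \<union> \<delta>') = E \<delta> + E \<delta>'"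
proof (rule blinfun_eqI)
  fix x
  have "(\<lambda>n. E (binaryset \<delta> \<delta>' n) x) sums E (\<Union>n. binaryset \<delta> \<delta>' n) x"
  proof (rule E_sums)
    show "disjoint_family (binaryset \<delta> \<delta>')"
      using assms(3) by (auto simp: disjoint_family_on_def binaryset_def)
  qed (use assms in \<open>auto simp: range_binaryset_eq\<close>)
  moreover have "(\<lambda>n. E (binaryset \<delta> \<delta>' n) x) sums (E \<delta> x + E \<delta>' x)"
    by (rule binaryset_sums) simp
  ultimately show "E (\<delta> \<union> \<delta>') x = (E \<delta> + E \<delta>') x"
    by (simp add: UN_binaryset_eq blinfun.add_left sums_unique2)
qed

lemma E_Diff:
  assumes "\<delta> \<in> sets borel" "S \<in> sets borel" "\<delta> \<subseteq> S" shows "E (S - \<delta>) = E S - E \<delta>"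
proof -
  have "\<delta> \<union> (S - \<delta>) = S" using assms(3) by auto
  then show ?thesis using E_Un[of \<delta> "S - \<delta>"] assms by simp
qed

lemma E_finite_UN:
  assumes "finite I" "\<And>i. i \<in> I \<Longrightarrow> D i \<in> sets borel" "disjoint_family_on D I"
  shows "E (\<Union>i\<in>I. D i) = (\<Sum>i\<in>I. E (D i))"
  using assms
proof (induction I rule: finite_induct)
  case (insert a I)
  have "E (D a \<union> (\<Union>i\<in>I. D i)) = E (D a) + E (\<Union>i\<in>I. D i)"
    by (rule E_Un) (use insert in \<open>auto simp: disjoint_family_on_def\<close>)
  then show ?case using insert by (simp add: disjoint_family_on_def)
qed simp

lemma E_incseq:
  assumes D: "\<And>n::nat. D n \<in> sets borel" and inc: "incseq D"
  shows "(\<lambda>n. E (D n) x) \<longlonglongrightarrow> E (\<Union>n. D n) x"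
proof -
  have meas: "range (disjointed D) \<subseteq> sets borel" using D by (intro sets.range_disjointed_sets) auto
  have "(\<lambda>n. E (disjointed D n) x) sums E (\<Union>n. disjointed D n) x"
    by (rule E_sums[OF meas disjoint_family_disjointed])
  then have "(\<lambda>n. \<Sum>i<Suc n. E (disjointed D i) x) \<longlonglongrightarrow> E (\<Union>n. D n) x"
    unfolding sums_def UN_disjointed_eq by (rule LIMSEQ_Suc)
  moreover have "(\<Sum>i<Suc n. E (disjointed D i) x) = E (D n) x" for n
  proof -
    have "(\<Sum>i<Suc n. E (disjointed D i)) = E (\<Union>i<Suc n. disjointed D i)"
      by (rule E_finite_UN[symmetric])
        (use meas disjoint_family_disjointed[of D] in \<open>auto simp: disjoint_family_on_def\<close>)
    also have "(\<Union>i<Suc n. disjointed D i) = (\<Union>i<Suc n. D i)"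
      using finite_UN_disjointed_eq[of D "Suc n"] by (simp add: atLeast0LessThan)
    also have "\<dots> = D n" using inc by (force simp: incseq_def less_Suc_eq_le)
    finally show ?thesis by (simp add: blinfun.sum_left[symmetric])
  qed
  ultimately show ?thesis by simp
qed

text \<open>
  If \<open>\<delta> \<mapsto> E \<delta> x\<close> is unbounded on subsets of \<open>S\<close>, then \<open>S\<close> splits into two pieces, both with
  values of norm greater than \<open>1\<close>, one of which is again unbounded in this sense. Splitting repeatedly produces
  disjoint sets whose values do not tend to \<open>0\<close>, against \<open>\<sigma>\<close>-additivity.
\<close>

lemma E_pointwise_bounded: "\<exists>K. \<forall>\<delta>\<in>sets borel. norm (E \<delta> x) \<le> K"
proof (rule ccontr)
  assume unbounded: "\<not> ?thesis"
  define v where "v \<delta> = E \<delta> x" for \<delta>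
  define unb where "unb S \<longleftrightarrow> S \<in> sets borel \<and> (\<forall>K. \<exists>\<delta>\<in>sets borel. \<delta> \<subseteq> S \<and> norm (v \<delta>) > K)" for S
  have start: "unb UNIV" using unbounded by (auto simp: unb_def v_def not_le)
  have split: "\<exists>S'. unb S' \<and> S' \<subseteq> S \<and> norm (v (S - S')) > 1" if S: "unb S" for S
  proof -
    obtain \<delta> where \<delta>: "\<delta> \<in> sets borel" "\<delta> \<subseteq> S" "norm (v \<delta>) > 1 + norm (v S)"
      using S unfolding unb_def by blast
    have Sb: "S \<in> sets borel" using S by (simp add: unb_def)
    have "v (S - \<delta>) = v S - v \<delta>"
      using E_Diff[OF \<delta>(1) Sb \<delta>(2)] by (simp add: v_def blinfun.diff_left)
    then have big: "norm (v (S - \<delta>)) > 1"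
      using \<delta>(3) norm_triangle_ineq2[of "v \<delta>" "v S"] by (simp add: norm_minus_commute)
    have "unb \<delta> \<or> unb (S - \<delta>)"
    proof (rule ccontr)
      assume "\<not> (unb \<delta> \<or> unb (S - \<delta>))"
      then obtain K1 K2 where K1: "\<And>d. d \<in> sets borel \<Longrightarrow> d \<subseteq> \<delta> \<Longrightarrow> norm (v d) \<le> K1"
        and K2: "\<And>d. d \<in> sets borel \<Longrightarrow> d \<subseteq> S - \<delta> \<Longrightarrow> norm (v d) \<le> K2"
        using \<delta>(1) Sb unfolding unb_def by (metis not_le sets.Diff)
      have "norm (v d) \<le> K1 + K2" if d: "d \<in> sets borel" "d \<subseteq> S" for d
      proof -
        have "v d = v (d \<inter> \<delta>) + v (d - \<delta>)"
          using E_Un[of "d \<inter> \<delta>" "d - \<delta>"] d \<delta>(1)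
          by (simp add: v_def Int_Diff_Un Int_Diff_disjoint blinfun.add_left)
        then show ?thesis
          using K1[of "d \<inter> \<delta>"] K2[of "d - \<delta>"] d \<delta>(1) norm_triangle_mono[of "v (d \<inter> \<delta>)" K1 "v (d - \<delta>)" K2]
          by auto
      qed
      then show False using S unfolding unb_def by (metis not_le)
    qed
    then show ?thesis
    proof
      assume "unb \<delta>"
      then show ?thesis using big \<delta>(2) by blast
    next
      assume "unb (S - \<delta>)"
      moreover have "S - (S - \<delta>) = \<delta>" using \<delta>(2) by auto
      moreover have "norm (v \<delta>) > 1" using \<delta>(3) norm_ge_zero[of "v S"] by linarith
      ultimately show ?thesis by (metis Diff_subset)
    qed
  qed
  obtain S where S: "\<And>n::nat. unb (S n)" "\<And>n. S (Suc n) \<subseteq> S n \<and> norm (v (S n - S (Suc n))) > 1"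
    using dependent_nat_choice[of "\<lambda>_ S. unb S" "\<lambda>_ S S'. S' \<subseteq> S \<and> norm (v (S - S')) > 1"] start split
    by metis
  have anti: "S n \<subseteq> S m" if "m \<le> n" for m n
    by (rule lift_Suc_antimono_le[OF _ that]) (use S in blast)
  have "disjoint_family (\<lambda>n. S n - S (Suc n))"
  proof -
    have "(S m - S (Suc m)) \<inter> (S n - S (Suc n)) = {}" if "m < n" for m n
      using anti[of "Suc m" n] that by auto
    then show ?thesis unfolding disjoint_family_on_def by (metis Int_commute linorder_neqE_nat)
  qed
  then have "(\<lambda>n. v (S n - S (Suc n))) sums v (\<Union>n. S n - S (Suc n))"
    unfolding v_def by (intro E_sums) (use S(1) in \<open>auto simp: unb_def\<close>)
  then have "(\<lambda>n. v (S n - S (Suc n))) \<longlonglongrightarrow> 0" by (intro summable_LIMSEQ_zero) (rule sums_summable)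
  then have "\<forall>\<^sub>F n in sequentially. norm (v (S n - S (Suc n))) < 1"
    by (auto dest: tendstoD[of _ _ _ 1])
  then obtain n where "norm (v (S n - S (Suc n))) < 1" by (auto simp: eventually_sequentially)
  then show False using S(2)[of n] by simp
qed

definition E_bound :: real where
  "E_bound = (SOME K. K \<ge> 1 \<and> (\<forall>\<delta>\<in>sets borel. norm (E \<delta>) \<le> K))"

lemma E_bound: "E_bound \<ge> 1" "\<delta> \<in> sets borel \<Longrightarrow> norm (E \<delta>) \<le> E_bound"
proof -
  obtain K where K: "\<forall>\<delta>\<in>sets borel. norm (E \<delta>) \<le> K"
    using uniform_boundedness_principle[of "sets borel" E, OF E_pointwise_bounded] by blast
  have "max 1 K \<ge> 1 \<and> (\<forall>\<delta>\<in>sets borel. norm (E \<delta>) \<le> max 1 K)" using K by (auto simp: le_max_iff_disj)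
  from someI[where P="\<lambda>K. K \<ge> 1 \<and> (\<forall>\<delta>\<in>sets borel. norm (E \<delta>) \<le> K)", OF this]
  show "E_bound \<ge> 1" "\<delta> \<in> sets borel \<Longrightarrow> norm (E \<delta>) \<le> E_bound" unfolding E_bound_def by auto
qed

definition borel_partition :: "(complex \<Rightarrow> 'p) \<Rightarrow> bool" where
  "borel_partition p \<longleftrightarrow> finite (range p) \<and> (\<forall>i. p -` {i} \<in> sets borel)"

lemma simple_function_iff_borel_partition: "simple_function borel s \<longleftrightarrow> borel_partition s"
proof -
  have "s -` {i} = {}" if "i \<notin> range s" for i using that by auto
  then have "(\<forall>i\<in>range s. s -` {i} \<in> sets borel) \<longleftrightarrow> (\<forall>i. s -` {i} \<in> sets borel)"
    by (metis sets.empty_sets)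
  then show ?thesis unfolding simple_function_def borel_partition_def by simp
qed

lemma borel_partition_Pair:
  assumes "borel_partition p" "borel_partition q" shows "borel_partition (\<lambda>z. (p z, q z))"
proof -
  have "range (\<lambda>z. (p z, q z)) \<subseteq> range p \<times> range q" by auto
  then have "finite (range (\<lambda>z. (p z, q z)))"
    by (rule finite_subset) (use assms in \<open>simp add: borel_partition_def\<close>)
  moreover have "(\<lambda>z. (p z, q z)) -` {i} = p -` {fst i} \<inter> q -` {snd i}" for i by auto
  ultimately show ?thesis using assms unfolding borel_partition_def by (simp add: sets.Int)
qed

lemma borel_partition_comp:
  assumes "borel_partition p" shows "borel_partition (\<lambda>z. h (p z))"
proof -
  have "range (\<lambda>z. h (p z)) = h ` range p" by auto
  moreover have "(\<lambda>z. h (p z)) -` {c} = (\<Union>i\<in>{i\<in>range p. h i = c}. p -` {i})" for c by auto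
  ultimately show ?thesis using assms unfolding borel_partition_def
    by (auto intro!: sets.finite_UN)
qed

text \<open>
  The integral may be computed from any finite Borel partition that refines the level sets. Two simple
  functions have a common such partition, which yields additivity and multiplicativity.
\<close>

lemma simple_integral_partition:
  assumes p: "borel_partition p"
  shows "simple_spectral_integral E (\<lambda>z. h (p z)) = (\<Sum>i\<in>range p. scalar_op (h i) o\<^sub>L E (p -` {i}))"
proof -
  have fin: "finite (range p)" and meas: "\<And>i. p -` {i} \<in> sets borel"
    using p by (auto simp: borel_partition_def)
  have "scalar_op c o\<^sub>L E ((\<lambda>z. h (p z)) -` {c})
      = (\<Sum>i | i \<in> range p \<and> h i = c. scalar_op (h i) o\<^sub>L E (p -` {i}))" for c
  proof -
    have "(\<lambda>z. h (p z)) -` {c} = (\<Union>i\<in>{i\<in>range p. h i = c}. p -` {i})" by auto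
    also have "E \<dots> = (\<Sum>i\<in>{i\<in>range p. h i = c}. E (p -` {i}))"
      by (rule E_finite_UN) (use fin meas in \<open>auto simp: disjoint_family_on_def\<close>)
    finally show ?thesis by (simp add: bounded_bilinear.sum_right[OF bounded_bilinear_blinfun_compose])
  qed
  then have "simple_spectral_integral E (\<lambda>z. h (p z))
      = (\<Sum>c\<in>h ` range p. \<Sum>i | i \<in> range p \<and> h i = c. scalar_op (h i) o\<^sub>L E (p -` {i}))"
    unfolding simple_spectral_integral_def by (simp add: image_image)
  also have "\<dots> = (\<Sum>i\<in>range p. scalar_op (h i) o\<^sub>L E (p -` {i}))"
    by (rule sum.image_gen[OF fin, symmetric])
  finally show ?thesis .
qed

lemma simple_integral_pair:
  assumes s: "borel_partition s" and s': "borel_partition s'"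
  defines "p \<equiv> \<lambda>z. (s z, s' z)"
  shows "simple_spectral_integral E s = (\<Sum>i\<in>range p. scalar_op (fst i) o\<^sub>L E (p -` {i}))"
    and "simple_spectral_integral E s' = (\<Sum>i\<in>range p. scalar_op (snd i) o\<^sub>L E (p -` {i}))"
    and "simple_spectral_integral E (\<lambda>z. f (s z) (s' z)) = (\<Sum>i\<in>range p. scalar_op (f (fst i) (snd i)) o\<^sub>L E (p -` {i}))"
proof -
  have p: "borel_partition p" unfolding p_def by (rule borel_partition_Pair[OF s s'])
  show "simple_spectral_integral E s = (\<Sum>i\<in>range p. scalar_op (fst i) o\<^sub>L E (p -` {i}))"
    "simple_spectral_integral E s' = (\<Sum>i\<in>range p. scalar_op (snd i) o\<^sub>L E (p -` {i}))"
    "simple_spectral_integral E (\<lambda>z. f (s z) (s' z)) = (\<Sum>i\<in>range p. scalar_op (f (fst i) (snd i)) o\<^sub>L E (p -` {i}))"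
    using simple_integral_partition[OF p, of fst] simple_integral_partition[OF p, of snd]
      simple_integral_partition[OF p, of "\<lambda>i. f (fst i) (snd i)"] by (simp_all add: p_def)
qed

lemma simple_integral_diff:
  assumes "borel_partition s" "borel_partition s'"
  shows "simple_spectral_integral E (\<lambda>z. s z - s' z) = simple_spectral_integral E s - simple_spectral_integral E s'"
proof -
  have sub: "scalar_op (a - b) o\<^sub>L F = (scalar_op a o\<^sub>L F) - (scalar_op b o\<^sub>L F)" for a b and F :: "'a \<Rightarrow>\<^sub>L 'a"
    by (rule blinfun_eqI) (simp add: blinfun.diff_left scaleC.diff_left)
  show ?thesis
    unfolding simple_integral_pair(1,2)[OF assms] simple_integral_pair(3)[OF assms, of "(-)"] sub
    by (rule sum_subtractf)
qed

lemma simple_integral_mult: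
  assumes s: "borel_partition s" and s': "borel_partition s'"
  shows "simple_spectral_integral E (\<lambda>z. s z * s' z) = simple_spectral_integral E s o\<^sub>L simple_spectral_integral E s'"
proof -
  let ?p = "\<lambda>z. (s z, s' z)"
  have p: "borel_partition ?p" by (rule borel_partition_Pair[OF s s'])
  then have fin: "finite (range ?p)" and meas: "\<And>i. ?p -` {i} \<in> sets borel"
    unfolding borel_partition_def by blast+
  have prod: "(scalar_op a o\<^sub>L E (?p -` {i})) o\<^sub>L (scalar_op b o\<^sub>L E (?p -` {j}))
      = (if i = j then scalar_op (a * b) o\<^sub>L E (?p -` {i}) else 0)" for a b i j
  proof -
    have "(scalar_op a o\<^sub>L E (?p -` {i})) o\<^sub>L (scalar_op b o\<^sub>L E (?p -` {j}))
        = scalar_op (a * b) o\<^sub>L E (?p -` {i} \<inter> ?p -` {j})"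
      unfolding E_Int[OF meas meas]
      by (rule blinfun_eqI) (simp add: complex_linearD[OF E_linear[OF meas]] scaleC_scaleC)
    moreover have "?p -` {i} \<inter> ?p -` {j} = (if i = j then ?p -` {i} else {})" by auto
    ultimately show ?thesis by simp
  qed
  have "simple_spectral_integral E s o\<^sub>L simple_spectral_integral E s'
      = (\<Sum>i\<in>range ?p. \<Sum>j\<in>range ?p. if i = j then scalar_op (fst i * snd j) o\<^sub>L E (?p -` {i}) else 0)"
    unfolding simple_integral_pair(1,2)[OF s s']
    by (simp only: bounded_bilinear.sum_left[OF bounded_bilinear_blinfun_compose] bounded_bilinear.sum_right[OF bounded_bilinear_blinfun_compose] prod)
      (rule sum.swap)
  also have "\<dots> = (\<Sum>i\<in>range ?p. scalar_op (fst i * snd i) o\<^sub>L E (?p -` {i}))"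
    using fin by (simp add: sum.delta)
  also have "\<dots> = simple_spectral_integral E (\<lambda>z. s z * s' z)"
    using simple_integral_pair(3)[OF s s', of "(*)"] by simp
  finally show ?thesis by simp
qed

text \<open>
  The partial sums of the projections \<open>E (s -` {c})\<close> are again values of \<open>E\<close>; real and imaginary parts of the
  coefficients are estimated separately.
\<close>

lemma simple_integral_bound:
  assumes s: "borel_partition s" and R: "\<And>z. cmod (s z) \<le> R" "R > 0"
  shows "norm (simple_spectral_integral E s) \<le> 6 * E_bound * R"
proof -
  let ?v = "\<lambda>c. E (s -` {c})"
  have fin: "finite (range s)" and meas: "\<And>i. s -` {i} \<in> sets borel"
    using s by (auto simp: borel_partition_def)
  have J: "norm (sum ?v J) \<le> E_bound" if "J \<subseteq> range s" for J
  proof -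
    have "sum ?v J = E (\<Union>c\<in>J. s -` {c})"
      by (rule E_finite_UN[symmetric])
        (use that fin meas finite_subset in \<open>auto simp: disjoint_family_on_def\<close>)
    moreover have "(\<Union>c\<in>J. s -` {c}) \<in> sets borel"
      using that fin meas finite_subset by (intro sets.finite_UN) auto
    ultimately show ?thesis using E_bound(2) by simp
  qed
  have part: "scalar_op c o\<^sub>L F = Re c *\<^sub>R F + (scalar_op \<i> o\<^sub>L (Im c *\<^sub>R F))" for c and F :: "'a \<Rightarrow>\<^sub>L 'a"
  proof (rule blinfun_eqI)
    fix x
    have "c *\<^sub>C F x = (of_real (Re c) + \<i> * of_real (Im c)) *\<^sub>C F x" by (simp flip: complex_eq)
    also have "\<dots> = Re c *\<^sub>R F x + \<i> *\<^sub>C Im c *\<^sub>R F x"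
      by (simp only: scaleC.add_left scaleC_scaleC[symmetric] scaleC_of_real)
    finally show "(scalar_op c o\<^sub>L F) x = (Re c *\<^sub>R F + (scalar_op \<i> o\<^sub>L (Im c *\<^sub>R F))) x"
      by (simp add: blinfun.add_left blinfun.scaleR_left)
  qed
  define A where "A = (\<Sum>c\<in>range s. Re c *\<^sub>R ?v c)"
  define B where "B = (\<Sum>c\<in>range s. Im c *\<^sub>R ?v c)"
  have A: "norm A \<le> 3 * E_bound * R" unfolding A_def
    by (rule norm_real_combination_le[OF fin J]) (use R abs_Re_le_cmod in \<open>auto intro: order_trans\<close>)
  have B: "norm B \<le> 3 * E_bound * R" unfolding B_def
    by (rule norm_real_combination_le[OF fin J]) (use R abs_Im_le_cmod in \<open>auto intro: order_trans\<close>)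
  have "simple_spectral_integral E s = (\<Sum>c\<in>range s. Re c *\<^sub>R ?v c + (scalar_op \<i> o\<^sub>L (Im c *\<^sub>R ?v c)))"
    unfolding simple_spectral_integral_def by (intro sum.cong refl part)
  then have "simple_spectral_integral E s = A + (scalar_op \<i> o\<^sub>L B)"
    by (simp add: A_def B_def sum.distrib bounded_bilinear.sum_right[OF bounded_bilinear_blinfun_compose])
  moreover have "norm (A + (scalar_op \<i> o\<^sub>L B)) \<le> norm A + norm B"
    using norm_triangle_ineq[of A "scalar_op \<i> o\<^sub>L B"] norm_scalar_op_comp_le[of \<i> B] by simp
  ultimately show ?thesis using A B by simp
qed

lemma spectral_integral_simple:
  "borel_partition s \<Longrightarrow> has_spectral_integral E s (simple_spectral_integral E s)"
  unfolding has_spectral_integral_def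
  by (intro exI[of _ "\<lambda>_. s"]) (auto simp: simple_function_iff_borel_partition uniform_limit_const)

lemma spectral_integral_indicator:
  assumes "\<delta> \<in> sets borel"
  shows "has_spectral_integral E (\<lambda>z. if z \<in> \<delta> then 1 else 0) (E \<delta>)"
proof -
  let ?p = "\<lambda>z. z \<in> \<delta>"
  have pre: "?p -` {True} = \<delta>" "?p -` {False} = - \<delta>" by auto
  have p: "borel_partition ?p"
    unfolding borel_partition_def
  proof (intro conjI allI)
    show "?p -` {i} \<in> sets borel" for i using assms pre by (cases i) auto
  qed simp
  have "simple_spectral_integral E (\<lambda>z. of_bool (?p z)) = (\<Sum>i\<in>range ?p. scalar_op (of_bool i) o\<^sub>L E (?p -` {i}))"
    by (rule simple_integral_partition[OF p])
  also have "\<dots> = (\<Sum>i\<in>UNIV. scalar_op (of_bool i) o\<^sub>L E (?p -` {i}))"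
  proof (rule sum.mono_neutral_left)
    have "?p -` {i} = {}" if "i \<notin> range ?p" for i using that by auto
    then show "\<forall>i\<in>UNIV - range ?p. scalar_op (of_bool i) o\<^sub>L E (?p -` {i}) = 0" by simp
  qed auto
  also have "\<dots> = (scalar_op 1 o\<^sub>L E \<delta>) + (scalar_op 0 o\<^sub>L E (- \<delta>))"
    unfolding UNIV_bool using pre by simp
  also have "\<dots> = E \<delta>" by (rule blinfun_eqI) (simp add: blinfun.add_left scaleC.zero_left)
  finally show ?thesis
    using spectral_integral_simple[OF borel_partition_comp[OF p, of of_bool]]
    by (simp add: of_bool_def if_distrib)
qed

lemma spectral_integral_diff:
  assumes "has_spectral_integral E f S" "has_spectral_integral E g S'"
  shows "has_spectral_integral E (\<lambda>z. f z - g z) (S - S')"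
proof -
  obtain s where s: "\<And>n. borel_partition (s n)" "uniform_limit UNIV s f sequentially"
      "(\<lambda>n. simple_spectral_integral E (s n)) \<longlonglongrightarrow> S"
    using assms(1) unfolding has_spectral_integral_def simple_function_iff_borel_partition by blast
  obtain s' where s': "\<And>n. borel_partition (s' n)" "uniform_limit UNIV s' g sequentially"
      "(\<lambda>n. simple_spectral_integral E (s' n)) \<longlonglongrightarrow> S'"
    using assms(2) unfolding has_spectral_integral_def simple_function_iff_borel_partition by blast
  show ?thesis
    unfolding has_spectral_integral_def simple_function_iff_borel_partition
  proof (intro exI[of _ "\<lambda>n z. s n z - s' n z"] conjI allI)
    show "borel_partition (\<lambda>z. s n z - s' n z)" for n
      using borel_partition_comp[OF borel_partition_Pair[OF s(1) s'(1)], of "\<lambda>(a, b). a - b"] by simp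
    show "uniform_limit UNIV (\<lambda>n z. s n z - s' n z) (\<lambda>z. f z - g z) sequentially"
      by (intro uniform_limit_minus s s')
    show "(\<lambda>n. simple_spectral_integral E (\<lambda>z. s n z - s' n z)) \<longlonglongrightarrow> S - S'"
      unfolding simple_integral_diff[OF s(1) s'(1)] by (intro tendsto_diff s s')
  qed
qed

lemma spectral_integral_mult:
  assumes "has_spectral_integral E f S" "has_spectral_integral E g S'" "bounded (range f)" "bounded (range g)"
  shows "has_spectral_integral E (\<lambda>z. f z * g z) (S o\<^sub>L S')"
proof -
  obtain s where s: "\<And>n. borel_partition (s n)" "uniform_limit UNIV s f sequentially"
      "(\<lambda>n. simple_spectral_integral E (s n)) \<longlonglongrightarrow> S"
    using assms(1) unfolding has_spectral_integral_def simple_function_iff_borel_partition by blast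
  obtain s' where s': "\<And>n. borel_partition (s' n)" "uniform_limit UNIV s' g sequentially"
      "(\<lambda>n. simple_spectral_integral E (s' n)) \<longlonglongrightarrow> S'"
    using assms(2) unfolding has_spectral_integral_def simple_function_iff_borel_partition by blast
  show ?thesis
    unfolding has_spectral_integral_def simple_function_iff_borel_partition
  proof (intro exI[of _ "\<lambda>n z. s n z * s' n z"] conjI allI)
    show "borel_partition (\<lambda>z. s n z * s' n z)" for n
      using borel_partition_comp[OF borel_partition_Pair[OF s(1) s'(1)], of "\<lambda>(a, b). a * b"] by simp
    show "uniform_limit UNIV (\<lambda>n z. s n z * s' n z) (\<lambda>z. f z * g z) sequentially"
      by (intro uniform_lim_mult s s' assms)
    show "(\<lambda>n. simple_spectral_integral E (\<lambda>z. s n z * s' n z)) \<longlonglongrightarrow> (S o\<^sub>L S')"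
      unfolding simple_integral_mult[OF s(1) s'(1)] by (intro tendsto_intros s s')
  qed
qed

lemma spectral_integral_bound:
  assumes "has_spectral_integral E f S" and R: "\<And>z. cmod (f z) \<le> R" "R \<ge> 0"
  shows "norm S \<le> 6 * E_bound * R"
proof -
  obtain s where s: "\<And>n. borel_partition (s n)" "uniform_limit UNIV s f sequentially"
      "(\<lambda>n. simple_spectral_integral E (s n)) \<longlonglongrightarrow> S"
    using assms(1) unfolding has_spectral_integral_def simple_function_iff_borel_partition by blast
  have "norm S \<le> 6 * E_bound * R + e" if e: "e > 0" for e
  proof -
    define d where "d = e / (6 * E_bound)"
    have d: "d > 0" using e E_bound(1) by (simp add: d_def)
    have "\<forall>\<^sub>F n in sequentially. norm (simple_spectral_integral E (s n)) \<le> 6 * E_bound * (R + d)"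
      using uniform_limitD[OF s(2) d]
    proof eventually_elim
      case (elim n)
      have "cmod (s n z) \<le> R + d" for z
      proof -
        have "cmod (s n z - f z) < d" using elim by (simp add: dist_norm)
        then show ?thesis using R(1)[of z] norm_triangle_sub[of "s n z" "f z"] by linarith
      qed
      then show ?case by (rule simple_integral_bound[OF s(1)]) (use R d in auto)
    qed
    then have "norm S \<le> 6 * E_bound * (R + d)"
      by (rule tendsto_upperbound[OF tendsto_norm[OF s(3)]]) simp
    also have "\<dots> = 6 * E_bound * R + e" using E_bound(1) by (simp add: d_def field_simps)
    finally show ?thesis .
  qed
  then show ?thesis by (rule field_le_epsilon)
qed

lemma spectral_integral_unique:
  assumes "has_spectral_integral E f S" "has_spectral_integral E f S'" shows "S = S'"
proof -
  have "norm (S - S') \<le> 6 * E_bound * 0"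
    by (rule spectral_integral_bound[OF spectral_integral_diff[OF assms]]) auto
  then show ?thesis by simp
qed

text \<open>
  By multiplicativity \<open>S\<^sup>n\<close> is the integral of \<open>f\<^sup>n\<close>, so the constant is the same for all \<open>n\<close>.
\<close>

lemma spectral_integral_power_bound:
  assumes f: "has_spectral_integral E f S" and R: "\<And>z. cmod (f z) \<le> R" "R \<ge> 0"
  shows "norm ((blinfun_apply S ^^ n) x) \<le> 6 * E_bound * R ^ n * norm x"
proof -
  have bdd: "bounded (range (\<lambda>z. f z ^ n))" for n
    by (rule boundedI[of _ "R ^ n"]) (auto simp: norm_power intro!: power_mono R)
  have "\<exists>P. has_spectral_integral E (\<lambda>z. f z ^ n) P \<and> blinfun_apply P = blinfun_apply S ^^ n"
  proof (induction n)
    case 0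
    show ?case using spectral_integral_indicator[of UNIV] by (intro exI[of _ id_blinfun]) auto
  next
    case (Suc n)
    then obtain P where P: "has_spectral_integral E (\<lambda>z. f z ^ n) P" "blinfun_apply P = blinfun_apply S ^^ n" by blast
    have "has_spectral_integral E (\<lambda>z. f z * f z ^ n) (S o\<^sub>L P)"
      by (rule spectral_integral_mult[OF f P(1) _ bdd]) (use bdd[of 1] in simp)
    then show ?case using P(2) by (intro exI[of _ "S o\<^sub>L P"]) auto
  qed
  then obtain P where P: "has_spectral_integral E (\<lambda>z. f z ^ n) P" "blinfun_apply P = blinfun_apply S ^^ n" by blast
  have "norm P \<le> 6 * E_bound * R ^ n"
    by (rule spectral_integral_bound[OF P(1)]) (use R in \<open>auto simp: norm_power intro!: power_mono\<close>)
  then show ?thesis unfolding P(2)[symmetric] by (rule order_trans[OF norm_blinfun mult_right_mono]) simp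
qed

text \<open>
  Rounding the real and imaginary parts down to multiples of \<open>1 / (n + 1)\<close> gives simple functions that
  converge uniformly.
\<close>

lemma spectral_integral_exists:
  assumes meas: "f \<in> borel_measurable borel" and R: "\<And>z. cmod (f z) \<le> R"
  shows "\<exists>S. has_spectral_integral E f S"
proof -
  define r where "r n x = of_int \<lfloor>real (Suc n) * x\<rfloor> / real (Suc n)" for n and x :: real
  define s where "s n z = Complex (r n (Re (f z))) (r n (Im (f z)))" for n z
  have r: "\<bar>r n x - x\<bar> \<le> 1 / real (Suc n)" for n x
  proof -
    have "real (Suc n) * (r n x - x) = of_int \<lfloor>real (Suc n) * x\<rfloor> - real (Suc n) * x" 
      by (simp add: r_def right_diff_distrib)
    then have "\<bar>real (Suc n) * (r n x - x)\<bar> \<le> 1" by linarith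
    then have "real (Suc n) * \<bar>r n x - x\<bar> \<le> 1" by (simp only: abs_mult abs_of_nat)
    then show ?thesis by (simp add: pos_le_divide_eq mult.commute del: of_nat_Suc)
  qed
  have close: "cmod (s n z - f z) \<le> 2 / real (Suc n)" for n z
  proof -
    have "cmod (s n z - f z) \<le> \<bar>r n (Re (f z)) - Re (f z)\<bar> + \<bar>r n (Im (f z)) - Im (f z)\<bar>"
      using cmod_le[of "s n z - f z"] by (simp add: s_def)
    also have "\<dots> \<le> 1 / real (Suc n) + 1 / real (Suc n)" by (intro add_mono r)
    finally show ?thesis by simp
  qed
  have part: "borel_partition (s n)" for n
    unfolding simple_function_iff_borel_partition[symmetric]
  proof (rule simple_function_borel_measurable)
    have [measurable]: "(\<lambda>x. Re (f x)) \<in> borel_measurable borel" "(\<lambda>x. Im (f x)) \<in> borel_measurable borel"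
      using meas by (simp_all add: borel_measurable_complex_iff)
    show "s n \<in> borel_measurable borel"
      unfolding s_def r_def borel_measurable_complex_iff complex.sel by (intro conjI) measurable
    let ?J = "{\<lfloor>- (real (Suc n) * R)\<rfloor>..\<lfloor>real (Suc n) * R\<rfloor>}"
    have "r n x \<in> (\<lambda>j. of_int j / real (Suc n)) ` ?J" if "\<bar>x\<bar> \<le> R" for x
    proof -
      have "real (Suc n) * x \<le> real (Suc n) * R" "real (Suc n) * (- R) \<le> real (Suc n) * x"
        by (intro mult_left_mono; use that in auto)+
      then have "\<lfloor>real (Suc n) * x\<rfloor> \<in> ?J" by (auto intro!: floor_mono)
      then show ?thesis unfolding r_def by blast
    qed
    moreover have "\<bar>Re (f z)\<bar> \<le> R" "\<bar>Im (f z)\<bar> \<le> R" for z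
      using R[of z] abs_Re_le_cmod[of "f z"] abs_Im_le_cmod[of "f z"] by linarith+
    ultimately have "s n ` space borel \<subseteq> (\<lambda>(a, b). Complex a b) `
        ((\<lambda>j. of_int j / real (Suc n)) ` ?J \<times> (\<lambda>j. of_int j / real (Suc n)) ` ?J)"
      unfolding s_def by auto
    then show "finite (s n ` space borel)" by (rule finite_subset) auto
  qed
  have to0: "(\<lambda>n. 2 / real (Suc n)) \<longlonglongrightarrow> 0"
    using tendsto_mult_right_zero[OF LIMSEQ_inverse_real_of_nat, of 2] by (simp add: divide_inverse)
  have "Cauchy (\<lambda>n. simple_spectral_integral E (s n))"
  proof (rule metric_CauchyI)
    fix e :: real assume e: "e > 0"
    define d where "d = e / (6 * E_bound * 3)"
    have d: "d > 0" using e E_bound(1) by (simp add: d_def)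
    have "\<forall>\<^sub>F n in sequentially. 2 / real (Suc n) < d" using order_tendstoD(2)[OF to0 d] .
    then obtain N where N: "\<And>n. n \<ge> N \<Longrightarrow> 2 / real (Suc n) < d" by (auto simp: eventually_sequentially)
    have "dist (simple_spectral_integral E (s m)) (simple_spectral_integral E (s n)) < e"
      if "m \<ge> N" "n \<ge> N" for m n
    proof -
      have "cmod (s m z - s n z) \<le> 2 * d" for z
        using close[of m z] close[of n z] N[OF that(1)] N[OF that(2)]
          norm_triangle_ineq4[of "s m z - f z" "s n z - f z"] by simp
      then have "norm (simple_spectral_integral E (\<lambda>z. s m z - s n z)) \<le> 6 * E_bound * (2 * d)"
        using borel_partition_comp[OF borel_partition_Pair[OF part part], of "\<lambda>(a, b). a - b" m n] d
        by (intro simple_integral_bound) auto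
      also have "\<dots> < e" using e E_bound(1) by (simp add: d_def)
      finally show ?thesis by (simp add: dist_norm simple_integral_diff[OF part part])
    qed
    then show "\<exists>N. \<forall>m\<ge>N. \<forall>n\<ge>N. dist (simple_spectral_integral E (s m)) (simple_spectral_integral E (s n)) < e" by blast
  qed
  then obtain S where S: "(\<lambda>n. simple_spectral_integral E (s n)) \<longlonglongrightarrow> S"
    using Cauchy_convergent convergent_def by blast
  moreover have "uniform_limit UNIV s f sequentially"
  proof (rule uniform_limitI)
    fix e :: real assume "e > 0"
    from order_tendstoD(2)[OF to0 this]
    show "\<forall>\<^sub>F n in sequentially. \<forall>z\<in>UNIV. dist (s n z) (f z) < e"
      by eventually_elim (use close in \<open>auto simp: dist_norm intro: le_less_trans\<close>)
  qed
  ultimately show ?thesis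
    unfolding has_spectral_integral_def simple_function_iff_borel_partition using part by blast
qed

end

section \<open>Scalar type spectral semigroups\<close>

text \<open>
  A bounded scalar type operator \<open>B\<close> with resolution of the identity \<open>E\<close>. The representation expresses
  \<open>B\<close> as a strong limit of integrals over discs, so the facts below are obtained from integrals of bounded functions.
\<close>

locale scalar_operator = spectral E
  for E :: "complex set \<Rightarrow> ('a::complex_banach \<Rightarrow>\<^sub>L 'a)" +
  fixes B :: "'a \<Rightarrow>\<^sub>L 'a"
  assumes B: "bounded_operator B = spectral_integral_id E"
begin

lemma B_approximation:
  "\<exists>S :: nat \<Rightarrow> 'a \<Rightarrow>\<^sub>L 'a.
     (\<forall>n. has_spectral_integral E (\<lambda>z. if cmod z \<le> real n then z else 0) (S n)) \<and>
     (\<forall>x. (\<lambda>n. S n x) \<longlonglongrightarrow> B x)"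
proof -
  have graph: "\<exists>S. (\<forall>n. has_spectral_integral E (\<lambda>z. if cmod z \<le> real n then z else 0) (S n))
      \<and> (\<lambda>n. S n x) \<longlonglongrightarrow> B x" for x
  proof -
    have "(x, B x) \<in> spectral_integral_id E"
      unfolding B[symmetric] by (auto simp: bounded_operator_def)
    then show ?thesis by (simp add: spectral_integral_id_def)
  qed
  obtain S :: "nat \<Rightarrow> 'a \<Rightarrow>\<^sub>L 'a" where S: "\<And>n. has_spectral_integral E (\<lambda>z. if cmod z \<le> real n then z else 0) (S n)"
    using graph[of 0] by blast
  have "(\<lambda>n. S n x) \<longlonglongrightarrow> B x" for x
  proof -
    obtain S' where S': "\<And>n. has_spectral_integral E (\<lambda>z. if cmod z \<le> real n then z else 0) (S' n)"
        "(\<lambda>n. S' n x) \<longlonglongrightarrow> B x"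
      using graph[of x] by blast
    have "S' n = S n" for n by (rule spectral_integral_unique[OF S'(1) S])
    then show ?thesis using S'(2) by simp
  qed
  with S show ?thesis by blast
qed

lemma B_restriction:
  assumes \<delta>: "\<delta> \<in> sets borel" "\<And>z. z \<in> \<delta> \<Longrightarrow> cmod z \<le> R"
  shows "has_spectral_integral E (\<lambda>z. if z \<in> \<delta> then z else 0) (B o\<^sub>L E \<delta>)"
    and "B (E \<delta> x) = E \<delta> (B x)"
proof -
  obtain S :: "nat \<Rightarrow> 'a \<Rightarrow>\<^sub>L 'a" where S: "\<And>n. has_spectral_integral E (\<lambda>z. if cmod z \<le> real n then z else 0) (S n)"
    and lim: "\<And>x. (\<lambda>n. S n x) \<longlonglongrightarrow> B x"
    using B_approximation by blast
  let ?f = "\<lambda>z. if z \<in> \<delta> then z else 0"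
  have bdd: "bounded (range (\<lambda>z::complex. if cmod z \<le> real n then z else 0))" for n
    by (rule boundedI[of _ "real n"]) auto
  have bdd1: "bounded (range (\<lambda>z. if z \<in> \<delta> then 1 else (0::complex)))"
    by (rule boundedI[of _ 1]) auto
  obtain N :: nat where N: "R \<le> N" using real_arch_simple by blast
  have integral: "has_spectral_integral E ?f (S n o\<^sub>L E \<delta>)" "has_spectral_integral E ?f (E \<delta> o\<^sub>L S n)"
    if "n \<ge> N" for n
  proof -
    have "cmod z \<le> real n" if "z \<in> \<delta>" for z
      using \<delta>(2)[OF that] N \<open>n \<ge> N\<close> of_nat_le_iff[of N n, where ?'a=real] by linarith
    then have eq: "(\<lambda>z. (if cmod z \<le> real n then z else 0) * (if z \<in> \<delta> then 1 else 0)) = ?f"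
      "(\<lambda>z. (if z \<in> \<delta> then 1 else 0) * (if cmod z \<le> real n then z else 0)) = ?f" by auto
    show "has_spectral_integral E ?f (S n o\<^sub>L E \<delta>)"
      by (rule spectral_integral_mult[OF S[of n] spectral_integral_indicator[OF \<delta>(1)] bdd[of n] bdd1, unfolded eq])
    show "has_spectral_integral E ?f (E \<delta> o\<^sub>L S n)"
      by (rule spectral_integral_mult[OF spectral_integral_indicator[OF \<delta>(1)] S[of n] bdd1 bdd[of n], unfolded eq])
  qed
  define Z where "Z = S N o\<^sub>L E \<delta>"
  have Z: "has_spectral_integral E ?f Z" unfolding Z_def by (rule integral) simp
  have SE: "S n (E \<delta> x) = Z x" "E \<delta> (S n x) = Z x" if "n \<ge> N" for n x
    using spectral_integral_unique[OF integral(1)[OF that] Z] spectral_integral_unique[OF integral(2)[OF that] Z]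
    by (metis blinfun_apply_blinfun_compose)+
  have BE: "B (E \<delta> x) = Z x" for x
  proof (rule LIMSEQ_unique[OF lim])
    show "(\<lambda>n. S n (E \<delta> x)) \<longlonglongrightarrow> Z x"
      by (rule tendsto_eventually) (use SE(1) in \<open>auto simp: eventually_sequentially\<close>)
  qed
  then have "B o\<^sub>L E \<delta> = Z" by (intro blinfun_eqI) simp
  then show "has_spectral_integral E ?f (B o\<^sub>L E \<delta>)" using Z by simp
  have "E \<delta> (B x) = Z x"
  proof (rule LIMSEQ_unique)
    show "(\<lambda>n. E \<delta> (S n x)) \<longlonglongrightarrow> E \<delta> (B x)" by (intro tendsto_intros lim)
    show "(\<lambda>n. E \<delta> (S n x)) \<longlonglongrightarrow> Z x"
      by (rule tendsto_eventually) (use SE(2) in \<open>auto simp: eventually_sequentially\<close>)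
  qed
  then show "B (E \<delta> x) = E \<delta> (B x)" using BE by simp
qed

lemma E_B_power_bound:
  assumes \<delta>: "\<delta> \<in> sets borel" "\<And>z. z \<in> \<delta> \<Longrightarrow> cmod z \<le> R" and R: "R \<ge> 0"
  shows "norm (E \<delta> ((blinfun_apply B ^^ n) x)) \<le> 6 * E_bound * R ^ n * norm (E \<delta> x)"
proof -
  have "E \<delta> ((blinfun_apply B ^^ n) x) = (blinfun_apply (B o\<^sub>L E \<delta>) ^^ n) (E \<delta> x)"
  proof (induction n)
    case (Suc n)
    then show ?case
      using B_restriction(2)[OF \<delta>, of "(blinfun_apply B ^^ n) x"] E_idem[OF \<delta>(1), of "(blinfun_apply B ^^ n) x"]
      by simp
  qed simp
  then show ?thesis
    using spectral_integral_power_bound[OF B_restriction(1)[OF \<delta>], of R n "E \<delta> x"] \<delta>(2) R by simp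
qed

lemma partial_inverse:
  assumes \<rho>: "\<rho> > 0"
  shows "\<exists>C.
    (\<forall>x. B (blinfun_apply C x) = E {z. \<rho> \<le> cmod z} x) \<and>
    (\<forall>x. blinfun_apply C (B x) = E {z. \<rho> \<le> cmod z} x) \<and>
    (\<forall>x. E {z. \<rho> \<le> cmod z} (blinfun_apply C x) = blinfun_apply C x) \<and>
    (\<forall>n x. norm ((blinfun_apply C ^^ n) x) \<le> 6 * E_bound * inverse \<rho> ^ n * norm x)"
proof -
  let ?D = "{z. \<rho> \<le> cmod z}"
  define Q where "Q = E ?D"
  have closed: "closed {z. \<rho> \<le> cmod z}" by (intro closed_Collect_le continuous_intros)
  then have D: "?D \<in> sets borel" by simp
  define f :: "complex \<Rightarrow> complex" where "f = (\<lambda>z. if z \<in> ?D then inverse z else 0)"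
  have f_bound: "cmod (f z) \<le> inverse \<rho>" for z
    using \<rho> by (auto simp: f_def norm_inverse intro!: le_imp_inverse_le)
  have "f \<in> borel_measurable borel"
  proof -
    have "continuous_on ?D f"
      by (rule continuous_on_eq[of _ inverse]) (use \<rho> in \<open>auto simp: f_def intro!: continuous_intros\<close>)
    then have "(\<lambda>z. indicator ?D z *\<^sub>R f z) \<in> borel_measurable borel"
      by (rule borel_measurable_continuous_on_indicator[OF D])
    moreover have "(\<lambda>z. indicator ?D z *\<^sub>R f z) = f" by (auto simp: f_def indicator_def)
    ultimately show ?thesis by simp
  qed
  from spectral_integral_exists[OF this f_bound] obtain C where C: "has_spectral_integral E f C" by blast
  obtain S :: "nat \<Rightarrow> 'a \<Rightarrow>\<^sub>L 'a" where S: "\<And>n. has_spectral_integral E (\<lambda>z. if cmod z \<le> real n then z else 0) (S n)"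
    and lim: "\<And>x. (\<lambda>n. S n x) \<longlonglongrightarrow> B x"
    using B_approximation by blast
  have bdd: "bounded (range (\<lambda>z::complex. if cmod z \<le> real n then z else 0))" for n
    by (rule boundedI[of _ "real n"]) auto
  have bddf: "bounded (range f)" by (rule boundedI[of _ "inverse \<rho>"]) (use f_bound in auto)
  have bdd1: "bounded (range (\<lambda>z. if z \<in> ?D then 1 else (0::complex)))"
    by (rule boundedI[of _ 1]) auto
  define An where "An n = {z. \<rho> \<le> cmod z \<and> cmod z \<le> real n}" for n
  have "closed (An n)" for n unfolding An_def by (intro closed_Collect_conj closed_Collect_le continuous_intros)
  then have An: "An n \<in> sets borel" for n by simp
  have nonzero: "z \<noteq> 0" if "\<rho> \<le> cmod z" for z using that \<rho> by auto
  have prod: "(\<lambda>z. (if cmod z \<le> real n then z else 0) * f z) = (\<lambda>z. if z \<in> An n then 1 else 0)"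
    "(\<lambda>z. f z * (if cmod z \<le> real n then z else 0)) = (\<lambda>z. if z \<in> An n then 1 else 0)" for n
    using nonzero by (auto simp: f_def An_def fun_eq_iff)
  have SC: "S n o\<^sub>L C = E (An n)" and CS: "C o\<^sub>L S n = E (An n)" for n
    using spectral_integral_unique[OF _ spectral_integral_indicator[OF An]]
      spectral_integral_mult[OF S C bdd bddf, of n, unfolded prod] spectral_integral_mult[OF C S bddf bdd, of n, unfolded prod]
    by blast+
  have En: "(\<lambda>n. E (An n) x) \<longlonglongrightarrow> Q x" for x
  proof -
    have "(\<lambda>n. E (An n) x) \<longlonglongrightarrow> E (\<Union>n. An n) x"
      by (rule E_incseq[OF An]) (auto simp: incseq_def An_def)
    moreover have "(\<Union>n. An n) = ?D" using real_arch_simple by (auto simp: An_def)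
    ultimately show ?thesis by (simp add: Q_def)
  qed
  show ?thesis
    unfolding Q_def[symmetric]
  proof (intro exI[of _ C] conjI allI)
    show "B (C x) = Q x" for x
    proof (rule LIMSEQ_unique[OF lim])
      show "(\<lambda>n. S n (C x)) \<longlonglongrightarrow> Q x"
        using En[of x] by (simp flip: SC)
    qed
    show "C (B x) = Q x" for x
    proof (rule LIMSEQ_unique)
      show "(\<lambda>n. C (S n x)) \<longlonglongrightarrow> C (B x)" by (intro tendsto_intros lim)
      show "(\<lambda>n. C (S n x)) \<longlonglongrightarrow> Q x" using En[of x] by (simp flip: CS)
    qed
    have "(\<lambda>z. (if z \<in> ?D then 1 else 0) * f z) = f" by (auto simp: f_def)
    then have "has_spectral_integral E f (Q o\<^sub>L C)"
      using spectral_integral_mult[OF spectral_integral_indicator[OF D] C bdd1 bddf] by (simp add: Q_def)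
    then have "Q o\<^sub>L C = C" by (rule spectral_integral_unique[OF _ C])
    then show "Q (C x) = C x" for x by (metis blinfun_apply_blinfun_compose)
    show "norm ((blinfun_apply C ^^ n) x) \<le> 6 * E_bound * inverse \<rho> ^ n * norm x" for n x
      by (rule spectral_integral_power_bound[OF C f_bound]) (use \<rho> in simp)
  qed
qed

text \<open>
  A vector \<open>y\<close> in the range of \<open>E {z. \<rho> \<le> \<bar>z\<bar>}\<close> has preimages \<open>C\<^sup>n y\<close> under \<open>B\<^sup>n\<close> of size \<open>O (\<rho>\<^sup>-\<^sup>n)\<close>, and
  then so has \<open>D y\<close>. A vector with such preimages has no component in a smaller disc \<open>\<bar>z\<bar> \<le> r < \<rho>\<close>, since there
  \<open>B\<^sup>n\<close> is \<open>O (r\<^sup>n)\<close>; by \<open>\<sigma>\<close>-additivity it has none in \<open>\<bar>z\<bar> < \<rho>\<close>.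
\<close>

lemma invariant_outer_range:
  fixes D :: "'a \<Rightarrow>\<^sub>L 'a"
  assumes \<rho>: "\<rho> > 0" and comm: "\<And>x. D (B x) = B (D x)" and y: "E {z. \<rho> \<le> cmod z} y = y"
  shows "E {z. \<rho> \<le> cmod z} (D y) = D y"
proof -
  let ?Q = "E {z. \<rho> \<le> cmod z}"
  obtain C :: "'a \<Rightarrow>\<^sub>L 'a" where BC: "\<And>x. B (C x) = ?Q x" and "\<And>x. C (B x) = ?Q x"
    and QC: "\<And>x. ?Q (C x) = C x"
    and Cn: "\<And>n x. norm ((blinfun_apply C ^^ n) x) \<le> 6 * E_bound * inverse \<rho> ^ n * norm x"
    using partial_inverse[OF \<rho>] by blast
  have range_Cn: "?Q ((blinfun_apply C ^^ n) y) = (blinfun_apply C ^^ n) y" for n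
    by (induction n) (simp_all add: y QC)
  have BnCn: "(blinfun_apply B ^^ n) ((blinfun_apply C ^^ n) y) = y" for n
  proof (induction n)
    case (Suc n)
    have "(blinfun_apply B ^^ Suc n) ((blinfun_apply C ^^ Suc n) y)
        = (blinfun_apply B ^^ n) (B (C ((blinfun_apply C ^^ n) y)))" by (simp add: funpow_swap1)
    then show ?case using Suc by (simp add: BC range_Cn)
  qed simp
  have DBn: "D ((blinfun_apply B ^^ n) x) = (blinfun_apply B ^^ n) (D x)" for n x
    by (induction n) (simp_all add: comm)
  have inner: "E {z. cmod z \<le> r} (D y) = 0" if r: "0 \<le> r" "r < \<rho>" for r
  proof -
    let ?P = "E {z. cmod z \<le> r}"
    have "closed {z. cmod z \<le> r}" by (intro closed_Collect_le continuous_intros)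
    then have meas: "{z. cmod z \<le> r} \<in> sets borel" by simp
    define K where "K = 6 * E_bound * E_bound * norm D * (6 * E_bound) * norm y"
    have bound: "norm (?P (D y)) \<le> K * (r / \<rho>) ^ n" for n
    proof -
      define u where "u = D ((blinfun_apply C ^^ n) y)"
      have "D y = (blinfun_apply B ^^ n) u" unfolding u_def DBn[symmetric] BnCn ..
      then have "norm (?P (D y)) \<le> 6 * E_bound * r ^ n * norm (?P u)"
        using E_B_power_bound[OF meas _ r(1), of n u] by simp
      also have "norm (?P u) \<le> E_bound * norm u"
        by (rule order_trans[OF norm_blinfun mult_right_mono[OF E_bound(2)[OF meas]]]) simp
      also have "norm u \<le> norm D * (6 * E_bound * inverse \<rho> ^ n * norm y)"
        unfolding u_def by (rule order_trans[OF norm_blinfun mult_left_mono[OF Cn]]) simp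
      finally have "norm (?P (D y)) \<le> 6 * E_bound * r ^ n * (E_bound * (norm D * (6 * E_bound * inverse \<rho> ^ n * norm y)))"
        using r E_bound(1) by (simp add: mult_left_mono)
      also have "\<dots> = K * (r / \<rho>) ^ n"
        by (simp add: K_def divide_inverse power_mult_distrib)
      finally show ?thesis .
    qed
    have "(\<lambda>n. K * (r / \<rho>) ^ n) \<longlonglongrightarrow> K * 0"
      by (intro tendsto_intros LIMSEQ_power_zero) (use r \<rho> in simp)
    then have "norm (?P (D y)) \<le> K * 0"
      by (rule tendsto_lowerbound) (use bound in auto)
    then show ?thesis by simp
  qed
  define d where "d n = {z. cmod z \<le> \<rho> * (1 - inverse (real (Suc n)))}" for n
  have "closed (d n)" for n unfolding d_def by (intro closed_Collect_le continuous_intros)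
  then have d: "d n \<in> sets borel" for n by simp
  have "incseq d"
    unfolding incseq_def
  proof (intro allI impI)
    fix m n :: nat assume "m \<le> n"
    then have "\<rho> * (1 - inverse (real (Suc m))) \<le> \<rho> * (1 - inverse (real (Suc n)))"
      using \<rho> by (intro mult_left_mono diff_left_mono le_imp_inverse_le) auto
    then show "d m \<subseteq> d n" unfolding d_def by force
  qed
  from E_incseq[OF d this] have "(\<lambda>n. E (d n) (D y)) \<longlonglongrightarrow> E (\<Union>n. d n) (D y)" .
  moreover have "E (d n) (D y) = 0" for n
    unfolding d_def by (rule inner) (use \<rho> in \<open>auto simp: field_simps\<close>)
  ultimately have 0: "E (\<Union>n. d n) (D y) = 0" using LIMSEQ_unique[OF _ tendsto_const] by auto
  have "(\<Union>n. d n) = {z. cmod z < \<rho>}"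
  proof (intro equalityI subsetI)
    fix z assume "z \<in> {z. cmod z < \<rho>}"
    then have "1 - cmod z / \<rho> > 0" using \<rho> by simp
    then obtain n where "inverse (real (Suc n)) < 1 - cmod z / \<rho>" using reals_Archimedean by blast
    then have "cmod z / \<rho> \<le> 1 - inverse (real (Suc n))" by simp
    then have "cmod z \<le> \<rho> * (1 - inverse (real (Suc n)))" using \<rho> by (simp only: pos_divide_le_eq mult.commute)
    then show "z \<in> (\<Union>n. d n)" unfolding d_def by blast
  next
    fix z assume "z \<in> (\<Union>n. d n)"
    then obtain n where "cmod z \<le> \<rho> * (1 - inverse (real (Suc n)))" by (auto simp: d_def)
    also have "\<dots> < \<rho> * 1" by (rule mult_strict_left_mono) (use \<rho> in auto)
    finally show "z \<in> {z. cmod z < \<rho>}" by simp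
  qed
  moreover have "{z. \<rho> \<le> cmod z} = UNIV - {z. cmod z < \<rho>}" by auto
  moreover have "{z. cmod z < \<rho>} \<in> sets borel" by (intro borel_open open_Collect_less continuous_intros)
  ultimately have "?Q = id_blinfun - E {z. cmod z < \<rho>}" using E_Diff[of "{z. cmod z < \<rho>}" UNIV] by simp
  then show ?thesis using 0 \<open>(\<Union>n. d n) = _\<close> by (simp add: blinfun.diff_left)
qed

end

context c0_semigroup begin

lemma generator_invariant:
  assumes u: "(x, y) \<in> generator T" and t: "t \<ge> 0" shows "(T t x, T t y) \<in> generator T"
proof -
  have "((\<lambda>h. T t ((T h x - x) /\<^sub>R h)) \<longlongrightarrow> T t y) (at_right 0)"
    by (intro tendsto_intros generatorD[OF u])
  moreover have "\<forall>\<^sub>F h in at_right 0. T t ((T h x - x) /\<^sub>R h) = (T h (T t x) - T t x) /\<^sub>R h"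
    using eventually_at_right_less[of 0]
    by eventually_elim (use t in \<open>simp add: blinfun.scaleR_right blinfun.diff_right T_commute\<close>)
  ultimately show ?thesis unfolding generator_def by (auto elim: Lim_transform_eventually)
qed

lemma resolvent_commutes:
  assumes D: "is_resolvent (generator T) l D" and t: "t \<ge> 0"
  shows "D (T t y) = T t (D y)"
proof -
  have "(T t (D y), T t (y + l *\<^sub>C D y)) \<in> generator T"
    by (rule generator_invariant[OF is_resolventD(2)[OF D] t])
  from is_resolventD(3)[OF D this] show ?thesis
    using t by (simp add: blinfun.add_right T_scaleC)
qed

text \<open>
  With \<open>Y\<close> the range of \<open>E {z. \<rho> \<le> \<bar>z\<bar>}\<close> and \<open>D = R(0, A)\<close>, the estimates in both half-planes give
  \<open>\<parallel>y\<parallel> \<le> (1 + \<bar>l\<bar> C) \<parallel>y - l D y\<parallel>\<close> for \<open>y\<close> in \<open>Y\<close> and every complex \<open>l\<close>. By \<open>power_bound\<close>,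
  \<open>r\<^sup>2 \<parallel>D\<^sup>2 y\<parallel> \<le> (1 + r C) \<parallel>y\<parallel>\<close> for all \<open>r > 0\<close>, so \<open>D\<^sup>2 y = 0\<close> and \<open>y = 0\<close>.
\<close>

lemma scalar_type_stable:
  assumes scalar: "scalar_type_spectral (bounded_operator (T 1))"
    and sub: "{l. Re l \<ge> 0} \<subseteq> resolvent_set (generator T)"
    and bdd: "bdd_above {norm (resolvent l (generator T)) | l. Re l \<ge> 0}"
  shows "uniformly_exponentially_stable T"
proof -
  obtain E where E: "spectral_measure E" "bounded_operator (T 1) = spectral_integral_id E"
    using scalar unfolding scalar_type_spectral_def by blast
  interpret scalar_operator E "T 1" by unfold_locales (use E in auto)
  obtain \<epsilon> C0 where \<epsilon>: "\<epsilon> > 0" and C0: "C0 > 0"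
    and right: "\<And>l x y. Re l \<ge> - \<epsilon> \<Longrightarrow> (x, y) \<in> generator T \<Longrightarrow> norm x \<le> C0 * norm (y - l *\<^sub>C x)"
    using bounded_resolvent_estimate[OF sub bdd] by blast
  have "0 \<in> resolvent_set (generator T)" using sub by auto
  then obtain D where D: "is_resolvent (generator T) 0 D" by (auto simp: resolvent_set_def)
  have D_gen: "(D y, y) \<in> generator T" for y using is_resolventD(2)[OF D, of y] by (simp add: scaleC.zero_left)
  have D_comm: "D (T t y) = T t (D y)" if "t \<ge> 0" for t y by (rule resolvent_commutes[OF D that])
  \<comment> \<open>Any \<open>\<rho>\<close> strictly between \<open>exp (- \<epsilon>)\<close> and \<open>1\<close> would do.\<close>
  define \<rho> where "\<rho> = exp (- \<epsilon> / 2)"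
  have \<rho>: "\<rho> > 0" "\<rho> < 1" using \<epsilon> by (auto simp: \<rho>_def)
  define Q where "Q = E {z. \<rho> \<le> cmod z}"
  have inner: "{z. cmod z < \<rho>} \<in> sets borel" by (intro borel_open open_Collect_less continuous_intros)
  have "closed {z. \<rho> \<le> cmod z}" by (intro closed_Collect_le continuous_intros)
  then have outer: "{z. \<rho> \<le> cmod z} \<in> sets borel" by simp
  obtain C :: "'a \<Rightarrow>\<^sub>L 'a" where BC: "\<And>x. T 1 (C x) = Q x" and CB: "\<And>x. C (T 1 x) = Q x"
    and QC: "\<And>x. Q (C x) = C x"
    and Cn: "\<And>n x. norm ((blinfun_apply C ^^ n) x) \<le> 6 * E_bound * inverse \<rho> ^ n * norm x"
    using partial_inverse[OF \<rho>(1), folded Q_def] by blast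
  define Y where "Y = {y. Q y = y}"
  have Y: "complex_subspace Y"
    unfolding complex_subspace_def Y_def Q_def
    by (simp add: blinfun.add_right complex_linearD[OF E_linear[OF outer]])
  have inv: "D y \<in> Y" if "y \<in> Y" for y
    using invariant_outer_range[OF \<rho>(1), of D y] D_comm[of 1] that by (simp add: Y_def Q_def)
  have C_in: "(blinfun_apply C ^^ n) y \<in> Y" if "y \<in> Y" for n y
    using that by (induction n) (auto simp: Y_def QC)
  have DC: "D (C y) = C (D y)" if y: "y \<in> Y" for y
  proof -
    have "D (C y) \<in> Y" by (rule inv) (simp add: Y_def QC)
    then have "D (C y) = C (T 1 (D (C y)))" by (simp add: CB Y_def)
    also have "T 1 (D (C y)) = D y" using D_comm[of 1 "C y"] y by (simp add: BC Y_def)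
    finally show ?thesis .
  qed
  have DCn: "D ((blinfun_apply C ^^ n) y) = (blinfun_apply C ^^ n) (D y)" if y: "y \<in> Y" for n y
    by (induction n) (use C_in[OF y] DC in auto)
  have TCn: "T (real n) ((blinfun_apply C ^^ n) y) = y" if y: "y \<in> Y" for n y
  proof (induction n)
    case (Suc n)
    have "T (real n + 1) (C ((blinfun_apply C ^^ n) y)) = T (real n) (Q ((blinfun_apply C ^^ n) y))"
      by (simp add: T_add BC)
    then show ?case using Suc C_in[OF y, of n] by (simp add: Y_def add.commute)
  qed simp
  have C_linear: "(blinfun_apply C ^^ n) (y - l *\<^sub>C D y) = (blinfun_apply C ^^ n) y - l *\<^sub>C (blinfun_apply C ^^ n) (D y)"
    if y: "y \<in> Y" for n l y
  proof -
    have scale: "C (l *\<^sub>C w) = l *\<^sub>C C w" if w: "w \<in> Y" for w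
    proof -
      have "l *\<^sub>C C w \<in> Y" "l *\<^sub>C w \<in> Y" using Y w QC by (auto simp: complex_subspace_def Y_def)
      then have "l *\<^sub>C C w = C (T 1 (l *\<^sub>C C w))" by (simp add: CB Y_def)
      also have "T 1 (l *\<^sub>C C w) = l *\<^sub>C w" using w by (simp add: T_scaleC BC Y_def)
      finally show ?thesis by simp
    qed
    show ?thesis
      by (induction n) (use scale[OF C_in[OF inv[OF y]]] in \<open>simp_all add: blinfun.diff_right\<close>)
  qed
  \<comment> \<open>\<open>N\<close> is taken so large that \<open>exp (l N) C\<^sup>N\<close> has norm at most \<open>1/2\<close> whenever \<open>Re l \<le> - \<epsilon>\<close>.\<close>
  have "(\<lambda>n. 6 * E_bound * exp (- \<epsilon> / 2) ^ n) \<longlonglongrightarrow> 6 * E_bound * 0"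
    by (intro tendsto_intros LIMSEQ_power_zero) (use \<epsilon> in simp)
  then have "\<forall>\<^sub>F n in sequentially. 6 * E_bound * exp (- \<epsilon> / 2) ^ n < 1/2"
    by (intro order_tendstoD(2)[of _ 0]) auto
  then obtain N where N: "6 * E_bound * exp (- \<epsilon> / 2) ^ N < 1/2" by (auto simp: eventually_sequentially)
  obtain M where M: "M \<ge> 1" and bound: "\<forall>t. 0 \<le> t \<longrightarrow> t \<le> real N \<longrightarrow> norm (T t) \<le> M"
    using locally_bounded[of "real N"] by blast
  define C1 where "C1 = 2 * (real N * M * (6 * E_bound * inverse \<rho> ^ N))"
  have left: "norm (D y) \<le> C1 * norm (y - l *\<^sub>C D y)" if l: "Re l \<le> - \<epsilon>" and y: "y \<in> Y" for l y
  proof -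
    let ?v = "y - l *\<^sub>C D y"
    let ?y = "(blinfun_apply C ^^ N) y"
    have "norm (T (real N) (D ?y) - exp (l * of_real (real N)) *\<^sub>C D ?y)
        \<le> real N * 1 * M * norm (?y - l *\<^sub>C D ?y)"
      by (rule exp_growth_estimate[OF D_gen])
        (use bound l \<epsilon> in \<open>auto intro: mult_nonpos_nonneg\<close>)
    moreover have "T (real N) (D ?y) = D y" using D_comm[of "real N" ?y] TCn[OF y] by simp
    moreover have "?y - l *\<^sub>C D ?y = (blinfun_apply C ^^ N) ?v" using C_linear[OF y] DCn[OF y] by simp
    ultimately have "norm (D y - exp (l * of_real (real N)) *\<^sub>C (blinfun_apply C ^^ N) (D y))
        \<le> real N * M * norm ((blinfun_apply C ^^ N) ?v)" using DCn[OF y] by simp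
    also have "\<dots> \<le> real N * M * (6 * E_bound * inverse \<rho> ^ N * norm ?v)"
      by (rule mult_left_mono[OF Cn]) (use M in simp)
    finally have 1: "norm (D y - exp (l * of_real (real N)) *\<^sub>C (blinfun_apply C ^^ N) (D y)) \<le> C1 / 2 * norm ?v"
      by (simp add: C1_def ac_simps)
    have "norm (exp (l * of_real (real N)) *\<^sub>C (blinfun_apply C ^^ N) (D y))
        \<le> exp (- \<epsilon> * real N) * (6 * E_bound * inverse \<rho> ^ N * norm (D y))"
      unfolding norm_scaleC by (intro mult_mono Cn) (use mult_right_mono[OF l, of "real N"] in auto)
    also have "\<dots> = 6 * E_bound * exp (- \<epsilon> / 2) ^ N * norm (D y)"
    proof -
      have "exp (- \<epsilon> * real N) = exp (- \<epsilon> / 2) ^ N * exp (- \<epsilon> / 2) ^ N"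
        by (simp add: exp_of_nat_mult[symmetric] flip: exp_add)
      then show ?thesis using \<rho>(1) by (simp add: \<rho>_def power_inverse)
    qed
    also have "\<dots> \<le> 1 / 2 * norm (D y)" by (rule mult_right_mono) (use N in auto)
    finally have 2: "norm (exp (l * of_real (real N)) *\<^sub>C (blinfun_apply C ^^ N) (D y)) \<le> 1 / 2 * norm (D y)" .
    show ?thesis
      using 1 2 norm_triangle_sub[of "D y" "exp (l * of_real (real N)) *\<^sub>C (blinfun_apply C ^^ N) (D y)"] by linarith
  qed
  define C2 where "C2 = max C0 C1"
  have C2: "C2 > 0" using C0 by (simp add: C2_def)
  have all: "norm (D y) \<le> C2 * norm (y - l *\<^sub>C D y)" if y: "y \<in> Y" for l y
  proof (cases "Re l \<ge> - \<epsilon>")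
    case True
    show ?thesis by (rule order_trans[OF right[OF True D_gen] mult_right_mono]) (auto simp: C2_def)
  next
    case False
    show ?thesis by (rule order_trans[OF left[OF _ y] mult_right_mono]) (use False in \<open>auto simp: C2_def\<close>)
  qed
  have Y_trivial: "y = 0" if y: "y \<in> Y" for y
  proof -
    have square: "r\<^sup>2 * norm (D (D y)) \<le> (1 + r * C2) * norm y" if r: "r > 0" for r
    proof -
      interpret a_priori_estimate D Y r "1 + r * C2"
      proof
        show "norm u \<le> (1 + r * C2) * norm (u - w *\<^sub>C D u)" if "cmod w \<le> r" "u \<in> Y" for w u
        proof -
          have "norm (w *\<^sub>C D u) \<le> r * (C2 * norm (u - w *\<^sub>C D u))"
            unfolding norm_scaleC by (intro mult_mono that all) (use r in auto)
          then show ?thesis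
            using norm_triangle_sub[of u "w *\<^sub>C D u"] by (simp add: algebra_simps)
        qed
      qed (use Y inv r C2 is_resolventD(1)[OF D] in auto)
      show ?thesis using power_bound[OF r y, of 2] by (simp add: numeral_2_eq_2)
    qed
    have "norm (D (D y)) = 0"
    proof (rule ccontr)
      assume "norm (D (D y)) \<noteq> 0"
      then have a: "norm (D (D y)) > 0" by simp
      define r where "r = (1 + C2) * norm y / norm (D (D y)) + 1"
      have r: "r \<ge> 1" using C2 by (simp add: r_def)
      have "r * (r * norm (D (D y))) \<le> (1 + r * C2) * norm y"
        using square[of r] r by (simp add: power2_eq_square mult.assoc)
      also have "\<dots> \<le> r * ((1 + C2) * norm y)"
        using mult_right_mono[OF r, of "norm y"] by (simp add: algebra_simps)
      finally have "r * norm (D (D y)) \<le> (1 + C2) * norm y" using r by simp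
      moreover have "r * norm (D (D y)) = (1 + C2) * norm y + norm (D (D y))"
        using a by (simp add: r_def field_simps)
      ultimately show False using a by simp
    qed
    then have "D (D y) = 0" by simp
    moreover have "z = 0" if "D z = 0" for z
      using D_gen[of z] that linear_operatorD(1,2)[OF generator_linear] by metis
    ultimately show ?thesis by blast
  qed
  have "Q x = 0" for x
    by (rule Y_trivial) (simp add: Y_def Q_def E_idem[OF outer])
  moreover have "Q = id_blinfun - E {z. cmod z < \<rho>}"
  proof -
    have "{z. \<rho> \<le> cmod z} = UNIV - {z. cmod z < \<rho>}" by auto
    then show ?thesis using E_Diff[OF inner, of UNIV] by (simp add: Q_def)
  qed
  ultimately have id: "E {z. cmod z < \<rho>} x = x" for x by (simp add: blinfun.diff_left)
  have "norm (T (real n)) \<le> 6 * E_bound * \<rho> ^ n" for n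
  proof (rule norm_blinfun_bound)
    show "norm (T (real n) x) \<le> 6 * E_bound * \<rho> ^ n * norm x" for x
      using E_B_power_bound[OF inner, of \<rho> n x] \<rho> T_power[of 1 n x] by (simp add: id)
  qed (use E_bound(1) \<rho> in simp)
  then show ?thesis using \<rho> by (intro stable_if_discrete_decay[of \<rho> "6 * E_bound"]) auto
qed

end


section \<open>Classes of eventually norm-continuous semigroups\<close>

lemma norm_blinfun_le_if_unit_ball:
  fixes F :: "'a::real_normed_vector \<Rightarrow>\<^sub>L 'b::real_normed_vector"
  assumes "\<And>x. norm x \<le> 1 \<Longrightarrow> norm (F x) \<le> b" shows "norm F \<le> b"
proof (rule norm_blinfun_bound)
  show "0 \<le> b" using assms[of 0] by simp
  show "norm (F x) \<le> b * norm x" for x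
  proof (cases "x = 0")
    case False
    then have "norm (F (x /\<^sub>R norm x)) \<le> b" by (intro assms) simp
    then show ?thesis using False by (simp add: blinfun.scaleR_right field_simps)
  qed simp
qed

lemma uniformly_continuous_imp_eventually_norm_continuous:
  "uniformly_continuous_semigroup T \<Longrightarrow> eventually_norm_continuous T"
  unfolding uniformly_continuous_semigroup_def eventually_norm_continuous_def
  by (intro exI[of _ 1]) (auto elim: continuous_on_subset)

lemma analytic_imp_eventually_norm_continuous:
  assumes "analytic_semigroup T" shows "eventually_norm_continuous T"
proof -
  obtain \<delta> S where \<delta>: "0 < \<delta>" and S: "\<And>t. t \<ge> 0 \<Longrightarrow> S (complex_of_real t) = T t"
    and der: "\<And>z. z \<in> sector \<delta> \<Longrightarrow> \<exists>D. (S has_derivative (\<lambda>h. scalar_op h o\<^sub>L D)) (at z)"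
    using assms unfolding analytic_semigroup_def by metis
  have "isCont S (complex_of_real t)" if "t \<ge> 1" for t
  proof -
    have "complex_of_real t \<in> sector \<delta>" using that \<delta> by (simp add: sector_def Arg_of_real)
    then show ?thesis using der has_derivative_continuous by blast
  qed
  then have "continuous_on (complex_of_real ` {1..}) S"
    by (intro continuous_at_imp_continuous_on) auto
  then have "continuous_on {1..} (S \<circ> complex_of_real)"
    by (intro continuous_on_compose continuous_intros)
  then have "continuous_on {1..} T"
    by (rule continuous_on_eq) (simp add: S)
  then show ?thesis unfolding eventually_norm_continuous_def by (intro exI[of _ 1]) simp
qed

context c0_semigroup begin

text \<open>
  Strong continuity is uniform on compact sets, and \<open>T(t\<^sub>0)\<close> maps the unit ball into one.
\<close>

lemma eventually_compact_imp_eventually_norm_continuous: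
  assumes "eventually_compact T" shows "eventually_norm_continuous T"
proof -
  obtain t0 where t0: "t0 > 0" and comp: "compact (closure (T t0 ` cball 0 1))"
    using assms unfolding eventually_compact_def by blast
  let ?K = "closure (T t0 ` cball 0 1)"
  have "continuous_on {t0..} T"
    unfolding continuous_on_iff
  proof (intro ballI allI impI)
    fix t e :: real assume t: "t \<in> {t0..}" and e: "e > 0"
    let ?P = "{0..t - t0 + 1} \<times> ?K"
    have "uniformly_continuous_on ?P (\<lambda>p. T (fst p) (snd p))"
      by (intro compact_uniformly_continuous compact_Times comp continuous_on_subset[OF jointly_continuous]) auto
    then obtain d where d: "d > 0" "\<And>p q. p \<in> ?P \<Longrightarrow> q \<in> ?P \<Longrightarrow> dist q p < d
        \<Longrightarrow> dist (T (fst q) (snd q)) (T (fst p) (snd p)) < e / 2"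
      unfolding uniformly_continuous_on_def using half_gt_zero[OF e] by meson
    have "dist (T s) (T t) < e" if s: "s \<in> {t0..}" "dist s t < min d 1" for s
    proof -
      have "norm (T s - T t) \<le> e / 2"
      proof (rule norm_blinfun_le_if_unit_ball)
        fix x :: 'a assume "norm x \<le> 1"
        then have "T t0 x \<in> ?K" by (intro subsetD[OF closure_subset]) auto
        then have "dist (T (s - t0) (T t0 x)) (T (t - t0) (T t0 x)) < e / 2"
          using d(2)[of "(t - t0, T t0 x)" "(s - t0, T t0 x)"] s t
          by (auto simp: dist_Pair_Pair dist_real_def)
        then show "norm ((T s - T t) x) \<le> e / 2"
          using T_add[of "s - t0" t0 x] T_add[of "t - t0" t0 x] s t t0
          by (simp add: dist_norm blinfun.diff_left)
      qed
      then show ?thesis using e by (simp add: dist_norm)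
    qed
    then show "\<exists>d>0. \<forall>s\<in>{t0..}. dist s t < d \<longrightarrow> dist (T s) (T t) < e"
      using d(1) by (intro exI[of _ "min d 1"]) auto
  qed
  then show ?thesis using t0 unfolding eventually_norm_continuous_def by blast
qed

text \<open>
  The difference quotients of \<open>T\<close> at a point \<open>t\<^sub>1\<close> are pointwise bounded, hence bounded in norm by the
  uniform boundedness principle; the semigroup law moves the resulting Lipschitz estimate to later times.
\<close>

lemma eventually_differentiable_imp_eventually_norm_continuous:
  assumes "eventually_differentiable T" shows "eventually_norm_continuous T"
proof -
  obtain t0 where t0: "t0 \<ge> 0" and diff: "\<And>x t. t > t0 \<Longrightarrow> (\<lambda>s. T s x) differentiable (at t)"
    using assms unfolding eventually_differentiable_def by blast
  define t1 where "t1 = t0 + 1"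
  have t1: "t1 > 0" using t0 by (simp add: t1_def)
  obtain M1 where M1: "M1 \<ge> 1" and bound1: "\<forall>t. 0 \<le> t \<longrightarrow> t \<le> t1 + 1 \<longrightarrow> norm (T t) \<le> M1"
    using locally_bounded[of "t1 + 1"] by blast
  have "\<exists>K. \<forall>h\<in>{0<..1}. norm (((T (t1 + h) - T t1) /\<^sub>R h) x) \<le> K" for x
  proof -
    obtain D where "((\<lambda>s. T s x) has_vector_derivative D) (at t1)"
      using diff[of t1 x] by (auto simp: t1_def vector_derivative_works)
    then obtain d where d: "d > 0"
      "\<And>y. norm (y - t1) < d \<Longrightarrow> norm (T y x - T t1 x - (y - t1) *\<^sub>R D) \<le> 1 * norm (y - t1)"
      unfolding has_vector_derivative_def has_derivative_at_alt using zero_less_one by metis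
    have "norm (((T (t1 + h) - T t1) /\<^sub>R h) x) \<le> max (1 + norm D) ((M1 * norm x + M1 * norm x) / d)"
      if h: "h \<in> {0<..1}" for h
    proof (cases "h < d")
      case True
      have "norm (T (t1 + h) x - T t1 x) \<le> norm (T (t1 + h) x - T t1 x - h *\<^sub>R D) + norm (h *\<^sub>R D)"
        by (metis diff_add_cancel norm_triangle_ineq)
      also have "\<dots> \<le> h + h * norm D" using d(2)[of "t1 + h"] h True by simp
      finally have "norm (T (t1 + h) x - T t1 x) / h \<le> 1 + norm D" using h by (simp add: field_simps)
      then show ?thesis using h
        by (simp add: blinfun.scaleR_left blinfun.diff_left divide_inverse mult.commute le_max_iff_disj)
    next
      case False
      have "norm (T (t1 + h) x - T t1 x) \<le> norm (T (t1 + h) x) + norm (T t1 x)" by (rule norm_triangle_ineq4)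
      also have "\<dots> \<le> M1 * norm x + M1 * norm x"
        by (intro add_mono order_trans[OF norm_blinfun mult_right_mono[OF bound1[rule_format]]]) (use h t1 in auto)
      finally have "norm (T (t1 + h) x - T t1 x) / h \<le> (M1 * norm x + M1 * norm x) / d"
        using False d(1) M1 by (intro frac_le) auto
      then show ?thesis using h
        by (simp add: blinfun.scaleR_left blinfun.diff_left divide_inverse mult.commute le_max_iff_disj)
    qed
    then show ?thesis by blast
  qed
  from uniform_boundedness_principle[of "{0<..1}" "\<lambda>h. (T (t1 + h) - T t1) /\<^sub>R h", OF this]
  obtain L where L: "\<And>h. h \<in> {0<..1} \<Longrightarrow> norm ((T (t1 + h) - T t1) /\<^sub>R h) \<le> L" by blast
  have lip: "norm (T s - T t) \<le> M * (\<bar>L\<bar> * (s - t))"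
    if "t1 \<le> t" "t < s" "s \<le> t + 1" and M: "norm (T (t - t1)) \<le> M" for s t M
  proof -
    have "T s - T t = T (t - t1) o\<^sub>L (T (t1 + (s - t)) - T t1)"
      by (rule blinfun_eqI)
        (use that t1 T_add[of "t - t1" "t1 + (s - t)"] T_add[of "t - t1" t1] in
          \<open>simp add: blinfun.diff_left blinfun.diff_right\<close>)
    then have "norm (T s - T t) \<le> norm (T (t - t1)) * norm (T (t1 + (s - t)) - T t1)"
      by (simp add: norm_blinfun_compose)
    also have "norm (T (t1 + (s - t)) - T t1) \<le> \<bar>L\<bar> * (s - t)"
    proof -
      have "norm (T (t1 + (s - t)) - T t1) = (s - t) * norm ((T (t1 + (s - t)) - T t1) /\<^sub>R (s - t))"
        using that by simp
      also have "\<dots> \<le> (s - t) * \<bar>L\<bar>"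
        by (intro mult_left_mono order_trans[OF L abs_ge_self]) (use that in auto)
      finally show ?thesis by (simp add: mult.commute)
    qed
    finally show ?thesis using M that
      by (meson abs_ge_zero diff_ge_0_iff_ge less_imp_le mult_left_mono mult_nonneg_nonneg mult_right_mono norm_ge_zero order_trans)
  qed
  have "continuous_on {t1..} T"
    unfolding continuous_on
  proof
    fix t assume t: "t \<in> {t1..}"
    obtain M where M: "M \<ge> 1" and bound: "\<forall>s. 0 \<le> s \<longrightarrow> s \<le> t + 1 \<longrightarrow> norm (T s) \<le> M"
      using locally_bounded[of "t + 1"] by blast
    have "((\<lambda>s. M * (\<bar>L\<bar> * \<bar>s - t\<bar>)) \<longlongrightarrow> M * (\<bar>L\<bar> * \<bar>t - t\<bar>)) (at t within {t1..})"
      by (intro tendsto_intros)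
    then have lim: "((\<lambda>s. M * (\<bar>L\<bar> * \<bar>s - t\<bar>)) \<longlongrightarrow> 0) (at t within {t1..})" by simp
    have "\<forall>\<^sub>F s in at t within {t1..}. norm (T s - T t) \<le> M * (\<bar>L\<bar> * \<bar>s - t\<bar>)"
      unfolding eventually_at
    proof (intro exI[of _ 1] conjI ballI impI)
      fix s assume s: "s \<in> {t1..}" "s \<noteq> t \<and> dist s t < 1"
      show "norm (T s - T t) \<le> M * (\<bar>L\<bar> * \<bar>s - t\<bar>)"
      proof (cases "t < s")
        case True
        moreover have "norm (T (t - t1)) \<le> M" by (rule bound[rule_format]) (use t t1 in auto)
        ultimately show ?thesis
          using lip[of t s M] s t by (simp add: dist_real_def)
      next
        case False
        moreover have "norm (T (s - t1)) \<le> M"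
          by (rule bound[rule_format]) (use s t t1 False in auto)
        ultimately show ?thesis
          using lip[of s t M] s t by (simp add: dist_real_def norm_minus_commute[of "T s"])
      qed
    qed simp
    from Lim_null_comparison[OF this lim]
    show "(T \<longlongrightarrow> T t) (at t within {t1..})" by (simp add: LIM_zero_iff)
  qed
  then show ?thesis using t1 unfolding eventually_norm_continuous_def by blast
qed

end

theorem corollary5p1:
  fixes T :: "real \<Rightarrow> ('a::complex_banach \<Rightarrow>\<^sub>L 'a)" and A :: "'a operator"
  assumes "C0_semigroup T" and "A = generator T"
  shows
    "(uniformly_exponentially_stable T \<longrightarrow>
        {l. Re l \<ge> 0} \<subseteq> resolvent_set A \<and>
        bdd_above {norm (resolvent l A) | l. Re l \<ge> 0}) \<and>
     (scalar_type_spectral_semigroup T \<or> eventually_norm_continuous T \<longrightarrow>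
        {l. Re l \<ge> 0} \<subseteq> resolvent_set A \<and>
        bdd_above {norm (resolvent l A) | l. Re l \<ge> 0} \<longrightarrow>
        uniformly_exponentially_stable T) \<and>
     (eventually_compact T \<or> eventually_differentiable T \<or> analytic_semigroup T \<or>
        uniformly_continuous_semigroup T \<longrightarrow> eventually_norm_continuous T)"
proof -
  interpret c0_semigroup T by unfold_locales (rule assms(1))
  show ?thesis
    unfolding assms(2)
  proof (intro conjI impI)
    assume "uniformly_exponentially_stable T"
    from stable_imp_bounded_resolvent[OF this]
    show "{l. Re l \<ge> 0} \<subseteq> resolvent_set (generator T)"
      and "bdd_above {norm (resolvent l (generator T)) | l. Re l \<ge> 0}" .
  next
    assume "scalar_type_spectral_semigroup T \<or> eventually_norm_continuous T"
      and resolvent: "{l. Re l \<ge> 0} \<subseteq> resolvent_set (generator T) \<and>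
        bdd_above {norm (resolvent l (generator T)) | l. Re l \<ge> 0}"
    then show "uniformly_exponentially_stable T"
    proof (elim disjE)
      assume "scalar_type_spectral_semigroup T"
      then have "scalar_type_spectral (bounded_operator (T 1))"
        by (simp add: scalar_type_spectral_semigroup_def)
      then show ?thesis by (rule scalar_type_stable[OF _ conjunct1[OF resolvent] conjunct2[OF resolvent]])
    next
      assume "eventually_norm_continuous T"
      then show ?thesis
        by (rule eventually_norm_continuous_stable[OF _ conjunct1[OF resolvent] conjunct2[OF resolvent]])
    qed
  next
    assume "eventually_compact T \<or> eventually_differentiable T \<or> analytic_semigroup T \<or>
      uniformly_continuous_semigroup T"
    then show "eventually_norm_continuous T"
      using eventually_compact_imp_eventually_norm_continuous
        eventually_differentiable_imp_eventually_norm_continuous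
        analytic_imp_eventually_norm_continuous
        uniformly_continuous_imp_eventually_norm_continuous by (elim disjE) simp_all
  qed
qed

end
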